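(* Let $\{W(\mathbf{x}):\mathbf{x}\in\mathbb{R}^2\}$ be a real-valued centered stationary Gaussian random field with paths of class $\mathcal{C}^3$, such that $\mathrm{Var}(W'(\mathbf{0}))$ is invertible, such that $$\min\{\Delta(\mathbf{z}):\|\mathbf{z}\|=1\}>0,\qquad\text{where }\ \Delta(\mathbf{z})=\det\big[\mathrm{Var}\big(W''(\mathbf{0})\mathbf{z}\big)\big],\ \mathbf{z}\in\mathbb{R}^2,$$ and which is $\delta$-dependent for some $\delta>0$, i.e. $\mathbb{E}(W(\mathbf{x})W(\mathbf{y}))=0$ whenever $\|\mathbf{x}-\mathbf{y}\|>\delta$. For $k>0$ let $SP_2(\mathbb{R}^2)=\#\{\mathbf{x}\in\mathbb{R}^2: W'(\mathbf{x})=k\mathbf{x}\}$. Then there is a constant $L>0$ depending only on the law of the field such that, for all $k>0$ small enough, $$\mathrm{Var}\big(SP_2(\mathbb{R}^2)\big)\le\frac{L}{k^2}.$$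
   Context: $W'(\mathbf{x})=(W_x,W_y)^T$ is the gradient and $W''(\mathbf{0})$ is the $2\times2$ Hessian matrix at the origin, so $W''(\mathbf{0})\mathbf{z}$ is a Gaussian vector in $\mathbb{R}^2$. $SP_2(\mathbb{R}^2)$ is the number of approximate (Longuet-Higgins) specular points of the random surface. *)

theory Defs
  imports "HOL-Probability.Probability"
begin

definition pd :: "2 \<Rightarrow> (real^2 \<Rightarrow> real) \<Rightarrow> real^2 \<Rightarrow> real" where
  "pd i f x = deriv (\<lambda>t. f (x + t *\<^sub>R axis i 1)) 0"

fun Ck :: "nat \<Rightarrow> (real^2 \<Rightarrow> real) \<Rightarrow> bool" where
  "Ck 0 f = continuous_on UNIV f"
| "Ck (Suc k) f = (continuous_on UNIV f \<and>
     (\<forall>i. (\<forall>x. (\<lambda>t. f (x + t *\<^sub>R axis i 1)) differentiable (at 0)) \<and> Ck k (pd i f)))"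

definition grad :: "(real^2 \<Rightarrow> real) \<Rightarrow> real^2 \<Rightarrow> real^2" where
  "grad f x = (\<chi> i. pd i f x)"

definition hess :: "(real^2 \<Rightarrow> real) \<Rightarrow> real^2 \<Rightarrow> real^2^2" where
  "hess f x = (\<chi> i j. pd j (pd i f) x)"

definition covmat :: "'a measure \<Rightarrow> ('a \<Rightarrow> real^2) \<Rightarrow> real^2^2" where
  "covmat M X = (\<chi> i j. (\<integral>\<omega>. X \<omega> $ i * X \<omega> $ j \<partial>M)
                        - (\<integral>\<omega>. X \<omega> $ i \<partial>M) * (\<integral>\<omega>. X \<omega> $ j \<partial>M))"

definition centered_gaussian_field :: "'a measure \<Rightarrow> ('a \<Rightarrow> real^2 \<Rightarrow> real) \<Rightarrow> bool" where
  "centered_gaussian_field M W \<longleftrightarrow>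
     (\<forall>x. (\<lambda>\<omega>. W \<omega> x) \<in> borel_measurable M) \<and>
     (\<forall>(n::nat) (xs::nat \<Rightarrow> real^2) (c::nat \<Rightarrow> real).
        (AE \<omega> in M. (\<Sum>i<n. c i * W \<omega> (xs i)) = 0) \<or>
        (\<exists>\<sigma>>0. distributed M lborel (\<lambda>\<omega>. \<Sum>i<n. c i * W \<omega> (xs i)) (normal_density 0 \<sigma>)))"

definition stationary_field :: "'a measure \<Rightarrow> ('a \<Rightarrow> real^2 \<Rightarrow> real) \<Rightarrow> bool" where
  "stationary_field M W \<longleftrightarrow>
     (\<forall>(n::nat) (xs::nat \<Rightarrow> real^2) h.
        distr M (PiM {..<n} (\<lambda>_. borel)) (\<lambda>\<omega>. \<lambda>i\<in>{..<n}. W \<omega> (xs i + h))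
      = distr M (PiM {..<n} (\<lambda>_. borel)) (\<lambda>\<omega>. \<lambda>i\<in>{..<n}. W \<omega> (xs i)))"

definition delta_dependent :: "'a measure \<Rightarrow> ('a \<Rightarrow> real^2 \<Rightarrow> real) \<Rightarrow> real \<Rightarrow> bool" where
  "delta_dependent M W \<delta> \<longleftrightarrow>
     (\<forall>x y. norm (x - y) > \<delta> \<longrightarrow> (\<integral>\<omega>. W \<omega> x * W \<omega> y \<partial>M) = 0)"

definition SP2 :: "('a \<Rightarrow> real^2 \<Rightarrow> real) \<Rightarrow> real \<Rightarrow> 'a \<Rightarrow> (real^2) set" where
  "SP2 W k \<omega> = {x. grad (W \<omega>) x = k *\<^sub>R x}"

end

theory Submission
  imports Defs
begin

text \<open>
  Let \<open>N\<close> be the number of zeros of \<open>F x = W' x - k x\<close> in a unit square and let \<open>K\<close> bound the second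
  and third derivatives of \<open>W\<close> near it. Zeros at which \<open>F'\<close> has size \<open>s\<close> lie, at scale \<open>s / K\<close>, along a single curve,
  on which a zero \<open>x\<close> is isolated at scale \<open>\<bar>det (F' x)\<bar> / (s K)\<close>. Packing these neighbourhoods
  gives \<open>\<Sum> \<bar>det (F' x)\<bar> \<le> C K\<^sup>2\<close>, so that \<open>N\<^sup>2 \<le> C K\<^sup>2 (\<Sum> 1 / \<bar>det (F' x)\<bar>)\<close> by Cauchy--Schwarz.
  The last sum is at most a constant times the lower limit of the area of \<open>{\<bar>F\<bar> \<le> \<epsilon>}\<close> divided by \<open>\<epsilon>\<^sup>2\<close>,
  in which no determinant occurs any more.

  By Gaussian regression on \<open>W' x\<close>, the bound \<open>K\<close> is controlled by \<open>W' x\<close> and by a supremum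
  independent of \<open>W' x\<close>, which is square integrable by Fernique's argument. As \<open>W' x\<close> has a Gaussian
  density, Fatou's lemma gives \<open>E N\<^sup>2 \<le> C exp (- k (\<bar>p\<^sub>1\<bar> + \<bar>p\<^sub>2\<bar>))\<close> in the unit square at \<open>p\<close>.
  Counts in distant squares are independent, so the variance of the total count is at most a
  constant times the sum of these second moments, which is of order \<open>1 / k\<^sup>2\<close>.
\<close>

section \<open>Joint characteristic functions\<close>

text \<open>The obstacle is a zero at which \<open>F'\<close> is almost singular: other zeros may
  lie close to it, and no bound on \<open>1 / \<bar>det\<bar>\<close> is at hand. The two sums in
  the Cauchy--Schwarz step are matched to this. A small Jacobian makes a zero light in the first
  sum, and its large weight in the second one is geometric: it is the area of the parallelogram on
  which the linear part of \<open>F\<close> stays small. The expectation of an area is computed by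
  Fubini, so within a cell only the joint law of \<open>K\<close> and the gradient at one point is
  needed, never that of the gradients at two points.

  The Gaussian density decays faster than any exponential. Rate 2 is kept, and one unit of it pays
  for the growth of the conditioned bound on \<open>K\<close>. The sum of
  \<open>exp (- k * \<bar>a\<bar>)\<close> over the integers is of order \<open>1 / k\<close>, once
  for each coordinate.

  Counts take values in the extended reals, so that finiteness is a result of the bound. Joint laws
  are compared on rectangles with countably many sides, enough for suprema over dense sets.\<close>

lemma char_distr_density:
  fixes X :: "'a \<Rightarrow> real"
  assumes [measurable]: "X \<in> borel_measurable M" "f \<in> borel_measurable M"
    and "\<And>\<omega>. 0 \<le> f \<omega>"
  shows "char (distr (density M (\<lambda>\<omega>. ennreal (f \<omega>))) borel X) t
       = (CLINT \<omega>|M. complex_of_real (f \<omega>) * iexp (t * X \<omega>))"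
proof -
  have "char (distr (density M (\<lambda>\<omega>. ennreal (f \<omega>))) borel X) t
      = (CLINT \<omega>|density M (\<lambda>\<omega>. ennreal (f \<omega>)). iexp (t * X \<omega>))"
    unfolding char_def by (subst integral_distr) auto
  also have "\<dots> = (CLINT \<omega>|M. f \<omega> *\<^sub>R iexp (t * X \<omega>))"
    using assms by (subst integral_density) auto
  finally show ?thesis by (simp add: scaleR_conv_of_real)
qed

lemma integrable_bounded_complex:
  fixes f :: "'a \<Rightarrow> complex"
  assumes "prob_space M" "f \<in> borel_measurable M" "\<And>\<omega>. cmod (f \<omega>) \<le> c"
  shows "integrable M f"
proof -
  interpret prob_space M by fact
  show ?thesis using assms by (intro integrable_const_bound[of _ c]) auto
qed

text \<open>Normalised by their common mass \<open>c\<close> (the hypothesis at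
  \<open>t = 0\<close>), the weights become probability densities, and Levy's theorem identifies the
  image measures under \<open>X\<close> and \<open>X'\<close>. Mass zero cannot be normalised, but
  then both weights vanish almost everywhere. The bound 2 leaves room for the weights
  \<open>1 + cos\<close> and \<open>1 + sin\<close>.\<close>

lemma weighted_char_unique:
  fixes X :: "'a \<Rightarrow> real" and X' :: "'b \<Rightarrow> real"
  assumes M: "prob_space M" and N: "prob_space N"
    and X[measurable]: "X \<in> borel_measurable M" "X' \<in> borel_measurable N"
    and f[measurable]: "f \<in> borel_measurable M" "f' \<in> borel_measurable N"
    and b: "\<And>\<omega>. 0 \<le> f \<omega> \<and> f \<omega> \<le> 2" "\<And>\<omega>. 0 \<le> f' \<omega> \<and> f' \<omega> \<le> 2"
    and eq: "\<And>t. (CLINT \<omega>|M. complex_of_real (f \<omega>) * iexp (t * X \<omega>))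
               = (CLINT \<omega>|N. complex_of_real (f' \<omega>) * iexp (t * X' \<omega>))"
    and A[measurable]: "A \<in> sets borel"
  shows "(LINT \<omega>|M. f \<omega> * indicator A (X \<omega>)) = (LINT \<omega>|N. f' \<omega> * indicator A (X' \<omega>))"
proof -
  interpret M: prob_space M by fact
  interpret N: prob_space N by fact
  define c where "c = (LINT \<omega>|M. f \<omega>)"
  have c': "c = (LINT \<omega>|N. f' \<omega>)"
    using eq[of 0] unfolding c_def by (simp flip: of_real_eq_iff[where 'a=complex] integral_complex_of_real)
  have i: "integrable M f" "integrable N f'"
    using b by (auto intro!: M.integrable_const_bound[of _ 2] N.integrable_const_bound[of _ 2])
  have ii: "integrable M (\<lambda>\<omega>. f \<omega> * indicator B (X \<omega>))" "integrable N (\<lambda>\<omega>. f' \<omega> * indicator B (X' \<omega>))"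
    if [measurable]: "B \<in> sets borel" for B
    using b by (auto intro!: M.integrable_const_bound[of _ 2] N.integrable_const_bound[of _ 2] simp: indicator_def)
  have "c \<ge> 0" unfolding c_def using b by (intro Bochner_Integration.integral_nonneg) auto
  show ?thesis
  proof (cases "c = 0")
    case True
    have "AE \<omega> in M. f \<omega> = 0" using True i b unfolding c_def by (subst (asm) integral_nonneg_eq_0_iff_AE) auto
    then have "(LINT \<omega>|M. f \<omega> * indicator A (X \<omega>)) = (LINT \<omega>|M. 0)"
      by (intro integral_cong_AE) auto
    moreover have "AE \<omega> in N. f' \<omega> = 0" using True i b unfolding c' by (subst (asm) integral_nonneg_eq_0_iff_AE) auto
    then have "(LINT \<omega>|N. f' \<omega> * indicator A (X' \<omega>)) = (LINT \<omega>|N. 0)"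
      by (intro integral_cong_AE) auto
    ultimately show ?thesis by simp
  next
    case False
    with \<open>c \<ge> 0\<close> have c: "c > 0" by simp
    define D where "D = distr (density M (\<lambda>\<omega>. ennreal (f \<omega> / c))) borel X"
    define D' where "D' = distr (density N (\<lambda>\<omega>. ennreal (f' \<omega> / c))) borel X'"
    have e1: "emeasure D B = ennreal ((LINT \<omega>|M. f \<omega> * indicator B (X \<omega>)) / c)" if [measurable]: "B \<in> sets borel" for B
    proof -
      have "emeasure D B = (\<integral>\<^sup>+\<omega>. ennreal (f \<omega> / c) * indicator (X -` B \<inter> space M) \<omega> \<partial>M)"
        unfolding D_def by (subst emeasure_distr) (auto simp: emeasure_density)
      also have "\<dots> = (\<integral>\<^sup>+\<omega>. ennreal (f \<omega> * indicator B (X \<omega>) / c) \<partial>M)"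
        by (intro nn_integral_cong) (auto simp: indicator_def)
      also have "\<dots> = ennreal (LINT \<omega>|M. f \<omega> * indicator B (X \<omega>) / c)"
        using b c ii[OF that] by (intro nn_integral_eq_integral) auto
      finally show ?thesis by simp
    qed
    have e2: "emeasure D' B = ennreal ((LINT \<omega>|N. f' \<omega> * indicator B (X' \<omega>)) / c)" if [measurable]: "B \<in> sets borel" for B
    proof -
      have "emeasure D' B = (\<integral>\<^sup>+\<omega>. ennreal (f' \<omega> / c) * indicator (X' -` B \<inter> space N) \<omega> \<partial>N)"
        unfolding D'_def by (subst emeasure_distr) (auto simp: emeasure_density)
      also have "\<dots> = (\<integral>\<^sup>+\<omega>. ennreal (f' \<omega> * indicator B (X' \<omega>) / c) \<partial>N)"
        by (intro nn_integral_cong) (auto simp: indicator_def)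
      also have "\<dots> = ennreal (LINT \<omega>|N. f' \<omega> * indicator B (X' \<omega>) / c)"
        using b c ii[OF that] by (intro nn_integral_eq_integral) auto
      finally show ?thesis by simp
    qed
    have "prob_space D" using c e1[of UNIV] by (intro prob_spaceI) (auto simp: D_def c_def)
    moreover have "prob_space D'" using c e2[of UNIV] by (intro prob_spaceI) (auto simp: D'_def c')
    ultimately have rd: "real_distribution D" "real_distribution D'"
      by (auto simp: real_distribution_def real_distribution_axioms_def D_def D'_def)
    have "char D = char D'"
    proof
      fix t
      have "char D t = (CLINT \<omega>|M. complex_of_real (f \<omega> / c) * iexp (t * X \<omega>))"
        unfolding D_def using b c by (intro char_distr_density) auto
      also have "\<dots> = (CLINT \<omega>|M. complex_of_real (f \<omega>) * iexp (t * X \<omega>)) / c"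
        by simp
      also have "\<dots> = (CLINT \<omega>|N. complex_of_real (f' \<omega>/c) * iexp (t * X' \<omega>))"
        using eq[of t] by simp
      also have "\<dots> = char D' t"
        unfolding D'_def using b c by (intro char_distr_density[symmetric]) auto
      finally show "char D t = char D' t" .
    qed
    then have "D = D'" by (intro Levy_uniqueness rd)
    with e1[OF A] e2[OF A] have "ennreal ((LINT \<omega>|M. f \<omega> * indicator A (X \<omega>)) / c) = ennreal ((LINT \<omega>|N. f' \<omega> * indicator A (X' \<omega>)) / c)" by simp
    then show ?thesis using c b by (subst (asm) ennreal_inj) (auto intro!: Bochner_Integration.integral_nonneg)
  qed
qed

text \<open>Euler's formula turns a trigonometric weight into integrals against \<open>1\<close>,
  \<open>iexp Y\<close> and \<open>iexp (- Y)\<close>, which a joint characteristic function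
  controls.\<close>

lemma CLINT_cos_sin:
  fixes b Y :: "'a \<Rightarrow> real" and z :: "'a \<Rightarrow> complex"
  assumes "prob_space M" and [measurable]: "b \<in> borel_measurable M" "Y \<in> borel_measurable M" "z \<in> borel_measurable M"
    and b: "\<And>\<omega>. 0 \<le> b \<omega> \<and> b \<omega> \<le> 1" and z: "\<And>\<omega>. cmod (z \<omega>) = 1"
  shows "(CLINT \<omega>|M. complex_of_real (b \<omega> * (1 + cos (Y \<omega>))) * z \<omega>)
      = (CLINT \<omega>|M. b \<omega> * z \<omega>) + ((CLINT \<omega>|M. b \<omega> * z \<omega> * iexp (Y \<omega>)) + (CLINT \<omega>|M. b \<omega> * z \<omega> * iexp (- Y \<omega>))) / 2" (is ?A)
   and "(CLINT \<omega>|M. complex_of_real (b \<omega> * (1 + sin (Y \<omega>))) * z \<omega>)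
      = (CLINT \<omega>|M. b \<omega> * z \<omega>) + ((CLINT \<omega>|M. b \<omega> * z \<omega> * iexp (Y \<omega>)) - (CLINT \<omega>|M. b \<omega> * z \<omega> * iexp (- Y \<omega>))) / (2 * \<i>)" (is ?B)
proof -
  have i: "integrable M (\<lambda>\<omega>. b \<omega> * z \<omega>)" "integrable M (\<lambda>\<omega>. b \<omega> * z \<omega> * iexp (Y \<omega>))"
     "integrable M (\<lambda>\<omega>. b \<omega> * z \<omega> * iexp (- Y \<omega>))"
    using b z by (auto intro!: integrable_bounded_complex[OF assms(1), where c=1] simp: norm_mult)
  have c: "complex_of_real (cos y) = (iexp y + iexp (- y)) / 2" "complex_of_real (sin y) = (iexp y - iexp (- y)) / (2 * \<i>)" for y :: real
    by (simp_all add: cos_of_real[symmetric] sin_of_real[symmetric] cos_exp_eq sin_exp_eq)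
  have "(\<lambda>\<omega>. complex_of_real (b \<omega> * (1 + cos (Y \<omega>))) * z \<omega>) = 
     (\<lambda>\<omega>. b \<omega> * z \<omega> + (b \<omega> * z \<omega> * iexp (Y \<omega>) + b \<omega> * z \<omega> * iexp (- Y \<omega>)) / 2)"
    by (rule ext) (simp only: of_real_mult of_real_add of_real_1 c, simp add: field_simps)
  then show ?A using i by simp
  have "(\<lambda>\<omega>. complex_of_real (b \<omega> * (1 + sin (Y \<omega>))) * z \<omega>) = 
     (\<lambda>\<omega>. b \<omega> * z \<omega> + (b \<omega> * z \<omega> * iexp (Y \<omega>) - b \<omega> * z \<omega> * iexp (- Y \<omega>)) / (2*\<i>))"
    by (rule ext) (simp only: of_real_mult of_real_add of_real_1 c, simp add: field_simps)
  then show ?B using i by simp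
qed

text \<open>Levy's uniqueness theorem needs positive weights, and \<open>exp (\<i> Y)\<close> is a linear combination of the
  weights \<open>1\<close>, \<open>1 + cos Y\<close> and \<open>1 + sin Y\<close>. This allows to treat one coordinate at a time.\<close>

lemma weighted_char_unique_step:
  fixes X Y :: "'a \<Rightarrow> real" and X' Y' :: "'b \<Rightarrow> real"
  assumes M: "prob_space M" and N: "prob_space N"
    and X[measurable]: "X \<in> borel_measurable M" "X' \<in> borel_measurable N"
    and Y[measurable]: "Y \<in> borel_measurable M" "Y' \<in> borel_measurable N"
    and f[measurable]: "f \<in> borel_measurable M" "f' \<in> borel_measurable N"
    and b: "\<And>\<omega>. 0 \<le> f \<omega> \<and> f \<omega> \<le> 1" "\<And>\<omega>. 0 \<le> f' \<omega> \<and> f' \<omega> \<le> 1"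
    and eq: "\<And>s t. (CLINT \<omega>|M. complex_of_real (f \<omega>) * iexp (t * X \<omega>) * iexp (s * Y \<omega>))
               = (CLINT \<omega>|N. complex_of_real (f' \<omega>) * iexp (t * X' \<omega>) * iexp (s * Y' \<omega>))"
    and A[measurable]: "A \<in> sets borel"
  shows "(CLINT \<omega>|M. complex_of_real (f \<omega> * indicator A (X \<omega>)) * iexp (Y \<omega>))
       = (CLINT \<omega>|N. complex_of_real (f' \<omega> * indicator A (X' \<omega>)) * iexp (Y' \<omega>))"
proof -
  \<comment> \<open>The frequencies 0, 1 and -1 of \<open>Y\<close> are those in Euler's formula;
    the frequency of \<open>X\<close> stays free for the uniqueness theorem.\<close>
  note eq0 = eq[of _ 0, simplified] and eq1 = eq[of _ 1, simplified] and eqm = eq[of _ "-1", simplified]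
  have b0: "\<And>\<omega>. 0 \<le> f \<omega> \<and> f \<omega> \<le> 2" "\<And>\<omega>. 0 \<le> f' \<omega> \<and> f' \<omega> \<le> 2"
    using b by (auto intro: order_trans[of _ 1])
  have bc: "0 \<le> g * (1 + h) \<and> g * (1 + h) \<le> 2" if "0 \<le> g \<and> g \<le> 1" "-1 \<le> h" "h \<le> 1" for g h :: real
    using that mult_mono[of g 1 "1+h" 2] by auto
  have 1: "(LINT \<omega>|M. f \<omega> * indicator A (X \<omega>)) = (LINT \<omega>|N. f' \<omega> * indicator A (X' \<omega>))"
    using b0 eq0 by (intro weighted_char_unique[OF M N]) auto
  have 2: "(LINT \<omega>|M. f \<omega> * (1 + cos (Y \<omega>)) * indicator A (X \<omega>)) = (LINT \<omega>|N. f' \<omega> * (1 + cos (Y' \<omega>)) * indicator A (X' \<omega>))"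
    proof (rule weighted_char_unique[OF M N])
    fix t
    show "(CLINT \<omega>|M. complex_of_real (f \<omega> * (1 + cos (Y \<omega>))) * iexp (t * X \<omega>))
       = (CLINT \<omega>|N. complex_of_real (f' \<omega> * (1 + cos (Y' \<omega>))) * iexp (t * X' \<omega>))"
      using b eq0[of t] eq1[of t] eqm[of t] by (subst (1 2) CLINT_cos_sin) (auto simp: M N)
  qed (use bc[OF b(1) cos_ge_minus_one cos_le_one] bc[OF b(2) cos_ge_minus_one cos_le_one] in auto)
  have 3: "(LINT \<omega>|M. f \<omega> * (1 + sin (Y \<omega>)) * indicator A (X \<omega>)) = (LINT \<omega>|N. f' \<omega> * (1 + sin (Y' \<omega>)) * indicator A (X' \<omega>))"
    proof (rule weighted_char_unique[OF M N])
    fix t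
    show "(CLINT \<omega>|M. complex_of_real (f \<omega> * (1 + sin (Y \<omega>))) * iexp (t * X \<omega>))
       = (CLINT \<omega>|N. complex_of_real (f' \<omega> * (1 + sin (Y' \<omega>))) * iexp (t * X' \<omega>))"
      using b eq0[of t] eq1[of t] eqm[of t] by (subst (1 2) CLINT_cos_sin) (auto simp: M N)
  qed (use bc[OF b(1) sin_ge_minus_one sin_le_one] bc[OF b(2) sin_ge_minus_one sin_le_one] in auto)
  \<comment> \<open>Real and imaginary part are recovered by subtracting the constant weight from
    the two trigonometric ones.\<close>
  have *: "(CLINT \<omega>|M. complex_of_real (f \<omega> * indicator A (X \<omega>)) * iexp (Y \<omega>))
    = Complex ((LINT \<omega>|M. f \<omega> * (1 + cos (Y \<omega>)) * indicator A (X \<omega>)) - (LINT \<omega>|M. f \<omega> * indicator A (X \<omega>)))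
        ((LINT \<omega>|M. f \<omega> * (1 + sin (Y \<omega>)) * indicator A (X \<omega>)) - (LINT \<omega>|M. f \<omega> * indicator A (X \<omega>)))"
    if M: "prob_space M" and [measurable]: "X \<in> borel_measurable M" "Y \<in> borel_measurable M" "f \<in> borel_measurable M"
      and b: "\<And>\<omega>. 0 \<le> f \<omega> \<and> f \<omega> \<le> 1" for M :: "'x measure" and f X Y
  proof -
    interpret prob_space M by fact
    have i: "integrable M (\<lambda>\<omega>. f \<omega> * indicator A (X \<omega>))"
      using b by (intro integrable_const_bound[of _ 1]) (auto simp: indicator_def)
    have i2: "integrable M (\<lambda>\<omega>. f \<omega> * (1 + cos (Y \<omega>)) * indicator A (X \<omega>))" "integrable M (\<lambda>\<omega>. f \<omega> * (1 + sin (Y \<omega>)) * indicator A (X \<omega>))"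
      using bc[OF b cos_ge_minus_one cos_le_one] bc[OF b sin_ge_minus_one sin_le_one] 
      by (auto intro!: integrable_const_bound[of _ 2] AE_I2 simp: indicator_def simp del: abs_mult)
    have i3: "integrable M (\<lambda>\<omega>. complex_of_real (f \<omega> * indicator A (X \<omega>)) * iexp (Y \<omega>))"
      using b by (auto intro!: integrable_bounded_complex[OF M, where c=1] simp: norm_mult indicator_def)
    show ?thesis
      unfolding complex_eq_iff
      using i i2 i3
      by (simp flip: integral_Re integral_Im Bochner_Integration.integral_diff add: Re_exp Im_exp algebra_simps del: of_real_mult)
  qed
  show ?thesis
    by (subst (1 2) *) (use M N b 1 2 3 in auto)
qed

text \<open>Induction moves one coordinate at a time from the exponential into the weight, where it
  becomes an indicator. This is why the statement carries arbitrary weights; they stay between 0 and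
  1.\<close>

lemma weighted_char_rectangle:
  fixes X :: "nat \<Rightarrow> 'a \<Rightarrow> real" and X' :: "nat \<Rightarrow> 'b \<Rightarrow> real"
  assumes M: "prob_space M" and N: "prob_space N"
    and X[measurable]: "\<And>i. X i \<in> borel_measurable M" "\<And>i. X' i \<in> borel_measurable N"
    and A[measurable]: "\<And>i. A i \<in> sets borel"
    and "f \<in> borel_measurable M" "f' \<in> borel_measurable N"
    and "\<And>\<omega>. 0 \<le> f \<omega> \<and> f \<omega> \<le> 1" "\<And>\<omega>. 0 \<le> f' \<omega> \<and> f' \<omega> \<le> 1"
    and "\<And>t. (CLINT \<omega>|M. complex_of_real (f \<omega>) * iexp (\<Sum>i<n. t i * X i \<omega>))
               = (CLINT \<omega>|N. complex_of_real (f' \<omega>) * iexp (\<Sum>i<n. t i * X' i \<omega>))"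
  shows "(LINT \<omega>|M. f \<omega> * (\<Prod>i<n. indicator (A i) (X i \<omega>))) = (LINT \<omega>|N. f' \<omega> * (\<Prod>i<n. indicator (A i) (X' i \<omega>)))"
  using assms(6-)
proof (induction n arbitrary: f f')
  case 0
  have "complex_of_real (LINT \<omega>|M. f \<omega>) = complex_of_real (LINT \<omega>|N. f' \<omega>)"
    using "0.prems"(5) by (simp flip: integral_complex_of_real)
  then show ?case by simp
next
  case (Suc n)
  note [measurable] = Suc.prems(1,2)
  have "(CLINT \<omega>|M. complex_of_real (f \<omega> * indicator (A n) (X n \<omega>)) * iexp (\<Sum>i<n. t i * X i \<omega>))
      = (CLINT \<omega>|N. complex_of_real (f' \<omega> * indicator (A n) (X' n \<omega>)) * iexp (\<Sum>i<n. t i * X' i \<omega>))" for t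
  proof (rule weighted_char_unique_step[OF M N])
    fix s r :: real
    \<comment> \<open>Frequency \<open>r\<close> on the new coordinate, and the old frequencies
      scaled by the parameter \<open>s\<close> that the one-coordinate step varies.\<close>
    have e: "(\<Sum>i<Suc n. (if i = n then r else s * t i) * x i) = r * x n + s * (\<Sum>i<n. t i * x i)" for x :: "nat \<Rightarrow> real"
      by (simp add: sum_distrib_left mult.assoc cong: sum.cong_simp)
    show "(CLINT \<omega>|M. complex_of_real (f \<omega>) * iexp (r * X n \<omega>) * iexp (s * (\<Sum>i<n. t i * X i \<omega>)))
       = (CLINT \<omega>|N. complex_of_real (f' \<omega>) * iexp (r * X' n \<omega>) * iexp (s * (\<Sum>i<n. t i * X' i \<omega>)))"
      using Suc.prems(5)[of "\<lambda>i. if i = n then r else s * t i"] unfolding e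
      by (simp add: exp_add distrib_left mult.assoc)
  qed (use Suc.prems in auto)
  then have "(LINT \<omega>|M. f \<omega> * indicator (A n) (X n \<omega>) * (\<Prod>i<n. indicator (A i) (X i \<omega>))) = (LINT \<omega>|N. f' \<omega> * indicator (A n) (X' n \<omega>) * (\<Prod>i<n. indicator (A i) (X' i \<omega>)))"
    using Suc.prems(3,4) by (intro Suc.IH) (auto simp: indicator_def)
  then show ?case by (simp add: mult_ac)
qed

text \<open>Countably many constraints follow from finitely many by continuity from above. Countable
  rectangles are the form in which bounds on a supremum and pairs of interleaved families appear
  later.\<close>

theorem char_rectangle:
  fixes X :: "nat \<Rightarrow> 'a \<Rightarrow> real" and X' :: "nat \<Rightarrow> 'b \<Rightarrow> real"
  assumes M: "prob_space M" and N: "prob_space N"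
    and X[measurable]: "\<And>i. X i \<in> borel_measurable M" "\<And>i. X' i \<in> borel_measurable N"
    and A[measurable]: "\<And>i. A i \<in> sets borel"
    and eq: "\<And>n t. (CLINT \<omega>|M. iexp (\<Sum>i<n. t i * X i \<omega>)) = (CLINT \<omega>|N. iexp (\<Sum>i<n. t i * X' i \<omega>))"
  shows "measure M {\<omega>\<in>space M. \<forall>i. X i \<omega> \<in> A i} = measure N {\<omega>\<in>space N. \<forall>i. X' i \<omega> \<in> A i}"
proof -
  have lim: "(\<lambda>n. LINT \<omega>|M. (\<Prod>i<n. indicator (A i) (X i \<omega>))) \<longlonglongrightarrow> measure M {\<omega>\<in>space M. \<forall>i. X i \<omega> \<in> A i}"
    if M: "prob_space M" and [measurable]: "\<And>i. X i \<in> borel_measurable M" for M :: "'x measure" and X :: "nat \<Rightarrow> 'x \<Rightarrow> real"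
  proof -
    interpret prob_space M by fact
    have 1: "(LINT \<omega>|M. (\<Prod>i<n. indicator (A i) (X i \<omega>))) = measure M {\<omega>\<in>space M. \<forall>i<n. X i \<omega> \<in> A i}" for n
    proof -
      have "(LINT \<omega>|M. (\<Prod>i<n. indicator (A i) (X i \<omega>) :: real)) = (LINT \<omega>|M. indicator {\<omega>\<in>space M. \<forall>i<n. X i \<omega> \<in> A i} \<omega>)"
      proof (rule Bochner_Integration.integral_cong)
        fix \<omega> assume "\<omega> \<in> space M"
        then show "(\<Prod>i<n. indicator (A i) (X i \<omega>) :: real) = indicator {\<omega>\<in>space M. \<forall>i<n. X i \<omega> \<in> A i} \<omega>"
          by (induction n) (auto simp: indicator_def less_Suc_eq split: if_splits)
      qed simp
      also have "\<dots> = measure M ({\<omega>\<in>space M. \<forall>i<n. X i \<omega> \<in> A i} \<inter> space M)" by (rule Bochner_Integration.integral_indicator)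
      finally show ?thesis by (simp add: Int_absorb2 subset_eq)
    qed
    have "(\<lambda>n. measure M {\<omega>\<in>space M. \<forall>i<n. X i \<omega> \<in> A i}) \<longlonglongrightarrow> measure M (\<Inter>n. {\<omega>\<in>space M. \<forall>i<n. X i \<omega> \<in> A i})"
      by (rule finite_Lim_measure_decseq) (auto simp: decseq_def)
    moreover have "(\<Inter>n. {\<omega>\<in>space M. \<forall>i<n. X i \<omega> \<in> A i}) = {\<omega>\<in>space M. \<forall>i. X i \<omega> \<in> A i}" by auto
    ultimately show ?thesis by (simp add: 1)
  qed
  have "(LINT \<omega>|M. (\<Prod>i<n. indicator (A i) (X i \<omega>)) :: real) = (LINT \<omega>|N. (\<Prod>i<n. indicator (A i) (X' i \<omega>)))" for n
  proof -
    have "(LINT \<omega>|M. (1::real) * (\<Prod>i<n. indicator (A i) (X i \<omega>))) = (LINT \<omega>|N. 1 * (\<Prod>i<n. indicator (A i) (X' i \<omega>)))"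
      by (rule weighted_char_rectangle[OF M N X A, where f="\<lambda>_. 1" and f'="\<lambda>_. 1" and n=n]) (simp_all only: eq of_real_1 mult_1 borel_measurable_const zero_le_one order_refl simp_thms)
    then show ?thesis by simp
  qed
  then show ?thesis
    using lim[of M X, OF M X(1)] lim[of N X', OF N X(2)] by (auto intro: LIMSEQ_unique)
qed

section \<open>Gaussian spaces\<close>

text \<open>Defined through the characteristic function, so that the degenerate law is included and
  pointwise limits reduce to dominated convergence.\<close>

definition gauss_var :: "'a measure \<Rightarrow> ('a \<Rightarrow> real) \<Rightarrow> real \<Rightarrow> bool" where
  "gauss_var M X v \<longleftrightarrow> X \<in> borel_measurable M \<and> v \<ge> 0 \<and>
     (\<forall>t. (CLINT \<omega>|M. iexp (t * X \<omega>)) = complex_of_real (exp (- (t\<^sup>2 * v) / 2)))"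

definition gauss :: "'a measure \<Rightarrow> ('a \<Rightarrow> real) \<Rightarrow> bool" where
  "gauss M X \<longleftrightarrow> (\<exists>v. gauss_var M X v)"

lemma char_std_normal_scaled:
  "char (distr std_normal_distribution borel (\<lambda>x. s * x)) t = complex_of_real (exp (- (t\<^sup>2 * s\<^sup>2) / 2))"
proof -
  interpret S: real_distribution std_normal_distribution by (rule real_dist_normal_dist)
  have "char (distr std_normal_distribution borel (\<lambda>x. s * x)) t = char std_normal_distribution (t * s)"
    unfolding char_def by (subst integral_distr) (auto simp: mult.assoc)
  then show ?thesis by (simp add: char_std_normal_distribution power_mult_distrib)
qed

lemma (in prob_space) gauss_var_distributed:
  assumes G: "gauss_var M X v" and v: "v > 0"
  shows "distributed M lborel X (normal_density 0 (sqrt v))"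
proof -
  interpret S: real_distribution std_normal_distribution by (rule real_dist_normal_dist)
  have X[measurable]: "X \<in> borel_measurable M" using G by (simp add: gauss_var_def)
  have "distr M borel X = distr std_normal_distribution borel (\<lambda>x. sqrt v * x)"
  proof (rule Levy_uniqueness)
    show "char (distr M borel X) = char (distr std_normal_distribution borel (\<lambda>x. sqrt v * x))"
    proof
      fix t
      have "char (distr M borel X) t = (CLINT \<omega>|M. iexp (t * X \<omega>))"
        unfolding char_def by (subst integral_distr) auto
      then show "char (distr M borel X) t = char (distr std_normal_distribution borel (\<lambda>x. sqrt v * x)) t"
        using G v by (simp add: char_std_normal_scaled gauss_var_def)
    qed
  qed auto
  moreover have "distributed std_normal_distribution lborel (\<lambda>x. 0 + sqrt v * x) (normal_density (0 + sqrt v * 0) (\<bar>sqrt v\<bar> * 1))"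
    by (rule S.normal_density_affine) (use v in \<open>auto simp: distributed_def intro!: distr_id2\<close>)
  then have "distr std_normal_distribution lborel (\<lambda>x. sqrt v * x) = density lborel (normal_density 0 (sqrt v))"
    using v by (simp add: distributed_def)
  moreover have "distr std_normal_distribution borel (\<lambda>x. sqrt v * x) = distr std_normal_distribution lborel (\<lambda>x. sqrt v * x)"
     "distr M borel X = distr M lborel X"
    by (auto intro!: distr_cong)
  ultimately show ?thesis by (simp add: distributed_def)
qed

lemma (in prob_space) gauss_var_0:
  assumes G: "gauss_var M X 0"
  shows "AE \<omega> in M. X \<omega> = 0"
proof -
  have X[measurable]: "X \<in> borel_measurable M" using G by (simp add: gauss_var_def)
  have "distr M borel X = return borel 0"
  proof (rule Levy_uniqueness)
    show "real_distribution (return borel (0::real))"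
      by (auto simp: real_distribution_def real_distribution_axioms_def intro: prob_space_return)
    show "char (distr M borel X) = char (return borel 0)"
    proof
      fix t
      have "char (distr M borel X) t = (CLINT \<omega>|M. iexp (t * X \<omega>))"
        unfolding char_def by (subst integral_distr) auto
      then show "char (distr M borel X) t = char (return borel 0) t"
        using G by (simp add: gauss_var_def char_def integral_return)
    qed
  qed auto
  moreover have "AE x in return borel (0::real). x = 0" by (subst AE_return) auto
  ultimately have "AE x in distr M borel X. x = 0" by (simp only:)
  then show ?thesis by (subst (asm) AE_distr_iff) auto
qed

text \<open>Variance 0 has no density and is settled almost everywhere; otherwise the moments are
  those of the normal density.\<close>

lemma (in prob_space) gauss_var_moments:
  assumes G: "gauss_var M X v"
  shows "integrable M (\<lambda>\<omega>. (X \<omega>)\<^sup>2)" "expectation (\<lambda>\<omega>. (X \<omega>)\<^sup>2) = v" 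
    "integrable M X" "expectation X = 0"
proof -
  have X[measurable]: "X \<in> borel_measurable M" and v: "v \<ge> 0" using G by (auto simp: gauss_var_def)
  have "integrable M (\<lambda>\<omega>. (X \<omega>)\<^sup>2) \<and> expectation (\<lambda>\<omega>. (X \<omega>)\<^sup>2) = v \<and> integrable M X \<and> expectation X = 0"
  proof (cases "v = 0")
    case True
    have ae: "AE \<omega> in M. X \<omega> = 0" using G True by (auto intro: gauss_var_0)
    have ae2: "AE \<omega> in M. (X \<omega>)\<^sup>2 = 0" using ae by eventually_elim simp
    have "integrable M X" "integrable M (\<lambda>\<omega>. (X \<omega>)\<^sup>2)"
      using integrable_cong_AE[OF X _ ae] integrable_cong_AE[OF _ _ ae2] by auto
    moreover have "expectation X = 0" "expectation (\<lambda>\<omega>. (X \<omega>)\<^sup>2) = 0"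
      using integral_cong_AE[OF X _ ae] integral_cong_AE[OF _ _ ae2] by auto
    ultimately show ?thesis using True by simp
  next
    case False
    with v have v: "v > 0" by simp
    note D = gauss_var_distributed[OF G v]
    have "integrable lborel (\<lambda>x. normal_density 0 (sqrt v) x * (x - 0)^2)"
      using v by (intro integrable_normal_moment) auto
    then have 1: "integrable M (\<lambda>\<omega>. (X \<omega>)\<^sup>2)"
      using distributed_integrable[OF D, of "\<lambda>x. x^2"] by (auto simp: normal_density_nonneg)
    have "integrable lborel (\<lambda>x. normal_density 0 (sqrt v) x * (x - 0)^1)"
      using v by (intro integrable_normal_moment) auto
    then have 2: "integrable M X"
      using distributed_integrable[OF D, of "\<lambda>x. x"] by (auto simp: normal_density_nonneg)
    have 3: "expectation X = 0" using D v by (intro normal_distributed_expectation) auto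
    have "variance X = (sqrt v)\<^sup>2" by (rule normal_distributed_variance) (use D v in auto)
    with 1 2 3 v show ?thesis by simp
  qed
  then show "integrable M (\<lambda>\<omega>. (X \<omega>)\<^sup>2)" "expectation (\<lambda>\<omega>. (X \<omega>)\<^sup>2) = v" 
    "integrable M X" "expectation X = 0" by auto
qed

lemma (in prob_space) gaussD:
  assumes "gauss M X"
  shows "X \<in> borel_measurable M" "integrable M (\<lambda>\<omega>. (X \<omega>)\<^sup>2)" "integrable M X" "expectation X = 0"
    "gauss_var M X (expectation (\<lambda>\<omega>. (X \<omega>)\<^sup>2))"
    "(CLINT \<omega>|M. iexp (X \<omega>)) = complex_of_real (exp (- expectation (\<lambda>\<omega>. (X \<omega>)\<^sup>2) / 2))"
proof -
  obtain v where v: "gauss_var M X v" using assms by (auto simp: gauss_def)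
  note m = gauss_var_moments[OF v]
  show "X \<in> borel_measurable M" "integrable M (\<lambda>\<omega>. (X \<omega>)\<^sup>2)" "integrable M X" "expectation X = 0"
    using v m by (auto simp: gauss_var_def)
  show g: "gauss_var M X (expectation (\<lambda>\<omega>. (X \<omega>)\<^sup>2))" using v m by simp
  show "(CLINT \<omega>|M. iexp (X \<omega>)) = complex_of_real (exp (- expectation (\<lambda>\<omega>. (X \<omega>)\<^sup>2) / 2))"
    using g unfolding gauss_var_def by (auto dest!: spec[of _ 1])
qed

text \<open>Completing the square in \<open>(\<bar>x\<bar> - a * v)\<^sup>2 \<ge> 0\<close> bounds
  the Gaussian density by an exponential of any rate \<open>a\<close>, and
  \<open>\<bar>x\<bar> \<ge> \<bar>u\<bar> - b\<close> on the interval. The free rate later absorbs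
  the correlation of the two gradient components.\<close>

lemma (in prob_space) gauss_interval_bound:
  fixes a r u :: real
  assumes G: "gauss M X" and v: "expectation (\<lambda>\<omega>. (X \<omega>)\<^sup>2) = v" "v > 0" and "a \<ge> 0" "0 < r" "r \<le> b"
  shows "prob {\<omega>\<in>space M. X \<omega> \<in> {u-r..u+r}} \<le> 2 * (1 / sqrt (2 * pi * v)) * exp (a\<^sup>2* v/2 + a*b) * r * exp (- a * \<bar>u\<bar>)"
proof -
  note D = gauss_var_distributed[OF gaussD(5)[OF G, unfolded v(1)] v(2)]
  have X[measurable]: "X \<in> borel_measurable M" using gaussD[OF G] by simp
  define C where "C = 1 / sqrt (2 * pi * v) * exp (a\<^sup>2* v/2 + a*b) * exp (- a * \<bar>u\<bar>)"
  have C0: "C \<ge> 0" unfolding C_def using v by simp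
  have le: "normal_density 0 (sqrt v) x \<le> C" if "x \<in> {u-r..u+r}" for x
  proof -
    have "\<bar>x\<bar> \<ge> \<bar>u\<bar> - b" using that assms by auto
    then have 1: "a * \<bar>x\<bar> \<ge> a * (\<bar>u\<bar> - b)" using \<open>a \<ge> 0\<close> by (rule mult_left_mono)
    have "0 \<le> (\<bar>x\<bar> - a * v)\<^sup>2 / (2 * v)" using v by simp
    also have "\<dots> = x\<^sup>2 / (2* v) - a * \<bar>x\<bar> + a\<^sup>2 * v / 2" using v
      by (simp add: power2_diff field_simps) (simp add: power2_eq_square)
    finally have "- x\<^sup>2 / (2* v) \<le> a\<^sup>2 * v / 2 + a * b + - a * \<bar>u\<bar>" using 1 by (simp add: algebra_simps)
    then have "exp (- x\<^sup>2 / (2* v)) \<le> exp (a\<^sup>2 * v / 2 + a * b + - a * \<bar>u\<bar>)" by (subst exp_le_cancel_iff)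
    then have "1 / sqrt (2 * pi * v) * exp (- x\<^sup>2 / (2* v)) \<le> 1 / sqrt (2 * pi * v) * exp (a\<^sup>2 * v / 2 + a * b + - a * \<bar>u\<bar>)"
      using v by (intro mult_left_mono) auto
    then show ?thesis using v unfolding normal_density_def C_def exp_add by simp
  qed
  have "emeasure M (X -` {u-r..u+r} \<inter> space M) = (\<integral>\<^sup>+x. ennreal (normal_density 0 (sqrt v) x) * indicator {u-r..u+r} x \<partial>lborel)"
    using D by (intro distributed_emeasure) auto
  also have "\<dots> \<le> (\<integral>\<^sup>+x. ennreal C * indicator {u-r..u+r} x \<partial>lborel)"
    using le by (intro nn_integral_mono) (auto simp: indicator_def intro!: ennreal_leI)
  also have "\<dots> = ennreal C * ennreal (2 * r)" using assms by (subst nn_integral_cmult_indicator) auto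
  also have "\<dots> = ennreal (C * (2 * r))" using C0 assms by (simp add: ennreal_mult)
  finally have "emeasure M (X -` {u-r..u+r} \<inter> space M) \<le> ennreal (C * (2 * r))" .
  then have "measure M (X -` {u-r..u+r} \<inter> space M) \<le> C * (2 * r)"
    using C0 assms by (simp add: emeasure_eq_measure)
  moreover have "X -` {u-r..u+r} \<inter> space M = {\<omega>\<in>space M. X \<omega> \<in> {u-r..u+r}}" by auto
  ultimately show ?thesis unfolding C_def by (simp add: mult_ac)
qed

text \<open>All linear combinations are Gaussian, which is joint Gaussianity: finite-dimensional
  laws are determined by the second moments.\<close>

definition gauss_space :: "'a measure \<Rightarrow> ('a \<Rightarrow> real) set \<Rightarrow> bool" where
  "gauss_space M V \<longleftrightarrow> V \<noteq> {} \<and> (\<forall>X\<in>V. gauss M X) \<and>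
     (\<forall>X\<in>V. \<forall>Y\<in>V. \<forall>a b. (\<lambda>\<omega>. a * X \<omega> + b * Y \<omega>) \<in> V)"

lemma gauss_spaceD:
  assumes "gauss_space M V"
  shows "X \<in> V \<Longrightarrow> gauss M X" "X \<in> V \<Longrightarrow> Y \<in> V \<Longrightarrow> (\<lambda>\<omega>. a * X \<omega> + b * Y \<omega>) \<in> V"
    "(\<lambda>\<omega>. 0) \<in> V" "X \<in> V \<Longrightarrow> (\<lambda>\<omega>. a * X \<omega>) \<in> V"
    "X \<in> V \<Longrightarrow> Y \<in> V \<Longrightarrow> (\<lambda>\<omega>. X \<omega> + Y \<omega>) \<in> V" "X \<in> V \<Longrightarrow> Y \<in> V \<Longrightarrow> (\<lambda>\<omega>. X \<omega> - Y \<omega>) \<in> V"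
proof -
  show 1: "X \<in> V \<Longrightarrow> gauss M X" "\<And>X Y a b. X \<in> V \<Longrightarrow> Y \<in> V \<Longrightarrow> (\<lambda>\<omega>. a * X \<omega> + b * Y \<omega>) \<in> V"
    for X using assms by (auto simp: gauss_space_def)
  obtain Z where "Z \<in> V" using assms by (auto simp: gauss_space_def)
  from 1(2)[OF this this, of 0 0] show "(\<lambda>\<omega>. 0) \<in> V" by simp
  show "X \<in> V \<Longrightarrow> (\<lambda>\<omega>. a * X \<omega>) \<in> V" using 1(2)[of X X a 0] by simp
  show "X \<in> V \<Longrightarrow> Y \<in> V \<Longrightarrow> (\<lambda>\<omega>. X \<omega> + Y \<omega>) \<in> V" using 1(2)[of X Y 1 1] by simp
  show "X \<in> V \<Longrightarrow> Y \<in> V \<Longrightarrow> (\<lambda>\<omega>. X \<omega> - Y \<omega>) \<in> V" using 1(2)[of X Y 1 "-1"] by simp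
qed

lemma gauss_space_sum:
  assumes G: "gauss_space M V" and "\<And>i. i < (n::nat) \<Longrightarrow> X i \<in> V"
  shows "(\<lambda>\<omega>. \<Sum>i<n. t i * X i \<omega>) \<in> V"
  using assms(2)
proof (induction n)
  case 0
  then show ?case using gauss_spaceD(3)[OF G] by simp
next
  case (Suc n)
  have "(\<lambda>\<omega>. 1 * (\<Sum>i<n. t i * X i \<omega>) + t n * X n \<omega>) \<in> V"
    using Suc by (intro gauss_spaceD(2)[OF G]) auto
  then show ?case by simp
qed

text \<open>Polarisation, since integrability is known for squares of members.\<close>

lemma (in prob_space) gauss_space_prod_integrable:
  assumes "gauss_space M V" "X \<in> V" "Y \<in> V"
  shows "integrable M (\<lambda>\<omega>. X \<omega> * Y \<omega>)"
proof -
  note g = gauss_spaceD(1)[OF assms(1,2)] gauss_spaceD(1)[OF assms(1,3)]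
  have "integrable M (\<lambda>\<omega>. ((X \<omega> + Y \<omega>)\<^sup>2 - (X \<omega>)\<^sup>2 - (Y \<omega>)\<^sup>2) / 2)"
    using gaussD(2)[OF g(1)] gaussD(2)[OF g(2)] gaussD(2)[OF gauss_spaceD(1)[OF assms(1) gauss_spaceD(5)[OF assms]]] by auto
  moreover have "((X \<omega> + Y \<omega>)\<^sup>2 - (X \<omega>)\<^sup>2 - (Y \<omega>)\<^sup>2) / 2 = X \<omega> * Y \<omega>" for \<omega>
    by (simp add: power2_sum)
  ultimately show ?thesis by simp
qed

lemma (in prob_space) gauss_space_char_sum:
  assumes G: "gauss_space M V" and "\<And>i::nat. X i \<in> V"
  shows "(CLINT \<omega>|M. iexp (\<Sum>i<n. t i * X i \<omega>))
     = complex_of_real (exp (- (\<Sum>i<n. \<Sum>j<n. t i * t j * expectation (\<lambda>\<omega>. X i \<omega> * X j \<omega>)) / 2))"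
proof -
  have "gauss M (\<lambda>\<omega>. \<Sum>i<n. t i * X i \<omega>)"
    using gauss_space_sum[OF G, of n X t] assms(2) gauss_spaceD(1)[OF G] by auto
  note gaussD(6)[OF this]
  moreover have "(\<Sum>i<n. t i * X i \<omega>)\<^sup>2 = (\<Sum>i<n. \<Sum>j<n. t i * t j * (X i \<omega> * X j \<omega>))" for \<omega>
    by (simp add: power2_eq_square sum_product mult_ac)
  moreover have "expectation (\<lambda>\<omega>. \<Sum>i<n. \<Sum>j<n. t i * t j * (X i \<omega> * X j \<omega>))
     = (\<Sum>i<n. \<Sum>j<n. t i * t j * expectation (\<lambda>\<omega>. X i \<omega> * X j \<omega>))"
    using gauss_space_prod_integrable[OF G assms(2) assms(2)]
    by (subst Bochner_Integration.integral_sum, auto intro!: sum.cong)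
  ultimately show ?thesis by simp
qed

text \<open>The joint characteristic functions of members of a Gaussian space depend only on the
  covariances.\<close>

lemma gauss_space_law_eq:
  fixes X :: "nat \<Rightarrow> 'a \<Rightarrow> real" and X' :: "nat \<Rightarrow> 'b \<Rightarrow> real"
  assumes M: "prob_space M" and N: "prob_space N"
    and V: "gauss_space M V" "\<And>i. X i \<in> V" and V': "gauss_space N V'" "\<And>i. X' i \<in> V'"
    and cov: "\<And>i j. (LINT \<omega>|M. X i \<omega> * X j \<omega>) = (LINT \<omega>|N. X' i \<omega> * X' j \<omega>)"
    and A: "\<And>i. A i \<in> sets borel"
  shows "measure M {\<omega>\<in>space M. \<forall>i. X i \<omega> \<in> A i} = measure N {\<omega>\<in>space N. \<forall>i. X' i \<omega> \<in> A i}"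
  using prob_space.gauss_space_char_sum[OF M V] prob_space.gauss_space_char_sum[OF N V']
    prob_space.gaussD(1)[OF M gauss_spaceD(1)[OF V]] prob_space.gaussD(1)[OF N gauss_spaceD(1)[OF V']] A cov
  by (intro char_rectangle[OF M N]) auto

section \<open>Stability of Gaussian spaces under pointwise limits\<close>

definition lim_closure :: "'a measure \<Rightarrow> ('a \<Rightarrow> real) set \<Rightarrow> ('a \<Rightarrow> real) set" where
  "lim_closure M V = {X. \<exists>Y. (\<forall>n::nat. Y n \<in> V) \<and> (\<forall>\<omega>\<in>space M. (\<lambda>n. Y n \<omega>) \<longlonglongrightarrow> X \<omega>)}"

lemma lim_closure_superset: "V \<subseteq> lim_closure M V"
  by (fastforce simp: lim_closure_def intro!: exI[of _ "\<lambda>n. X" for X])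

text \<open>The characteristic functions converge by dominated convergence. Near 0 the limit is
  positive, so a logarithm taken there shows that the variances converge; without this they might
  escape to infinity.\<close>

lemma (in prob_space) gauss_lim:
  assumes Xn: "\<And>n::nat. gauss M (Xn n)" and lim: "\<And>\<omega>. \<omega> \<in> space M \<Longrightarrow> (\<lambda>n. Xn n \<omega>) \<longlonglongrightarrow> X \<omega>"
  shows "gauss M X" "(\<lambda>n. expectation (\<lambda>\<omega>. (Xn n \<omega>)\<^sup>2)) \<longlonglongrightarrow> expectation (\<lambda>\<omega>. (X \<omega>)\<^sup>2)"
proof -
  define v where "v n = expectation (\<lambda>\<omega>. (Xn n \<omega>)\<^sup>2)" for n
  define \<phi> where "\<phi> t = (CLINT \<omega>|M. iexp (t * X \<omega>))" for t
  have g: "gauss_var M (Xn n) (v n)" for n unfolding v_def using Xn by (rule gaussD)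
  have [measurable]: "Xn n \<in> borel_measurable M" for n using g by (simp add: gauss_var_def)
  have X[measurable]: "X \<in> borel_measurable M" by (rule borel_measurable_LIMSEQ_real[OF lim]) auto
  have l1: "(\<lambda>n. complex_of_real (exp (- (t\<^sup>2 * v n) / 2))) \<longlonglongrightarrow> \<phi> t" for t
  proof -
    have "(\<lambda>n. CLINT \<omega>|M. iexp (t * Xn n \<omega>)) \<longlonglongrightarrow> \<phi> t"
      unfolding \<phi>_def
      by (rule integral_dominated_convergence[where w="\<lambda>_. 1"]) (auto intro!: tendsto_intros lim)
    then show ?thesis using g by (simp add: gauss_var_def)
  qed
  have l2: "(\<lambda>n. exp (- (t\<^sup>2 * v n) / 2)) \<longlonglongrightarrow> Re (\<phi> t)" for t
    using tendsto_Re[OF l1[of t]] by simp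
  have im: "\<phi> t = complex_of_real (Re (\<phi> t))" for t
    using LIMSEQ_unique[OF l1[of t] tendsto_of_real[OF l2[of t]]] .
  \<comment> \<open>A frequency \<open>t0 > 0\<close> with positive limit is found among the numbers
    \<open>1 / (n + 1)\<close>, by continuity of \<open>\<phi>\<close> at 0.\<close>
  have "(\<lambda>n. \<phi> (inverse (real (Suc n)))) \<longlonglongrightarrow> (CLINT \<omega>|M. iexp (0 * X \<omega>))"
    unfolding \<phi>_def
  proof (rule integral_dominated_convergence[where w="\<lambda>_. 1"])
    show "AE \<omega> in M. (\<lambda>n. iexp (inverse (real (Suc n)) * X \<omega>)) \<longlonglongrightarrow> iexp (0 * X \<omega>)"
      by (intro AE_I2 isCont_tendsto_compose[OF isCont_iexp] tendsto_mult_right LIMSEQ_inverse_real_of_nat)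
  qed auto
  then have "(\<lambda>n. Re (\<phi> (inverse (real (Suc n))))) \<longlonglongrightarrow> 1"
    using tendsto_Re by (fastforce simp: prob_space)
  then have "eventually (\<lambda>n. Re (\<phi> (inverse (real (Suc n)))) > 0) sequentially"
    by (rule order_tendstoD) simp
  then obtain n0 where n0: "Re (\<phi> (inverse (real (Suc n0)))) > 0" by (auto simp: eventually_sequentially)
  define t0 where "t0 = inverse (real (Suc n0))"
  have t0: "t0 > 0" "Re (\<phi> t0) > 0" using n0 by (auto simp: t0_def)
  define w where "w = - 2 * ln (Re (\<phi> t0)) / t0\<^sup>2"
  have "(\<lambda>n. - 2 * ln (exp (- (t0\<^sup>2 * v n) / 2)) / t0\<^sup>2) \<longlonglongrightarrow> w"
    unfolding w_def using t0 by (intro tendsto_intros l2) auto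
  then have vw: "v \<longlonglongrightarrow> w" using t0 by simp
  have w0: "w \<ge> 0" by (rule LIMSEQ_le_const[OF vw]) (use g in \<open>auto simp: gauss_var_def\<close>)
  have "gauss_var M X w"
    unfolding gauss_var_def
  proof (intro conjI X w0 allI)
    fix t
    have "(\<lambda>n. exp (- (t\<^sup>2 * v n) / 2)) \<longlonglongrightarrow> exp (- (t\<^sup>2 * w) / 2)"
      by (intro tendsto_intros vw) auto
    then have "Re (\<phi> t) = exp (- (t\<^sup>2 * w) / 2)" using LIMSEQ_unique[OF l2] by blast
    then show "(CLINT \<omega>|M. iexp (t * X \<omega>)) = complex_of_real (exp (- (t\<^sup>2 * w) / 2))"
      using im[of t] by (simp add: \<phi>_def)
  qed
  then show "gauss M X" "(\<lambda>n. expectation (\<lambda>\<omega>. (Xn n \<omega>)\<^sup>2)) \<longlonglongrightarrow> expectation (\<lambda>\<omega>. (X \<omega>)\<^sup>2)"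
    using vw gauss_var_moments[of X w] by (auto simp: gauss_def v_def[abs_def])
qed

lemma (in prob_space) gauss_space_lim_closure:
  assumes G: "gauss_space M V"
  shows "gauss_space M (lim_closure M V)"
  unfolding gauss_space_def
proof (intro conjI ballI allI)
  show "lim_closure M V \<noteq> {}" using lim_closure_superset gauss_spaceD(3)[OF G] by blast
next
  fix X assume "X \<in> lim_closure M V"
  then obtain Y where "\<And>n::nat. Y n \<in> V" "\<And>\<omega>. \<omega> \<in> space M \<Longrightarrow> (\<lambda>n. Y n \<omega>) \<longlonglongrightarrow> X \<omega>"
    by (auto simp: lim_closure_def)
  then show "gauss M X" using gauss_lim(1)[of Y X] gauss_spaceD(1)[OF G] by blast
next
  fix X X' and a b :: real assume "X \<in> lim_closure M V" "X' \<in> lim_closure M V"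
  then obtain Y Y' where "\<And>n::nat. Y n \<in> V" "\<And>\<omega>. \<omega> \<in> space M \<Longrightarrow> (\<lambda>n. Y n \<omega>) \<longlonglongrightarrow> X \<omega>"
     "\<And>n::nat. Y' n \<in> V" "\<And>\<omega>. \<omega> \<in> space M \<Longrightarrow> (\<lambda>n. Y' n \<omega>) \<longlonglongrightarrow> X' \<omega>"
    unfolding lim_closure_def by blast
  then show "(\<lambda>\<omega>. a * X \<omega> + b * X' \<omega>) \<in> lim_closure M V"
    unfolding lim_closure_def mem_Collect_eq
    by (intro exI[of _ "\<lambda>n \<omega>. a * Y n \<omega> + b * Y' n \<omega>"]) (auto intro!: tendsto_intros gauss_spaceD(2)[OF G])
qed

text \<open>Polarisation expresses a covariance by the variances of \<open>X + Y\<close> and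
  \<open>X - Y\<close>, which converge by \<open>gauss_lim\<close>.\<close>

lemma (in prob_space) gauss_space_cov_lim:
  assumes G: "gauss_space M V" and V: "\<And>n::nat. Xn n \<in> V" "Y \<in> V"
    and lim: "\<And>\<omega>. \<omega> \<in> space M \<Longrightarrow> (\<lambda>n. Xn n \<omega>) \<longlonglongrightarrow> X \<omega>"
  shows "(\<lambda>n. expectation (\<lambda>\<omega>. Xn n \<omega> * Y \<omega>)) \<longlonglongrightarrow> expectation (\<lambda>\<omega>. X \<omega> * Y \<omega>)"
proof -
  have pol: "expectation (\<lambda>\<omega>. X \<omega> * Y \<omega>) = (expectation (\<lambda>\<omega>. (X \<omega> + Y \<omega>)\<^sup>2) - expectation (\<lambda>\<omega>. (X \<omega> - Y \<omega>)\<^sup>2)) / 4"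
    if "gauss M (\<lambda>\<omega>. X \<omega> + Y \<omega>)" "gauss M (\<lambda>\<omega>. X \<omega> - Y \<omega>)" for X
  proof -
    have "expectation (\<lambda>\<omega>. X \<omega> * Y \<omega>) = expectation (\<lambda>\<omega>. ((X \<omega> + Y \<omega>)\<^sup>2 - (X \<omega> - Y \<omega>)\<^sup>2) / 4)"
      by (simp add: power2_sum power2_diff)
    also have "\<dots> = (expectation (\<lambda>\<omega>. (X \<omega> + Y \<omega>)\<^sup>2) - expectation (\<lambda>\<omega>. (X \<omega> - Y \<omega>)\<^sup>2)) / 4"
      using gaussD(2)[OF that(1)] gaussD(2)[OF that(2)]
      by (subst integral_divide_zero, subst Bochner_Integration.integral_diff) auto
    finally show ?thesis .
  qed
  have g: "gauss M (\<lambda>\<omega>. Xn n \<omega> + Y \<omega>)" "gauss M (\<lambda>\<omega>. Xn n \<omega> - Y \<omega>)" for n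
    using gauss_spaceD(1,5,6)[OF G] V by auto
  note l = gauss_lim[of "\<lambda>n \<omega>. Xn n \<omega> + Y \<omega>" "\<lambda>\<omega>. X \<omega> + Y \<omega>"] gauss_lim[of "\<lambda>n \<omega>. Xn n \<omega> - Y \<omega>" "\<lambda>\<omega>. X \<omega> - Y \<omega>"]
  have "(\<lambda>n. (expectation (\<lambda>\<omega>. (Xn n \<omega> + Y \<omega>)\<^sup>2) - expectation (\<lambda>\<omega>. (Xn n \<omega> - Y \<omega>)\<^sup>2)) / 4) \<longlonglongrightarrow>
      (expectation (\<lambda>\<omega>. (X \<omega> + Y \<omega>)\<^sup>2) - expectation (\<lambda>\<omega>. (X \<omega> - Y \<omega>)\<^sup>2)) / 4"
    using g lim by (intro tendsto_intros l) (auto intro!: tendsto_intros)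
  moreover have "gauss M (\<lambda>\<omega>. X \<omega> + Y \<omega>)" "gauss M (\<lambda>\<omega>. X \<omega> - Y \<omega>)"
    using g lim by (auto intro!: l tendsto_intros)
  ultimately show ?thesis by (subst (1 2) pol) (use g in auto)
qed

section \<open>Independence and Fernique integrability\<close>

text \<open>On the product space this family contains both independent copies of \<open>V\<close>
  and all their rotations.\<close>

definition pair_sums :: "('a \<Rightarrow> real) set \<Rightarrow> ('a \<times> 'a \<Rightarrow> real) set" where
  "pair_sums V = {Z. \<exists>X\<in>V. \<exists>Y\<in>V. Z = (\<lambda>p. X (fst p) + Y (snd p))}"

lemma (in prob_space) pair_prob: "prob_space (M \<Otimes>\<^sub>M M)"
  by (rule prob_space_pair) (rule prob_space_axioms)+

lemma (in prob_space) pair_integral: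
  fixes f :: "'a \<times> 'a \<Rightarrow> 'c::{banach, second_countable_topology}"
  assumes "integrable (M \<Otimes>\<^sub>M M) f"
  shows "(LINT x|M. LINT y|M. f (x, y)) = (LINT p|(M \<Otimes>\<^sub>M M). f p)"
proof -
  interpret P: pair_prob_space M M by unfold_locales
  show ?thesis by (rule P.integral_fst'[OF assms])
qed

lemma (in prob_space) gauss_space_pair_sums:
  assumes G: "gauss_space M V"
  shows "gauss_space (M \<Otimes>\<^sub>M M) (pair_sums V)"
  unfolding gauss_space_def
proof (intro conjI ballI allI)
  show "pair_sums V \<noteq> {}" using gauss_spaceD(3)[OF G] unfolding pair_sums_def by blast
next
  fix Z assume "Z \<in> pair_sums V"
  then obtain X Y where Z: "X \<in> V" "Y \<in> V" "Z = (\<lambda>p. X (fst p) + Y (snd p))" by (auto simp: pair_sums_def)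
  have gv: "gauss_var M X (expectation (\<lambda>\<omega>. (X \<omega>)\<^sup>2))" "gauss_var M Y (expectation (\<lambda>\<omega>. (Y \<omega>)\<^sup>2))"
    using gaussD(5) gauss_spaceD(1)[OF G] Z by auto
  have [measurable]: "X \<in> borel_measurable M" "Y \<in> borel_measurable M" using gv by (auto simp: gauss_var_def)
  interpret P: prob_space "M \<Otimes>\<^sub>M M" by (rule pair_prob)
  show "gauss (M \<Otimes>\<^sub>M M) Z"
    unfolding gauss_def gauss_var_def
  proof (intro exI[of _ "expectation (\<lambda>\<omega>. (X \<omega>)\<^sup>2) + expectation (\<lambda>\<omega>. (Y \<omega>)\<^sup>2)"] conjI allI)
    fix t
    have "(CLINT p|(M \<Otimes>\<^sub>M M). iexp (t * Z p)) = (CLINT x|M. CLINT y|M. iexp (t * Z (x, y)))"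
      by (rule pair_integral[symmetric]) (auto intro!: integrable_bounded_complex[OF pair_prob, where c=1] simp: Z)
    also have "\<dots> = (CLINT x|M. iexp (t * X x) * (CLINT y|M. iexp (t * Y y)))"
      by (simp add: Z distrib_left exp_add)
    also have "\<dots> = (CLINT x|M. iexp (t * X x)) * (CLINT y|M. iexp (t * Y y))"
      by simp
    also have "\<dots> = complex_of_real (exp (- (t\<^sup>2 * expectation (\<lambda>\<omega>. (X \<omega>)\<^sup>2)) / 2) * exp (- (t\<^sup>2 * expectation (\<lambda>\<omega>. (Y \<omega>)\<^sup>2)) / 2))"
      using gv by (simp only: gauss_var_def of_real_mult)
    finally show "(CLINT p|(M \<Otimes>\<^sub>M M). iexp (t * Z p)) = complex_of_real (exp (- (t\<^sup>2 * (expectation (\<lambda>\<omega>. (X \<omega>)\<^sup>2) + expectation (\<lambda>\<omega>. (Y \<omega>)\<^sup>2))) / 2))"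
      by (simp add: exp_add[symmetric] algebra_simps add_divide_distrib)
  qed (use gv in \<open>auto simp: gauss_var_def Z\<close>)
next
  fix Z Z' and a b :: real assume "Z \<in> pair_sums V" "Z' \<in> pair_sums V"
  then obtain X Y X' Y' where Z: "X \<in> V" "Y \<in> V" "Z = (\<lambda>p. X (fst p) + Y (snd p))"
    "X' \<in> V" "Y' \<in> V" "Z' = (\<lambda>p. X' (fst p) + Y' (snd p))" by (auto simp: pair_sums_def)
  show "(\<lambda>p. a * Z p + b * Z' p) \<in> pair_sums V"
    unfolding pair_sums_def
    by (rule CollectI, rule bexI[of _ "\<lambda>\<omega>. a * X \<omega> + b * X' \<omega>"], rule bexI[of _ "\<lambda>\<omega>. a * Y \<omega> + b * Y' \<omega>"])
      (use Z in \<open>auto intro!: gauss_spaceD(2)[OF G] simp: algebra_simps\<close>)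
qed

text \<open>The mixed terms vanish because the two coordinates are independent and centered.\<close>

lemma (in prob_space) pair_sums_cov:
  assumes G: "gauss_space M V" and V: "X \<in> V" "Y \<in> V" "X' \<in> V" "Y' \<in> V"
  shows "(LINT p|(M \<Otimes>\<^sub>M M). (X (fst p) + Y (snd p)) * (X' (fst p) + Y' (snd p)))
    = expectation (\<lambda>\<omega>. X \<omega> * X' \<omega>) + expectation (\<lambda>\<omega>. Y \<omega> * Y' \<omega>)"
proof -
  interpret P: prob_space "M \<Otimes>\<^sub>M M" by (rule pair_prob)
  note g = gaussD(3,4)[OF gauss_spaceD(1)[OF G]] gauss_space_prod_integrable[OF G]
  have "(LINT p|(M \<Otimes>\<^sub>M M). (X (fst p) + Y (snd p)) * (X' (fst p) + Y' (snd p)))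
    = (LINT x|M. LINT y|M. (X x + Y y) * (X' x + Y' y))"
  proof -
    have "integrable (M \<Otimes>\<^sub>M M) (\<lambda>p. (X (fst p) + Y (snd p)) * (X' (fst p) + Y' (snd p)))"
      using V by (intro P.gauss_space_prod_integrable[OF gauss_space_pair_sums[OF G]]) (auto simp: pair_sums_def)
    from pair_integral[OF this] show ?thesis by simp
  qed
  also have "\<dots> = (LINT x|M. X x * X' x + expectation (\<lambda>\<omega>. Y \<omega> * Y' \<omega>))"
  proof (intro Bochner_Integration.integral_cong refl)
    fix x
    have "(LINT y|M. (X x + Y y) * (X' x + Y' y)) = (LINT y|M. X x * X' x + (X x * Y' y + (X' x * Y y + Y y * Y' y)))"
      by (simp add: algebra_simps)
    also have "\<dots> = X x * X' x + expectation (\<lambda>\<omega>. Y \<omega> * Y' \<omega>)"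
      using V g by (simp add: prob_space)
    finally show "(LINT y|M. (X x + Y y) * (X' x + Y' y)) = X x * X' x + expectation (\<lambda>\<omega>. Y \<omega> * Y' \<omega>)" .
  qed
  also have "\<dots> = expectation (\<lambda>\<omega>. X \<omega> * X' \<omega>) + expectation (\<lambda>\<omega>. Y \<omega> * Y' \<omega>)"
    using V g by (simp add: prob_space)
  finally show ?thesis .
qed

section \<open>Independence of uncorrelated families\<close>

lemma (in prob_space) pair_prob_rect:
  assumes [measurable]: "{x\<in>space M. P x} \<in> sets M" "{x\<in>space M. Q x} \<in> sets M"
  shows "measure (M \<Otimes>\<^sub>M M) {p\<in>space (M \<Otimes>\<^sub>M M). P (fst p) \<and> Q (snd p)} = prob {x\<in>space M. P x} * prob {x\<in>space M. Q x}"
proof -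
  interpret P: prob_space "M \<Otimes>\<^sub>M M" by (rule pair_prob)
  have "{p\<in>space (M \<Otimes>\<^sub>M M). P (fst p) \<and> Q (snd p)} = {x\<in>space M. P x} \<times> {x\<in>space M. Q x}"
    by (auto simp: space_pair_measure)
  then have "emeasure (M \<Otimes>\<^sub>M M) {p\<in>space (M \<Otimes>\<^sub>M M). P (fst p) \<and> Q (snd p)} = emeasure M {x\<in>space M. P x} * emeasure M {x\<in>space M. Q x}"
    by (simp add: emeasure_pair_measure_Times)
  then show ?thesis by (simp add: measure_def enn2real_mult)
qed

text \<open>Merges two sequences, so that a statement about one countable family covers a pair of
  families.\<close>

definition interleave :: "(nat \<Rightarrow> 'b) \<Rightarrow> (nat \<Rightarrow> 'b) \<Rightarrow> nat \<Rightarrow> 'b" where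
  "interleave f g n = (if even n then f (n div 2) else g (n div 2))"

lemma all_interleave: "(\<forall>n. P (interleave f g n) (interleave f' g' n)) \<longleftrightarrow> (\<forall>n. P (f n) (f' n) \<and> P (g n) (g' n))"
proof safe
  fix n assume *: "\<forall>n. P (interleave f g n) (interleave f' g' n)"
  show "P (f n) (f' n)" using *[rule_format, of "2*n"] by (simp add: interleave_def)
  show "P (g n) (g' n)" using *[rule_format, of "2*n+1"] by (simp add: interleave_def)
qed (auto simp: interleave_def)

text \<open>Placed on different coordinates of the product space, the two families have the same
  covariances as on \<open>M\<close>, hence the same joint law; there the probability of a rectangle
  factorises.\<close>

lemma (in prob_space) gauss_space_indep:
  fixes X Y :: "nat \<Rightarrow> 'a \<Rightarrow> real"
  assumes G: "gauss_space M V" and V: "\<And>i. X i \<in> V" "\<And>i. Y i \<in> V"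
    and cov: "\<And>i j. expectation (\<lambda>\<omega>. X i \<omega> * Y j \<omega>) = 0"
    and A[measurable]: "\<And>i. A i \<in> sets borel" "\<And>i. B i \<in> sets borel"
  shows "prob {\<omega>\<in>space M. \<forall>i. X i \<omega> \<in> A i \<and> Y i \<omega> \<in> B i}
     = prob {\<omega>\<in>space M. \<forall>i. X i \<omega> \<in> A i} * prob {\<omega>\<in>space M. \<forall>i. Y i \<omega> \<in> B i}"
proof -
  have [measurable]: "X i \<in> borel_measurable M" "Y i \<in> borel_measurable M" for i
    using gaussD(1) gauss_spaceD(1)[OF G] V by auto
  note z = gauss_spaceD(3)[OF G]
  define X' where "X' i = (\<lambda>p::'a \<times> 'a. X i (fst p) + 0)" for i
  define Y' where "Y' i = (\<lambda>p::'a \<times> 'a. 0 + Y i (snd p))" for i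
  have V': "X' i \<in> pair_sums V" "Y' i \<in> pair_sums V" for i
    unfolding X'_def Y'_def pair_sums_def using V gauss_spaceD(3)[OF G] by fastforce+
  have c: "(LINT p|(M \<Otimes>\<^sub>M M). X' i p * X' j p) = expectation (\<lambda>\<omega>. X i \<omega> * X j \<omega>)"
     "(LINT p|(M \<Otimes>\<^sub>M M). Y' i p * Y' j p) = expectation (\<lambda>\<omega>. Y i \<omega> * Y j \<omega>)"
     "(LINT p|(M \<Otimes>\<^sub>M M). X' i p * Y' j p) = 0" "(LINT p|(M \<Otimes>\<^sub>M M). Y' i p * X' j p) = 0" for i j
    unfolding X'_def Y'_def
    using pair_sums_cov[OF G V(1)[of i] z V(1)[of j] z] pair_sums_cov[OF G z V(2)[of i] z V(2)[of j]]
      pair_sums_cov[OF G V(1)[of i] z z V(2)[of j]] pair_sums_cov[OF G z V(2)[of i] V(1)[of j] z] by simp_all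
  have "prob {\<omega>\<in>space M. \<forall>i. interleave X Y i \<omega> \<in> interleave A B i}
      = measure (M \<Otimes>\<^sub>M M) {p\<in>space (M \<Otimes>\<^sub>M M). \<forall>i. interleave X' Y' i p \<in> interleave A B i}"
    by (rule gauss_space_law_eq[OF prob_space_axioms pair_prob G _ gauss_space_pair_sums[OF G]])
      (use V V' cov c in \<open>auto simp: interleave_def mult.commute\<close>)
  also have "\<dots> = measure (M \<Otimes>\<^sub>M M) {p\<in>space (M \<Otimes>\<^sub>M M). (\<forall>i. X i (fst p) \<in> A i) \<and> (\<forall>i. Y i (snd p) \<in> B i)}"
    unfolding all_interleave[of "\<lambda>x a. x p \<in> a" for p] by (auto simp: X'_def Y'_def intro!: arg_cong2[where f=measure])
  also have "\<dots> = prob {\<omega>\<in>space M. \<forall>i. X i \<omega> \<in> A i} * prob {\<omega>\<in>space M. \<forall>i. Y i \<omega> \<in> B i}"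
    by (rule pair_prob_rect) auto
  finally show ?thesis
    unfolding all_interleave[of "\<lambda>x a. x \<omega> \<in> a" for \<omega>] by simp
qed

section \<open>Tail of the supremum of a Gaussian sequence\<close>

lemma abs_le_Icc: "\<bar>x::real\<bar> \<le> s \<longleftrightarrow> x \<in> {-s..s}"
  by auto

text \<open>Fernique's argument: a rotation by 45 degrees preserves the law of two independent copies.\<close>

lemma (in prob_space) fernique_step:
  fixes X :: "nat \<Rightarrow> 'a \<Rightarrow> real"
  assumes G: "gauss_space M V" and V: "\<And>i. X i \<in> V"
  defines "p \<equiv> \<lambda>s. prob {\<omega>\<in>space M. \<forall>i. \<bar>X i \<omega>\<bar> \<le> s}"
  shows "p s * (1 - p (s + sqrt 2 * t)) \<le> (1 - p t)\<^sup>2"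
proof -
  let ?P = "M \<Otimes>\<^sub>M M"
  interpret P: prob_space ?P by (rule pair_prob)
  have [measurable]: "X i \<in> borel_measurable M" for i
    using gaussD(1) gauss_spaceD(1)[OF G] V by auto
  define r where "r = s + sqrt 2 * t"
  note z = gauss_spaceD(3)[OF G]
  define X' where "X' i = (\<lambda>p::'a \<times> 'a. X i (fst p) + 0)" for i
  define Y' where "Y' i = (\<lambda>p::'a \<times> 'a. 0 + X i (snd p))" for i
  define U where "U i = (\<lambda>p::'a \<times> 'a. 1 / sqrt 2 * X i (fst p) + (-1 / sqrt 2) * X i (snd p))" for i
  define W where "W i = (\<lambda>p::'a \<times> 'a. 1 / sqrt 2 * X i (fst p) + 1 / sqrt 2 * X i (snd p))" for i
  have V': "X' i \<in> pair_sums V" "Y' i \<in> pair_sums V" for i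
    unfolding X'_def Y'_def pair_sums_def using V gauss_spaceD(3)[OF G] by fastforce+
  have V'': "U i \<in> pair_sums V" "W i \<in> pair_sums V" for i
  proof -
    show "U i \<in> pair_sums V" unfolding U_def pair_sums_def
      by (rule CollectI, rule bexI[OF _ gauss_spaceD(4)[OF G V[of i], of "1 / sqrt 2"]],
          rule bexI[OF _ gauss_spaceD(4)[OF G V[of i], of "-1 / sqrt 2"]], rule refl)
    show "W i \<in> pair_sums V" unfolding W_def pair_sums_def
      by (rule CollectI, rule bexI[OF _ gauss_spaceD(4)[OF G V[of i], of "1 / sqrt 2"]],
          rule bexI[OF _ gauss_spaceD(4)[OF G V[of i], of "1 / sqrt 2"]], rule refl)
  qed
  define c where "c i j = expectation (\<lambda>\<omega>. X i \<omega> * X j \<omega>)" for i j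
  have c1: "(LINT p|?P. X' i p * X' j p) = c i j"
     "(LINT p|?P. Y' i p * Y' j p) = c i j"
     "(LINT p|?P. X' i p * Y' j p) = 0" "(LINT p|?P. Y' i p * X' j p) = 0" for i j
    unfolding X'_def Y'_def c_def
    using pair_sums_cov[OF G V[of i] z V[of j] z] pair_sums_cov[OF G z V[of i] z V[of j]]
      pair_sums_cov[OF G V[of i] z z V[of j]] pair_sums_cov[OF G z V[of i] V[of j] z] by simp_all
  have cc: "expectation (\<lambda>\<omega>. a * X i \<omega> * (b * X j \<omega>)) = a * b * c i j" for a b i j
  proof -
    have "expectation (\<lambda>\<omega>. a * X i \<omega> * (b * X j \<omega>)) = expectation (\<lambda>\<omega>. (a * b) * (X i \<omega> * X j \<omega>))" by (simp add: mult_ac)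
    then show ?thesis by (simp add: c_def)
  qed
  have c2: "(LINT p|?P. U i p * U j p) = c i j"
     "(LINT p|?P. W i p * W j p) = c i j"
     "(LINT p|?P. U i p * W j p) = 0" "(LINT p|?P. W i p * U j p) = 0" for i j
  proof -
    show "(LINT p|?P. U i p * U j p) = c i j"
    using pair_sums_cov[OF G gauss_spaceD(4)[OF G V[of i], of "1 / sqrt 2"] gauss_spaceD(4)[OF G V[of i], of "-1 / sqrt 2"]
      gauss_spaceD(4)[OF G V[of j], of "1 / sqrt 2"] gauss_spaceD(4)[OF G V[of j], of "-1 / sqrt 2"]]
      unfolding cc U_def W_def by simp
    show "(LINT p|?P. W i p * W j p) = c i j"
    using pair_sums_cov[OF G gauss_spaceD(4)[OF G V[of i], of "1 / sqrt 2"] gauss_spaceD(4)[OF G V[of i], of "1 / sqrt 2"]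
      gauss_spaceD(4)[OF G V[of j], of "1 / sqrt 2"] gauss_spaceD(4)[OF G V[of j], of "1 / sqrt 2"]]
      unfolding cc U_def W_def by simp
    show "(LINT p|?P. U i p * W j p) = 0"
    using pair_sums_cov[OF G gauss_spaceD(4)[OF G V[of i], of "1 / sqrt 2"] gauss_spaceD(4)[OF G V[of i], of "-1 / sqrt 2"]
      gauss_spaceD(4)[OF G V[of j], of "1 / sqrt 2"] gauss_spaceD(4)[OF G V[of j], of "1 / sqrt 2"]]
      unfolding cc U_def W_def by simp
    show "(LINT p|?P. W i p * U j p) = 0"
    using pair_sums_cov[OF G gauss_spaceD(4)[OF G V[of i], of "1 / sqrt 2"] gauss_spaceD(4)[OF G V[of i], of "1 / sqrt 2"]
      gauss_spaceD(4)[OF G V[of j], of "1 / sqrt 2"] gauss_spaceD(4)[OF G V[of j], of "-1 / sqrt 2"]]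
      unfolding cc U_def W_def by simp
  qed
  \<comment> \<open>The rotated pair has the same covariances as the original one, the mixed ones
    being zero, so the joint laws agree.\<close>
  have rot: "measure ?P {p\<in>space ?P. (\<forall>i. X i (fst p) \<in> A) \<and> (\<forall>i. X i (snd p) \<in> B)}
      = measure ?P {p\<in>space ?P. \<forall>i. U i p \<in> A \<and> W i p \<in> B}" if [measurable]: "A \<in> sets borel" "B \<in> sets borel" for A B
  proof -
    have "measure ?P {p\<in>space ?P. \<forall>i. interleave X' Y' i p \<in> interleave (\<lambda>_. A) (\<lambda>_. B) i}
      = measure ?P {p\<in>space ?P. \<forall>i. interleave U W i p \<in> interleave (\<lambda>_. A) (\<lambda>_. B) i}"
      by (rule gauss_space_law_eq[OF pair_prob pair_prob gauss_space_pair_sums[OF G] _ gauss_space_pair_sums[OF G]])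
        (use V V' V'' c1 c2 in \<open>auto simp: interleave_def\<close>)
    then show ?thesis unfolding all_interleave[of "\<lambda>x a. x p \<in> a" for p] by (simp add: X'_def Y'_def all_conj_distrib)
  qed
  have p: "p s = prob {\<omega>\<in>space M. \<forall>i. X i \<omega> \<in> {-s..s}}" for s
    unfolding p_def abs_le_Icc ..
  have [measurable]: "U i \<in> borel_measurable ?P" "W i \<in> borel_measurable ?P" for i
    unfolding U_def W_def by measurable
  let ?A = "{q\<in>space ?P. \<forall>i. U i q \<in> {-s..s} \<and> W i q \<in> UNIV}" and ?B = "{q\<in>space ?P. \<forall>i. U i q \<in> {-s..s} \<and> W i q \<in> {-r..r}}"
  have "p s * p r = measure ?P {q\<in>space ?P. (\<forall>i. X i (fst q) \<in> {-s..s}) \<and> (\<forall>i. X i (snd q) \<in> {-r..r})}"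
    unfolding p by (rule pair_prob_rect[symmetric]) auto
  also have "\<dots> = measure ?P ?B" by (rule rot) auto
  finally have 1: "p s * p r = measure ?P ?B" .
  have "p s * prob {\<omega>\<in>space M. \<forall>i. X i \<omega> \<in> UNIV} = measure ?P {q\<in>space ?P. (\<forall>i. X i (fst q) \<in> {-s..s}) \<and> (\<forall>i. X i (snd q) \<in> UNIV)}"
    unfolding p by (rule pair_prob_rect[symmetric]) auto
  also have "\<dots> = measure ?P ?A" by (rule rot) auto
  finally have 2: "p s = measure ?P ?A" by (simp add: prob_space)
  have "p s * (1 - p r) = measure ?P ?A - measure ?P ?B" using 1 2 by (simp add: algebra_simps)
  also have "\<dots> = measure ?P (?A - ?B)" by (rule P.finite_measure_Diff[symmetric]) auto
  also have "\<dots> \<le> measure ?P {q\<in>space ?P. (\<not> (\<forall>i. X i (fst q) \<in> {-t..t})) \<and> (\<not> (\<forall>i. X i (snd q) \<in> {-t..t}))}"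
  proof (rule P.finite_measure_mono)
    show "?A - ?B \<subseteq> {q\<in>space ?P. (\<not> (\<forall>i. X i (fst q) \<in> {-t..t})) \<and> (\<not> (\<forall>i. X i (snd q) \<in> {-t..t}))}"
    proof
      \<comment> \<open>At an index where \<open>U\<close> is small and \<open>W\<close> is large
        both coordinates exceed \<open>t\<close>, since twice the minimum of
        \<open>\<bar>x\<bar>\<close> and \<open>\<bar>y\<bar>\<close> equals the distance between
        \<open>\<bar>x + y\<bar>\<close> and \<open>\<bar>x - y\<bar>\<close>.\<close>
      fix q assume q: "q \<in> ?A - ?B"
      then obtain i where i: "U i q \<in> {-s..s}" "W i q \<notin> {-r..r}" by blast
      have s2: "sqrt 2 > (0::real)" "sqrt 2 * sqrt 2 = (2::real)" by auto
      have u: "U i q = (X i (fst q) - X i (snd q)) / sqrt 2" "W i q = (X i (fst q) + X i (snd q)) / sqrt 2"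
        by (simp_all add: U_def W_def field_simps)
      have a: "\<bar>X i (fst q) - X i (snd q)\<bar> \<le> s * sqrt 2" using i(1) s2 unfolding u by (auto simp: field_simps abs_le_iff)
      have "\<not> \<bar>X i (fst q) + X i (snd q)\<bar> \<le> r * sqrt 2" using i(2) s2 unfolding u by (auto simp: field_simps abs_le_iff)
      moreover have "r * sqrt 2 = s * sqrt 2 + 2 * t" unfolding r_def by (simp add: algebra_simps)
      ultimately have "\<bar>X i (fst q)\<bar> > t" "\<bar>X i (snd q)\<bar> > t" using a by linarith+
      then have "X i (fst q) \<notin> {-t..t}" "X i (snd q) \<notin> {-t..t}" by auto
      then show "q \<in> {q\<in>space ?P. (\<not> (\<forall>i. X i (fst q) \<in> {-t..t})) \<and> (\<not> (\<forall>i. X i (snd q) \<in> {-t..t}))}" using q by blast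
    qed
  qed auto
  also have "\<dots> = prob {\<omega>\<in>space M. \<not> (\<forall>i. X i \<omega> \<in> {-t..t})} * prob {\<omega>\<in>space M. \<not> (\<forall>i. X i \<omega> \<in> {-t..t})}"
    by (rule pair_prob_rect) auto
  also have "prob {\<omega>\<in>space M. \<not> (\<forall>i. X i \<omega> \<in> {-t..t})} = 1 - p t"
    unfolding p by (rule prob_neg) auto
  finally show ?thesis unfolding r_def by (simp add: power2_eq_square)
qed

text \<open>The supremum is taken in the extended reals, where it is measurable for any sequence of
  measurable functions. An infinite supremum yields the default value 0, so boundedness is assumed
  wherever the value matters.\<close>

definition sup_abs :: "(nat \<Rightarrow> 'a \<Rightarrow> real) \<Rightarrow> 'a \<Rightarrow> real" where
  "sup_abs X \<omega> = enn2real (SUP i. ennreal \<bar>X i \<omega>\<bar>)"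

lemma sup_abs_measurable[measurable]:
  assumes [measurable]: "\<And>i. X i \<in> borel_measurable M"
  shows "sup_abs X \<in> borel_measurable M"
  unfolding sup_abs_def[abs_def] by measurable

lemma sup_abs_nonneg: "0 \<le> sup_abs X \<omega>"
  by (simp add: sup_abs_def)

lemma sup_abs_le_iff:
  assumes "bdd_above (range (\<lambda>i. \<bar>X i \<omega>\<bar>))"
  shows "sup_abs X \<omega> \<le> s \<longleftrightarrow> (\<forall>i. \<bar>X i \<omega>\<bar> \<le> s)"
proof -
  obtain b where b: "\<And>i. \<bar>X i \<omega>\<bar> \<le> b" using assms by (auto simp: bdd_above_def)
  have b0: "b \<ge> 0" using b[of 0] by linarith
  have fin: "(SUP i. ennreal \<bar>X i \<omega>\<bar>) \<le> ennreal b" using b by (auto intro!: SUP_least ennreal_leI)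
  then have f: "(SUP i. ennreal \<bar>X i \<omega>\<bar>) < \<top>" using le_less_trans ennreal_less_top by blast
  show ?thesis
  proof (cases "s \<ge> 0")
    case True
    have "sup_abs X \<omega> \<le> s \<longleftrightarrow> (SUP i. ennreal \<bar>X i \<omega>\<bar>) \<le> ennreal s"
      unfolding sup_abs_def using f True
      by (metis enn2real_leI ennreal_enn2real ennreal_leI)
    also have "\<dots> \<longleftrightarrow> (\<forall>i. \<bar>X i \<omega>\<bar> \<le> s)" using True by (auto simp: SUP_le_iff)
    finally show ?thesis .
  next
    case False
    then show ?thesis using sup_abs_nonneg[of X \<omega>] by (auto intro!: exI[of _ 0])
  qed
qed

text \<open>The tail ratio \<open>u\<close> is at most squared at each step, while the levels
  \<open>t\<close> grow at most threefold. Geometric decay with ratio 1/24 already beats the factor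
  9 from the squared levels, so the second moment converges.\<close>

lemma (in prob_space) fernique:
  fixes X :: "nat \<Rightarrow> 'a \<Rightarrow> real"
  assumes G: "gauss_space M V" and V: "\<And>i. X i \<in> V"
    and bdd: "\<And>\<omega>. \<omega> \<in> space M \<Longrightarrow> bdd_above (range (\<lambda>i. \<bar>X i \<omega>\<bar>))"
  shows "(\<integral>\<^sup>+\<omega>. ennreal ((sup_abs X \<omega>)\<^sup>2) \<partial>M) < \<top>"
proof -
  have [measurable]: "X i \<in> borel_measurable M" for i
    using gaussD(1) gauss_spaceD(1)[OF G] V by auto
  define S where "S = sup_abs X"
  have [measurable]: "S \<in> borel_measurable M" unfolding S_def by measurable
  have S0: "S \<omega> \<ge> 0" for \<omega> by (simp add: S_def sup_abs_nonneg)
  define p where "p s = prob {\<omega>\<in>space M. \<forall>i. \<bar>X i \<omega>\<bar> \<le> s}" for s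
  have p: "p s = prob {\<omega>\<in>space M. S \<omega> \<le> s}" for s
    unfolding p_def S_def using bdd by (auto simp: sup_abs_le_iff intro!: arg_cong2[where f=measure])
  have p1: "p s \<le> 1" for s unfolding p by simp
  have q: "emeasure M {\<omega>\<in>space M. s < S \<omega>} = ennreal (1 - p s)" for s
  proof -
    have "prob {\<omega>\<in>space M. \<not> S \<omega> \<le> s} = 1 - p s" unfolding p by (rule prob_neg) auto
    then show ?thesis by (simp add: emeasure_eq_measure not_le)
  qed
  have "(\<lambda>n. p (real n)) \<longlonglongrightarrow> prob (\<Union>n. {\<omega>\<in>space M. S \<omega> \<le> real n})"
    unfolding p by (rule finite_Lim_measure_incseq) (auto simp: incseq_def)
  also have "(\<Union>n. {\<omega>\<in>space M. S \<omega> \<le> real n}) = space M" by (auto intro: real_arch_simple)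
  finally have "(\<lambda>n. p (real n)) \<longlonglongrightarrow> 1" by (simp add: prob_space)
  \<comment> \<open>With \<open>p s > 24/25\<close> the ratio \<open>(1 - p s) / p s\<close> is
    below 1/24.\<close>
  then have "eventually (\<lambda>n. p (real n) > 24/25) sequentially" by (rule order_tendstoD) simp
  then obtain n0 where n0: "\<And>n. n \<ge> n0 \<Longrightarrow> p (real n) > 24/25" by (auto simp: eventually_sequentially)
  define s where "s = real (Suc n0)"
  have s: "s > 0" "p s > 24/25" using n0[of "Suc n0"] by (auto simp: s_def)
  \<comment> \<open>The levels follow the recursion of \<open>fernique_step\<close>, starting from
    \<open>s\<close>.\<close>
  define t where "t = rec_nat s (\<lambda>_ x. s + sqrt 2 * x)"
  have t0: "t 0 = s" and tS: "t (Suc n) = s + sqrt 2 * t n" for n by (auto simp: t_def)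
  have s2: "1 \<le> sqrt 2" "sqrt 2 \<le> (2::real)" by (auto simp: real_le_lsqrt)
  have tge: "s \<le> t n" for n
    by (induction n) (use s in \<open>auto simp: t0 tS\<close>)
  have tle: "t n \<le> s * 3 ^ n" for n
  proof (induction n)
    case (Suc n)
    have "t (Suc n) \<le> t n + 2 * t n" unfolding tS using tge[of n] s2 s by (intro add_mono mult_right_mono) auto
    then show ?case using Suc by simp
  qed (simp add: t0)
  have tlow: "real (Suc n) * s \<le> t n" for n
  proof (induction n)
    case (Suc n)
    have "t n \<le> sqrt 2 * t n" using tge[of n] s2 s by (intro mult_le_cancel_right1[THEN iffD2]) auto
    then show ?case using Suc unfolding tS by (simp add: algebra_simps)
  qed (simp add: t0)
  define u where "u n = (1 - p (t n)) / p s" for n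
  have u0: "u n \<ge> 0" for n unfolding u_def using p1[of "t n"] s by auto
  have uS: "u (Suc n) \<le> (u n)\<^sup>2" for n
  proof -
    have "p s * (1 - p (t (Suc n))) \<le> (1 - p (t n))\<^sup>2"
      unfolding tS p_def by (rule fernique_step[OF G V])
    then have "p s * (1 - p (t (Suc n))) / (p s)\<^sup>2 \<le> (1 - p (t n))\<^sup>2 / (p s)\<^sup>2" by (intro divide_right_mono) auto
    then show ?thesis unfolding u_def using s by (simp add: power_divide) (simp add: power2_eq_square)
  qed
  have un: "u n \<le> (1/24) ^ Suc n" for n
  proof (induction n)
    case 0
    then show ?case unfolding u_def t0 using s by (simp add: field_simps)
  next
    case (Suc n)
    have "u (Suc n) \<le> u n * u n" using uS[of n] by (simp add: power2_eq_square)
    also have "\<dots> \<le> (1/24) ^ Suc n * (1/24)"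
    proof (rule mult_mono)
      have "(1/24::real) ^ Suc n \<le> (1/24) ^ 1" by (rule power_decreasing) auto
      then show "u n \<le> 1/24" using Suc by simp
    qed (use Suc u0 in auto)
    finally show ?case by simp
  qed
  define c where "c n = (t (Suc n))\<^sup>2" for n
  \<comment> \<open>A point with \<open>S \<omega> > s\<close> is charged to the level just below
    it: \<open>t k < S \<omega> \<le> t (Suc k)\<close>.\<close>
  have bound: "ennreal ((S \<omega>)\<^sup>2) \<le> ennreal (s\<^sup>2) + (\<Sum>n. ennreal (c n) * indicator {\<omega>\<in>space M. t n < S \<omega>} \<omega>)"
    if \<omega>: "\<omega> \<in> space M" for \<omega>
  proof (cases "S \<omega> \<le> s")
    case True
    then have "(S \<omega>)\<^sup>2 \<le> s\<^sup>2" using S0 by (intro power_mono) auto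
    then show ?thesis by (intro order_trans[OF ennreal_leI add_increasing2]) auto
  next
    case False
    obtain n1 :: nat where "S \<omega> / s \<le> real n1" using real_arch_simple by blast
    then have "S \<omega> \<le> real (Suc n1) * s" using s by (simp add: field_simps)
    then have ex: "S \<omega> \<le> t n1" using tlow[of n1] by linarith
    define m where "m = (LEAST n. S \<omega> \<le> t n)"
    have m: "S \<omega> \<le> t m" unfolding m_def by (rule LeastI, rule ex)
    obtain k where k: "m = Suc k" using m False t0 by (cases m) auto
    have tk: "t k < S \<omega>" using not_less_Least[of k "\<lambda>n. S \<omega> \<le> t n"] k unfolding m_def by auto
    have "(S \<omega>)\<^sup>2 \<le> c k" unfolding c_def using m k S0 by (intro power_mono) auto
    then have "ennreal ((S \<omega>)\<^sup>2) \<le> ennreal (c k) * indicator {\<omega>\<in>space M. t k < S \<omega>} \<omega>"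
      using tk \<omega> by (simp add: ennreal_leI)
    also have "\<dots> = (\<Sum>n\<in>{k}. ennreal (c n) * indicator {\<omega>\<in>space M. t n < S \<omega>} \<omega>)"
      by (subst sum.insert) auto
    also have "\<dots> \<le> (\<Sum>n. ennreal (c n) * indicator {\<omega>\<in>space M. t n < S \<omega>} \<omega>)"
      by (rule sum_le_suminf) auto
    finally show ?thesis by (simp add: add_increasing)
  qed
  have "(\<integral>\<^sup>+\<omega>. ennreal ((S \<omega>)\<^sup>2) \<partial>M) \<le> (\<integral>\<^sup>+\<omega>. ennreal (s\<^sup>2) + (\<Sum>n. ennreal (c n) * indicator {\<omega>\<in>space M. t n < S \<omega>} \<omega>) \<partial>M)"
    by (intro nn_integral_mono bound)
  also have "\<dots> = ennreal (s\<^sup>2) + (\<Sum>n. ennreal (c n) * ennreal (1 - p (t n)))"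
    by (simp add: nn_integral_add nn_integral_suminf nn_integral_cmult_indicator q emeasure_space_1)
  also have "\<dots> \<le> ennreal (s\<^sup>2) + (\<Sum>n. ennreal (s\<^sup>2 * (1/2) ^ Suc n))"
  proof (intro add_left_mono suminf_le summableI allI)
    fix n
    have "c n * (1 - p (t n)) \<le> (s * 3 ^ Suc n)\<^sup>2 * (1/24) ^ Suc n"
    proof (rule mult_mono)
      show "c n \<le> (s * 3 ^ Suc n)\<^sup>2" unfolding c_def using tle[of "Suc n"] tge[of "Suc n"] s by (intro power_mono) auto
      have "1 - p (t n) = u n * p s" unfolding u_def using s by simp
      also have "\<dots> \<le> u n * 1" using p1 u0 by (intro mult_left_mono)
      finally show "1 - p (t n) \<le> (1/24) ^ Suc n" using un[of n] by simp
    qed (use p1 in auto)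
    also have "\<dots> = s\<^sup>2 * (9/24) ^ Suc n"
    proof -
      have "(3 ^ Suc n)\<^sup>2 = (9::real) ^ Suc n" by (simp add: power2_eq_square power_mult_distrib[symmetric])
      then show ?thesis by (simp only: power_mult_distrib power_divide) simp
    qed
    also have "\<dots> \<le> s\<^sup>2 * (1/2) ^ Suc n" by (intro mult_left_mono power_mono) auto
    finally show "ennreal (c n) * ennreal (1 - p (t n)) \<le> ennreal (s\<^sup>2 * (1/2) ^ Suc n)"
      using p1 by (subst ennreal_mult[symmetric]) (auto simp: c_def intro!: ennreal_leI)
  qed
  also have "(\<Sum>n. ennreal (s\<^sup>2 * (1/2) ^ Suc n)) = ennreal (\<Sum>n. s\<^sup>2 * (1/2) ^ Suc n)"
    by (rule suminf_ennreal2) (auto intro!: summable_mult summable_geometric)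
  finally show ?thesis unfolding S_def by (rule le_less_trans) (simp add: ennreal_plus[symmetric] del: ennreal_plus)
qed

text \<open>A bound on the supremum is a rectangle with countably many sides, so the two
  distribution functions agree.\<close>

lemma (in prob_space) sup_abs_law_eq:
  fixes X Y :: "nat \<Rightarrow> 'a \<Rightarrow> real"
  assumes G: "gauss_space M V" and V: "\<And>i. X i \<in> V" "\<And>i. Y i \<in> V"
    and bdd: "\<And>\<omega>. \<omega> \<in> space M \<Longrightarrow> bdd_above (range (\<lambda>i. \<bar>X i \<omega>\<bar>))" "\<And>\<omega>. \<omega> \<in> space M \<Longrightarrow> bdd_above (range (\<lambda>i. \<bar>Y i \<omega>\<bar>))"
    and cov: "\<And>i j. expectation (\<lambda>\<omega>. X i \<omega> * X j \<omega>) = expectation (\<lambda>\<omega>. Y i \<omega> * Y j \<omega>)"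
    and f[measurable]: "f \<in> borel_measurable borel"
  shows "(\<integral>\<^sup>+\<omega>. f (sup_abs X \<omega>) \<partial>M) = (\<integral>\<^sup>+\<omega>. f (sup_abs Y \<omega>) \<partial>M)"
proof -
  have m[measurable]: "X i \<in> borel_measurable M" "Y i \<in> borel_measurable M" for i
    using gaussD(1) gauss_spaceD(1)[OF G] V by auto
  have "distr M borel (sup_abs X) = distr M borel (sup_abs Y)"
  proof (rule cdf_unique)
    show "cdf (distr M borel (sup_abs X)) = cdf (distr M borel (sup_abs Y))"
    proof
      fix s
      have e: "cdf (distr M borel (sup_abs Z)) s = prob {\<omega>\<in>space M. \<forall>i. Z i \<omega> \<in> {-s..s}}"
        if [measurable]: "\<And>i. Z i \<in> borel_measurable M" and "\<And>\<omega>. \<omega> \<in> space M \<Longrightarrow> bdd_above (range (\<lambda>i. \<bar>Z i \<omega>\<bar>))" for Z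
      proof -
        have "sup_abs Z -` {..s} \<inter> space M = {\<omega>\<in>space M. \<forall>i. Z i \<omega> \<in> {-s..s}}"
          unfolding abs_le_Icc[symmetric] using sup_abs_le_iff[of Z, OF that(2)] by auto
        then show ?thesis unfolding cdf_def by (subst measure_distr) auto
      qed
      show "cdf (distr M borel (sup_abs X)) s = cdf (distr M borel (sup_abs Y)) s"
        using gauss_space_law_eq[OF prob_space_axioms prob_space_axioms G V(1) G V(2) cov, of "\<lambda>_. {-s..s}"]
        by (simp only: e[of X] e[of Y] bdd m atLeastAtMost_borel)
    qed
  qed auto
  then have "(\<integral>\<^sup>+x. f x \<partial>distr M borel (sup_abs X)) = (\<integral>\<^sup>+x. f x \<partial>distr M borel (sup_abs Y))" by simp
  then show ?thesis by (simp add: nn_integral_distr)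
qed

section \<open>Counting zeros of a planar map\<close>

lemma ennreal_top_if_ge_nat:
  assumes "\<And>n::nat. ennreal (real n) \<le> x"
  shows "x = \<top>"
proof (rule ccontr)
  assume "x \<noteq> \<top>"
  then have "x < \<top>" by (simp only: less_top)
  then obtain n where "x < of_nat n" using ennreal_Ex_less_of_nat by blast
  then show False using assms[of n] by (simp add: ennreal_of_nat_eq_real_of_nat)
qed

section \<open>Plane geometry and packing of zeros\<close>

lemma norm2_sq: "(norm (x::real^2))\<^sup>2 = (x$1)\<^sup>2 + (x$2)\<^sup>2"
  unfolding power2_norm_eq_inner by (simp add: inner_vec_def sum_2 power2_eq_square)

lemma norm2_le: "norm (x::real^2) \<le> \<bar>x$1\<bar> + \<bar>x$2\<bar>"
  using norm_le_l1_cart[of x] by (simp add: sum_2)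

lemma inner2: "(x::real^2) \<bullet> y = x$1 * y$1 + x$2 * y$2"
  by (simp add: inner_vec_def sum_2)

text \<open>Ordered along the line, every length except the last is at most the gap to the next
  point. The gaps add up to at most \<open>d - c\<close>, and the last length is at most
  \<open>e\<close>. The induction removes the leftmost point and moves \<open>c\<close> to the next
  one.\<close>

lemma packing_line:
  fixes t l :: "'i \<Rightarrow> real"
  assumes "finite I" "c \<le> d" "e \<ge> 0"
    and "\<And>i. i \<in> I \<Longrightarrow> c \<le> t i \<and> t i \<le> d" "\<And>i. i \<in> I \<Longrightarrow> l i \<le> e"
    and "\<And>i j. i \<in> I \<Longrightarrow> j \<in> I \<Longrightarrow> i \<noteq> j \<Longrightarrow> l i \<le> \<bar>t i - t j\<bar>"
  shows "sum l I \<le> (d - c) + e"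
  using assms
proof (induction I arbitrary: c rule: finite_ranking_induct[where f="\<lambda>i. - t i"])
  case empty
  then show ?case by simp
next
  case (insert x S)
  show ?case
  proof (cases "x \<in> S")
    case True
    then have e: "insert x S = S" by auto
    show ?thesis using insert.prems unfolding e by (intro insert.IH)
  next
    case x: False
    show ?thesis
    proof (cases "S = {}")
      case True
      then show ?thesis using insert.prems by (auto intro: add_increasing)
    next
      case False
      define y where "y = arg_min_on t S"
      have y: "y \<in> S" "\<And>z. z \<in> S \<Longrightarrow> t y \<le> t z"
        unfolding y_def using insert.hyps(1) False by (auto intro: arg_min_if_finite arg_min_least)
      have "sum l S \<le> (d - t y) + e" using y insert.prems by (intro insert.IH) auto
      moreover have "l x \<le> \<bar>t x - t y\<bar>" using y x insert.prems(5)[of x y] by auto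
      moreover have "t x \<le> t y" using insert.hyps(2)[OF y(1)] by simp
      moreover have "c \<le> t x" using insert.prems by auto
      moreover have "sum l (insert x S) = l x + sum l S" using x insert.hyps(1) by simp
      ultimately show ?thesis by linarith
    qed
  qed
qed

text \<open>\<open>g m\<close> stands for the gradient of the \<open>m\<close>-th component of a
  planar map, so \<open>g 1 x\<close> and \<open>g 2 x\<close> are the rows of its
  derivative.\<close>

definition jac :: "(2 \<Rightarrow> real^2 \<Rightarrow> real^2) \<Rightarrow> real^2 \<Rightarrow> real" where
  "jac g x = g 1 x $ 1 * g 2 x $ 2 - g 1 x $ 2 * g 2 x $ 1"

definition rowmax :: "(2 \<Rightarrow> real^2 \<Rightarrow> real^2) \<Rightarrow> real^2 \<Rightarrow> real" where
  "rowmax g x = max (norm (g 1 x)) (norm (g 2 x))"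

lemma rowmax_ge: "norm (g m x) \<le> rowmax g x"
  using exhaust_2[of m] by (auto simp: rowmax_def)

lemma rowmax_nonneg: "rowmax g x \<ge> 0"
  using norm_ge_zero[of "g 1 x"] rowmax_ge[of g 1 x] by linarith

lemma rowmax_attained: "\<exists>m. rowmax g x = norm (g m x)"
  by (auto simp: rowmax_def max_def)

lemma rowmax_comp: "\<bar>g m x $ k\<bar> \<le> rowmax g x"
  using component_le_norm_cart[of "g m x" k] rowmax_ge[of g m x] by linarith

lemma jac_le: "\<bar>jac g x\<bar> \<le> 2 * (rowmax g x)\<^sup>2"
proof -
  have "\<bar>g 1 x $ 1 * g 2 x $ 2\<bar> \<le> rowmax g x * rowmax g x" "\<bar>g 1 x $ 2 * g 2 x $ 1\<bar> \<le> rowmax g x * rowmax g x"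
    unfolding abs_mult by (intro mult_mono rowmax_comp rowmax_nonneg abs_ge_zero)+
  then show ?thesis unfolding jac_def power2_eq_square by linarith
qed

text \<open>Cramer's rule: the adjugate matrix recovers \<open>jac g x\<close> times
  \<open>d\<close> from the two products \<open>g m x \<bullet> d\<close>.\<close>

lemma jac_inner_le:
  assumes "\<And>m. \<bar>g m x \<bullet> d\<bar> \<le> c"
  shows "\<bar>jac g x\<bar> * norm d \<le> 4 * rowmax g x * c"
proof -
  have r0: "rowmax g x \<ge> 0" by (rule rowmax_nonneg)
  have b: "\<bar>g m x $ k * (g m' x \<bullet> d)\<bar> \<le> rowmax g x * c" for m m' k
    unfolding abs_mult by (intro mult_mono rowmax_comp assms r0) auto
  have "jac g x * d$1 = g 2 x $ 2 * (g 1 x \<bullet> d) - g 1 x $ 2 * (g 2 x \<bullet> d)"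
       "jac g x * d$2 = g 1 x $ 1 * (g 2 x \<bullet> d) - g 2 x $ 1 * (g 1 x \<bullet> d)"
    unfolding jac_def inner2 by algebra+
  then have "\<bar>jac g x * d$1\<bar> \<le> 2 * (rowmax g x * c)" "\<bar>jac g x * d$2\<bar> \<le> 2 * (rowmax g x * c)"
    using b[of 2 2 1] b[of 1 2 2] b[of 1 1 2] b[of 2 1 1] by linarith+
  moreover have "\<bar>jac g x\<bar> * norm d \<le> \<bar>jac g x\<bar> * (\<bar>d$1\<bar> + \<bar>d$2\<bar>)"
    by (intro mult_left_mono norm2_le) simp
  ultimately show ?thesis by (simp add: abs_mult distrib_left)
qed

text \<open>Zeros whose distance is small compared to the size of their derivatives lie along one curve,
  and along this curve a zero is isolated at a scale proportional to its Jacobian.\<close>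

lemma clustered_zeros:
  fixes g :: "2 \<Rightarrow> real^2 \<Rightarrow> real^2"
  assumes K: "K > 0" and I: "finite I"
    and T: "\<And>x y m. x \<in> I \<Longrightarrow> y \<in> I \<Longrightarrow> \<bar>g m x \<bullet> (y - x)\<bar> \<le> K * (norm (y - x))\<^sup>2"
    and L: "\<And>x y m. x \<in> I \<Longrightarrow> y \<in> I \<Longrightarrow> norm (g m y - g m x) \<le> K * norm (y - x)"
    and D: "\<And>x. x \<in> I \<Longrightarrow> jac g x \<noteq> 0"
    and near: "\<And>i. i \<in> I \<Longrightarrow> norm (x - i) < rowmax g i / (16 * K)"
  shows "(\<Sum>i\<in>I. \<bar>jac g i\<bar> / (rowmax g i)\<^sup>2) \<le> 5"
proof (cases "I = {}")
  case False
  \<comment> \<open>\<open>i0\<close> has the largest derivative, of size \<open>s\<close>. All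
    points of \<open>I\<close> are within \<open>s / (8 * K)\<close> of each other, so every
    gradient changes by at most \<open>s / 8\<close> inside \<open>I\<close>.\<close>
  define i0 where "i0 = arg_min_on (\<lambda>i. - rowmax g i) I"
  define s where "s = rowmax g i0"
  have i0: "i0 \<in> I" "\<And>i. i \<in> I \<Longrightarrow> rowmax g i \<le> s"
    unfolding i0_def s_def using arg_min_if_finite[OF I False, of "\<lambda>i. - rowmax g i"] arg_min_least[OF I False, of _ "\<lambda>i. - rowmax g i"] by auto
  have pos: "rowmax g i > 0" if "i \<in> I" for i
    using D[OF that] jac_le[of g i] by (cases "rowmax g i = 0") (auto simp: rowmax_def less_max_iff_disj)
  have s0: "s > 0" unfolding s_def by (rule pos[OF i0(1)])
  have dst: "norm (j - i) \<le> s / (8 * K)" if "i \<in> I" "j \<in> I" for i j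
  proof -
    have "norm (j - i) \<le> norm (x - i) + norm (x - j)" using norm_triangle_ineq4[of "x - i" "x - j"] by simp
    also have "\<dots> \<le> s / (16 * K) + s / (16 * K)"
      using near[OF that(1)] near[OF that(2)] K
        divide_right_mono[OF i0(2)[OF that(1)], of "16 * K"] divide_right_mono[OF i0(2)[OF that(2)], of "16 * K"]
      by (intro add_mono) auto
    finally show ?thesis by simp
  qed
  obtain m where m: "s = norm (g m i0)" unfolding s_def using rowmax_attained by blast
  \<comment> \<open>The larger gradient at \<open>i0\<close>: up to an error \<open>s / 8\<close> it
    is a normal common to all points of the cluster.\<close>
  define n where "n = g m i0"
  have ns: "norm n = s" using m n_def by simp
  have dg: "norm (g m' i - g m' j) \<le> s / 8" if "i \<in> I" "j \<in> I" for i j m'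
  proof -
    have "norm (g m' i - g m' j) \<le> K * norm (i - j)" by (rule L) (use that in auto)
    also have "\<dots> \<le> K * (s / (8 * K))" using dst that K by (intro mult_left_mono) auto
    finally show ?thesis using K by simp
  qed
  have si: "rowmax g i \<ge> 7 * s / 8" if "i \<in> I" for i
    using dg[OF i0(1) that, of m] rowmax_ge[of g m i] norm_triangle_ineq2[of "g m i0" "g m i"] m by linarith
  \<comment> \<open>Coordinate along the direction orthogonal to \<open>n\<close>. Differences of
    zeros are almost orthogonal to \<open>n\<close>, so \<open>t\<close> preserves their distances
    up to a factor 2.\<close>
  define t where "t i = (n$1 * i$2 - n$2 * i$1) / s" for i :: "real^2"
  have tdiff: "norm (j - i) \<le> 2 * \<bar>t i - t j\<bar>" if ij: "i \<in> I" "j \<in> I" for i j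
  proof -
    define d where "d = j - i"
    have "\<bar>g m i \<bullet> d\<bar> \<le> K * (norm d)\<^sup>2" unfolding d_def by (rule T) fact+
    also have "\<dots> \<le> K * (s / (8 * K) * norm d)" unfolding power2_eq_square d_def
      using dst ij K by (intro mult_left_mono mult_right_mono) auto
    finally have 1: "\<bar>g m i \<bullet> d\<bar> \<le> s / 8 * norm d" using K by simp
    have "\<bar>(n - g m i) \<bullet> d\<bar> \<le> norm (n - g m i) * norm d" by (rule Cauchy_Schwarz_ineq2)
    also have "\<dots> \<le> s / 8 * norm d" unfolding n_def using dg[OF i0(1) ij(1)] by (intro mult_right_mono) auto
    finally have "\<bar>n \<bullet> d\<bar> \<le> s / 4 * norm d" using 1 unfolding inner_diff_left by linarith
    then have "(n \<bullet> d)\<^sup>2 \<le> (s / 4 * norm d)\<^sup>2" using s0 by (intro abs_le_square_iff[THEN iffD1]) simp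
    moreover have "(n \<bullet> d)\<^sup>2 + (n$1 * d$2 - n$2 * d$1)\<^sup>2 = s\<^sup>2 * (norm d)\<^sup>2"
      unfolding ns[symmetric] norm2_sq inner2 by algebra
    ultimately have "s\<^sup>2 * (norm d)\<^sup>2 \<le> (n$1 * d$2 - n$2 * d$1)\<^sup>2 + s\<^sup>2 * (norm d)\<^sup>2 / 16"
      by (simp add: power_mult_distrib power_divide)
    moreover have "n$1 * d$2 - n$2 * d$1 = s * (t j - t i)"
      using s0 unfolding t_def d_def by (simp add: field_simps)
    ultimately have "s\<^sup>2 * (norm d)\<^sup>2 \<le> s\<^sup>2 * (t j - t i)\<^sup>2 + s\<^sup>2 * (norm d)\<^sup>2 / 16"
      by (simp add: power_mult_distrib)
    then have "s\<^sup>2 * (norm d)\<^sup>2 \<le> s\<^sup>2 * ((t j - t i)\<^sup>2 + (norm d)\<^sup>2 / 16)" by (simp add: distrib_left)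
    then have "(norm d)\<^sup>2 \<le> (t j - t i)\<^sup>2 + (norm d)\<^sup>2 / 16" using s0 by (simp add: mult_le_cancel_left_pos)
    then have "(norm d)\<^sup>2 \<le> 4 * (t j - t i)\<^sup>2" using zero_le_power2[of "t j - t i"] by linarith
    then have "(norm d)\<^sup>2 \<le> (2 * \<bar>t i - t j\<bar>)\<^sup>2" by (simp add: power_mult_distrib power2_commute)
    then show ?thesis unfolding d_def by (rule power2_le_imp_le) simp
  qed
  \<comment> \<open>By \<open>jac_inner_le\<close> two zeros are at distance at least
    \<open>\<bar>jac g i\<bar> / (4 * K * rowmax g i)\<close>; half of this survives in the
    coordinate \<open>t\<close>.\<close>
  define l where "l i = \<bar>jac g i\<bar> / (8 * K * rowmax g i)" for i
  have "sum l I \<le> ((t i0 + s / (8 * K)) - (t i0 - s / (8 * K))) + s / (4 * K)"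
  proof (rule packing_line[OF I, where t=t])
    show "t i0 - s / (8 * K) \<le> t i0 + s / (8 * K)" "0 \<le> s / (4 * K)" using s0 K by auto
    fix i assume i: "i \<in> I"
    have "\<bar>n$1 * (i - i0)$2 - n$2 * (i - i0)$1\<bar> \<le> s * norm (i - i0)"
    proof (rule power2_le_imp_le)
      have "(n \<bullet> (i - i0))\<^sup>2 + (n$1 * (i - i0)$2 - n$2 * (i - i0)$1)\<^sup>2 = s\<^sup>2 * (norm (i - i0))\<^sup>2"
        unfolding ns[symmetric] norm2_sq inner2 by algebra
      then show "\<bar>n$1 * (i - i0)$2 - n$2 * (i - i0)$1\<bar>\<^sup>2 \<le> (s * norm (i - i0))\<^sup>2"
        using zero_le_power2[of "n \<bullet> (i - i0)"] unfolding power2_abs power_mult_distrib by linarith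
    qed (use s0 in auto)
    moreover have "n$1 * (i - i0)$2 - n$2 * (i - i0)$1 = s * (t i - t i0)"
      using s0 unfolding t_def by (simp add: field_simps)
    ultimately have "\<bar>t i - t i0\<bar> \<le> norm (i - i0)" using s0 by (simp add: abs_mult)
    also have "\<dots> \<le> s / (8 * K)" by (rule dst[OF i0(1) i])
    finally show "t i0 - s / (8 * K) \<le> t i \<and> t i \<le> t i0 + s / (8 * K)" by linarith
    have "\<bar>jac g i\<bar> \<le> 2 * rowmax g i * s"
      using jac_le[of g i] pos[OF i] unfolding power2_eq_square
      using mult_left_mono[OF i0(2)[OF i], of "2 * rowmax g i"] by (simp only: mult.assoc) linarith
    then show "l i \<le> s / (4 * K)" unfolding l_def using pos[OF i] K by (simp add: field_simps)
    fix j assume j: "j \<in> I" "i \<noteq> j"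
    have "\<bar>jac g i\<bar> * norm (j - i) \<le> 4 * rowmax g i * (K * (norm (j - i))\<^sup>2)"
      by (rule jac_inner_le) (use T i j in auto)
    then have "\<bar>jac g i\<bar> \<le> 4 * rowmax g i * K * norm (j - i)"
      using j by (simp add: power2_eq_square mult.assoc[symmetric])
    also have "\<dots> \<le> 4 * rowmax g i * K * (2 * \<bar>t i - t j\<bar>)"
      using tdiff[OF i j(1)] pos[OF i] K by (intro mult_left_mono) auto
    finally show "l i \<le> \<bar>t i - t j\<bar>" unfolding l_def using pos[OF i] K by (simp add: field_simps)
  qed
  then have suml: "sum l I \<le> s / (2 * K)" by simp
  \<comment> \<open>Every \<open>rowmax\<close> in the cluster is at least \<open>7 * s / 8\<close>,
    which replaces one factor of its square by a multiple of \<open>s\<close>. The resulting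
    constant 32/7 is below 5.\<close>
  have "(\<Sum>i\<in>I. \<bar>jac g i\<bar> / (rowmax g i)\<^sup>2) \<le> (\<Sum>i\<in>I. (64 * K / (7 * s)) * l i)"
  proof (rule sum_mono)
    fix i assume i: "i \<in> I"
    have "\<bar>jac g i\<bar> / (rowmax g i)\<^sup>2 = \<bar>jac g i\<bar> / rowmax g i * (1 / rowmax g i)" by (simp add: power2_eq_square)
    also have "\<dots> \<le> \<bar>jac g i\<bar> / rowmax g i * (8 / (7 * s))"
      using si[OF i] pos[OF i] s0 by (intro mult_left_mono) (auto simp: field_simps)
    also have "\<dots> = (64 * K / (7 * s)) * l i" unfolding l_def using K by (simp add: field_simps)
    finally show "\<bar>jac g i\<bar> / (rowmax g i)\<^sup>2 \<le> (64 * K / (7 * s)) * l i" .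
  qed
  also have "\<dots> = (64 * K / (7 * s)) * sum l I" by (simp add: sum_distrib_left)
  also have "\<dots> \<le> (64 * K / (7 * s)) * (s / (2 * K))" using suml s0 K by (intro mult_left_mono) auto
  also have "\<dots> \<le> 5" using s0 K by (simp add: field_simps)
  finally show ?thesis .
qed simp

text \<open>The cluster bound is integrated over the position \<open>x\<close>. The weight
  \<open>\<bar>jac g i\<bar> / (rowmax g i)\<^sup>2\<close> times the area of the ball of radius
  \<open>r i\<close> leaves the Jacobian itself, up to a factor of order
  \<open>1 / K\<^sup>2\<close>. The constant is \<open>5 * 9 * 256\<close>: the cluster bound, the
  area of \<open>ball p 3\<close> relative to the unit ball, and the square of the 16 in the
  radius.\<close>

lemma sum_jac_le:
  fixes g :: "2 \<Rightarrow> real^2 \<Rightarrow> real^2"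
  assumes K: "K > 0" and S: "finite S" "S \<subseteq> ball p 2"
    and T: "\<And>x y m. x \<in> S \<Longrightarrow> y \<in> S \<Longrightarrow> \<bar>g m x \<bullet> (y - x)\<bar> \<le> K * (norm (y - x))\<^sup>2"
    and L: "\<And>x y m. x \<in> S \<Longrightarrow> y \<in> S \<Longrightarrow> norm (g m y - g m x) \<le> K * norm (y - x)"
    and B: "\<And>x m. x \<in> S \<Longrightarrow> norm (g m x) \<le> K"
    and D: "\<And>x. x \<in> S \<Longrightarrow> jac g x \<noteq> 0"
  shows "(\<Sum>x\<in>S. \<bar>jac g x\<bar>) \<le> 11520 * K\<^sup>2"
proof -
  define r where "r i = rowmax g i / (16 * K)" for i
  define w where "w i = \<bar>jac g i\<bar> / (rowmax g i)\<^sup>2" for i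
  define \<beta> where "\<beta> = measure lborel (ball (0::real^2) 1)"
  have \<beta>: "\<beta> > 0" unfolding \<beta>_def by (simp add: content_ball_pos)
  have cb: "measure lborel (ball c \<rho>) = \<beta> * \<rho>\<^sup>2" if "\<rho> \<ge> 0" for c :: "real^2" and \<rho>
    unfolding \<beta>_def using content_ball_conv_unit_ball[OF that, of c] by (simp add: mult.commute)
  have bf: "emeasure lborel (ball (c::real^2) \<rho>) < \<top>" for c \<rho>
    using emeasure_lborel_ball_finite[of c \<rho>] by simp
  have w0: "w i \<ge> 0" for i by (simp add: w_def)
  have pos: "rowmax g i > 0" if "i \<in> S" for i
    using D[OF that] jac_le[of g i] by (cases "rowmax g i = 0") (auto simp: rowmax_def less_max_iff_disj)
  have r: "0 < r i" "r i \<le> 1" if "i \<in> S" for i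
  proof -
    show "0 < r i" unfolding r_def using pos[OF that] K by simp
    have "rowmax g i \<le> K" using B[OF that] by (simp add: rowmax_def)
    then show "r i \<le> 1" unfolding r_def using K by (simp add: field_simps)
  qed
  have "(LINT x|lborel. (\<Sum>i\<in>S. w i * indicator (ball i (r i)) x)) \<le> (LINT x|lborel. 5 * indicator (ball p 3) x)"
  proof (rule integral_mono)
    fix x
    \<comment> \<open>At a fixed \<open>x\<close> only the zeros whose ball contains
      \<open>x\<close> contribute, and these form a cluster.\<close>
    define I where "I = {i\<in>S. x \<in> ball i (r i)}"
    have "(\<Sum>i\<in>S. w i * indicator (ball i (r i)) x) = (\<Sum>i\<in>I. w i)"
      unfolding I_def using S(1) by (auto intro!: sum.mono_neutral_cong_right simp: indicator_def)
    also have "\<dots> \<le> 5 * indicator (ball p 3) x"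
    proof (cases "I = {}")
      case False
      then obtain i where i: "i \<in> S" "x \<in> ball i (r i)" by (auto simp: I_def)
      have "dist p x \<le> dist p i + dist i x" by (rule dist_triangle)
      also have "\<dots> < 2 + 1" using i r[OF i(1)] S(2) by (intro add_strict_mono) (auto simp: subset_eq)
      finally have "x \<in> ball p 3" by simp
      moreover have "(\<Sum>i\<in>I. w i) \<le> 5"
        unfolding w_def
        by (rule clustered_zeros[OF K, where x=x]) (use S T L D in \<open>auto simp: I_def r_def dist_norm norm_minus_commute\<close>)
      ultimately show ?thesis by simp
    qed simp
    finally show "(\<Sum>i\<in>S. w i * indicator (ball i (r i)) x) \<le> 5 * indicator (ball p 3) x" .
  qed (auto intro!: integrable_mult_right Bochner_Integration.integrable_sum integrable_real_indicator simp: bf)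
  moreover have "(LINT x|lborel. (\<Sum>i\<in>S. w i * indicator (ball i (r i)) x)) = (\<Sum>i\<in>S. w i * (\<beta> * (r i)\<^sup>2))"
    using r by (subst Bochner_Integration.integral_sum)
      (auto intro!: integrable_mult_right integrable_real_indicator sum.cong simp: bf cb less_imp_le)
  moreover have "\<dots> = (\<Sum>i\<in>S. \<bar>jac g i\<bar>) * (\<beta> / (256 * K\<^sup>2))"
    unfolding sum_distrib_right
  proof (rule sum.cong)
    fix i assume "i \<in> S"
    then show "w i * (\<beta> * (r i)\<^sup>2) = \<bar>jac g i\<bar> * (\<beta> / (256 * K\<^sup>2))"
      unfolding w_def r_def using pos[of i] K by (simp add: power_divide power_mult_distrib)
  qed simp
  moreover have "(LINT x|lborel. 5 * indicator (ball p 3) x) = 5 * (\<beta> * 9)"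
    using cb[of 3 p] by simp
  ultimately have "(\<Sum>i\<in>S. \<bar>jac g i\<bar>) * (\<beta> / (256 * K\<^sup>2)) \<le> 45 * \<beta>" by simp
  then show ?thesis using \<beta> K by (simp add: field_simps)
qed


section \<open>Area of the sublevel sets near the zeros\<close>

lemma content_linear_box:
  fixes T :: "real^2^2"
  shows "compact ((\<lambda>v. x + \<epsilon> *\<^sub>R (T *v v)) ` cbox (-1) 1)"
    "emeasure lborel ((\<lambda>v. x + \<epsilon> *\<^sub>R (T *v v)) ` cbox (-1) 1) = ennreal (4 * \<epsilon>\<^sup>2 * \<bar>det T\<bar>)"
proof -
  let ?f = "\<lambda>v. (\<epsilon> *\<^sub>R T) *v v"
  have im: "(\<lambda>v. x + \<epsilon> *\<^sub>R (T *v v)) ` cbox (-1) 1 = (+) x ` (?f ` cbox (-1) 1)"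
    by (simp add: image_image scaleR_matrix_vector_assoc)
  have lin: "linear ?f" by (rule matrix_vector_mul_linear)
  have c: "compact (?f ` cbox (-1) 1)"
    using lin by (intro compact_continuous_image linear_continuous_on) (auto simp: linear_conv_bounded_linear)
  show cc: "compact ((\<lambda>v. x + \<epsilon> *\<^sub>R (T *v v)) ` cbox (-1) 1)"
    unfolding im by (rule compact_translation[OF c])
  have box: "measure lebesgue (cbox (-1) (1::real^2)) = 4"
    using content_cbox_cart[of "-1" "1::real^2"] by (simp add: UNIV_2 interval_eq_empty_cart)
  have "measure lebesgue ((+) x ` (?f ` cbox (-1) 1)) = measure lebesgue (?f ` cbox (-1) 1)"
    by (rule measure_translation)
  also have "\<dots> = \<bar>det (matrix ?f)\<bar> * measure lebesgue (cbox (-1) (1::real^2))"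
    by (rule measure_linear_image[OF lin]) auto
  also have "\<dots> = 4 * \<epsilon>\<^sup>2 * \<bar>det T\<bar>"
    unfolding box by (simp add: det_2 power2_eq_square abs_mult[symmetric] algebra_simps)
      (simp add: abs_mult right_diff_distrib[symmetric] mult.assoc)
  finally have "measure lborel ((+) x ` (?f ` cbox (-1) 1)) = 4 * \<epsilon>\<^sup>2 * \<bar>det T\<bar>"
    using cc unfolding im by (simp add: compact_imp_closed borel_closed)
  then show "emeasure lborel ((\<lambda>v. x + \<epsilon> *\<^sub>R (T *v v)) ` cbox (-1) 1) = ennreal (4 * \<epsilon>\<^sup>2 * \<bar>det T\<bar>)"
    unfolding im[symmetric] using cc emeasure_compact_finite[OF cc] by (simp add: emeasure_eq_ennreal_measure less_top)
qed

lemma finite_separation: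
  fixes S :: "'a::metric_space set"
  assumes "finite S"
  shows "\<exists>e>0. \<forall>x\<in>S. \<forall>y\<in>S. x \<noteq> y \<longrightarrow> e \<le> dist x y"
  using assms
proof (induction S rule: finite_induct)
  case (insert a S)
  then obtain e where e: "e > 0" "\<forall>x\<in>S. \<forall>y\<in>S. x \<noteq> y \<longrightarrow> e \<le> dist x y" by auto
  obtain d where d: "d > 0" "\<forall>x\<in>S. x \<noteq> a \<longrightarrow> d \<le> dist a x" using finite_set_avoid[OF insert.hyps(1)] by blast
  show ?case
    by (rule exI[of _ "min d e"]) (use d e in \<open>auto simp: dist_commute min_le_iff_disj\<close>)
qed (auto intro: zero_less_one)

text \<open>Around a zero \<open>x\<close> the parallelogram with sides given by
  \<open>\<epsilon> *\<^sub>R T x\<close> lies in the sublevel set: the linear part of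
  \<open>f\<close> uses half of \<epsilon> and the quadratic remainder the other half.
  \<open>T x\<close> is a free parameter in place of the inverse derivative, because it must also
  make sense at singular zeros.\<close>

lemma sublevel_measure_ge:
  fixes f :: "2 \<Rightarrow> real^2 \<Rightarrow> real" and g :: "2 \<Rightarrow> real^2 \<Rightarrow> real^2" and T :: "real^2 \<Rightarrow> real^2^2"
  assumes K: "K > 0" and S: "finite S" "S \<subseteq> U" and U: "open U"
    and zero: "\<And>x m. x \<in> S \<Longrightarrow> f m x = 0"
    and E: "\<And>\<epsilon>. {y\<in>U. \<forall>m. \<bar>f m y\<bar> \<le> \<epsilon>} \<in> sets borel"
    and Tay: "\<And>x y m. x \<in> S \<Longrightarrow> y \<in> U \<Longrightarrow> \<bar>f m y - f m x - g m x \<bullet> (y - x)\<bar> \<le> K * (norm (y - x))\<^sup>2"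
    and T: "\<And>x v m. x \<in> S \<Longrightarrow> v \<in> cbox (-1) 1 \<Longrightarrow> \<bar>g m x \<bullet> (T x *v v)\<bar> \<le> 1/2"
  shows "\<exists>\<epsilon>0>0. \<forall>\<epsilon>. 0 < \<epsilon> \<and> \<epsilon> < \<epsilon>0 \<longrightarrow>
    ennreal (4 * \<epsilon>\<^sup>2 * (\<Sum>x\<in>S. \<bar>det (T x)\<bar>)) \<le> emeasure lborel {y\<in>U. \<forall>m. \<bar>f m y\<bar> \<le> \<epsilon>}"
proof -
  have "\<exists>b>0. \<forall>v\<in>cbox (-1) (1::real^2). norm (T x *v v) \<le> b" for x
  proof -
    have "bounded ((\<lambda>v. T x *v v) ` cbox (-1) 1)"
      by (intro bounded_linear_image bounded_cbox) (simp add: linear_conv_bounded_linear[symmetric] matrix_vector_mul_linear)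
    then show ?thesis unfolding bounded_pos by auto
  qed
  then obtain b where b: "\<And>x. b x > 0" "\<And>x v. v \<in> cbox (-1) (1::real^2) \<Longrightarrow> norm (T x *v v) \<le> b x" by metis
  \<comment> \<open>One size bound for all parallelograms; the summand 1 keeps it positive when
    \<open>S\<close> is empty.\<close>
  define B where "B = 1 + (\<Sum>x\<in>S. b x)"
  have B: "b x \<le> B" if "x \<in> S" for x
    unfolding B_def using member_le_sum[OF that, of b] less_imp_le[OF b(1)] S by auto
  have B1: "B \<ge> 1" unfolding B_def using b(1) by (simp add: sum_nonneg less_imp_le)
  have "\<exists>d>0. \<forall>x\<in>S. ball x d \<subseteq> U"
    using S(1,2)
  proof (induction S rule: finite_induct)
    case (insert x S)
    then obtain d where d: "d > 0" "\<forall>x\<in>S. ball x d \<subseteq> U" by auto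
    from insert U obtain e where "e > 0" "ball x e \<subseteq> U" using open_contains_ball by (metis insert_subset)
    with d show ?case by (intro exI[of _ "min d e"]) (auto simp: subset_eq)
  qed (auto intro: zero_less_one)
  then obtain d where d: "d > 0" "\<And>x. x \<in> S \<Longrightarrow> ball x d \<subseteq> U" by auto
  obtain e where e: "e > 0" "\<And>x y. x \<in> S \<Longrightarrow> y \<in> S \<Longrightarrow> x \<noteq> y \<Longrightarrow> e \<le> dist x y"
    using finite_separation[OF S(1)] by blast
  \<comment> \<open>The three bounds keep the parallelograms inside \<open>U\<close>, make them
    disjoint, and make the quadratic remainder at most \<open>\<epsilon> / 2\<close>.\<close>
  define \<epsilon>0 where "\<epsilon>0 = min (min (d / B) (e / (2 * B))) (1 / (2 * K * B\<^sup>2))"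
  show ?thesis
  proof (intro exI conjI allI impI)
    show "\<epsilon>0 > 0" unfolding \<epsilon>0_def using d e K B1 by auto
    fix \<epsilon> assume \<epsilon>: "0 < \<epsilon> \<and> \<epsilon> < \<epsilon>0"
    have eB: "\<epsilon> * B < d" "\<epsilon> * B < e / 2" "K * \<epsilon> * B\<^sup>2 \<le> 1/2"
      using \<epsilon> B1 K unfolding \<epsilon>0_def by (auto simp: field_simps)
    define P where "P x = (\<lambda>v. x + \<epsilon> *\<^sub>R (T x *v v)) ` cbox (-1) 1" for x
    have Pb: "dist x y \<le> \<epsilon> * B" if "x \<in> S" "y \<in> P x" for x y
    proof -
      from that obtain v where v: "v \<in> cbox (-1) 1" "y = x + \<epsilon> *\<^sub>R (T x *v v)" unfolding P_def by auto
      have "norm (T x *v v) \<le> B" using b(2)[OF v(1), of x] B[OF that(1)] by linarith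
      then show ?thesis using \<epsilon> by (simp add: v dist_norm mult_left_mono)
    qed
    have sub: "P x \<subseteq> {y\<in>U. \<forall>m. \<bar>f m y\<bar> \<le> \<epsilon>}" if x: "x \<in> S" for x
    proof
      fix y assume y: "y \<in> P x"
      have yU: "y \<in> U" using Pb[OF x y] eB(1) d(2)[OF x] by (auto simp: subset_eq)
      from y obtain v where v: "v \<in> cbox (-1) 1" "y = x + \<epsilon> *\<^sub>R (T x *v v)" unfolding P_def by auto
      have "\<bar>f m y\<bar> \<le> \<epsilon>" for m
      proof -
        have "\<bar>f m y\<bar> \<le> \<bar>g m x \<bullet> (y - x)\<bar> + K * (norm (y - x))\<^sup>2"
          using Tay[OF x yU, of m] zero[OF x, of m] by linarith
        also have "\<bar>g m x \<bullet> (y - x)\<bar> = \<epsilon> * \<bar>g m x \<bullet> (T x *v v)\<bar>" using \<epsilon> v by (simp add: abs_mult)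
        also have "\<dots> \<le> \<epsilon> * (1/2)" using \<epsilon> T[OF x v(1)] by (intro mult_left_mono) auto
        also have "K * (norm (y - x))\<^sup>2 \<le> K * (\<epsilon> * B)\<^sup>2"
          using Pb[OF x y] K by (intro mult_left_mono power_mono) (auto simp: dist_norm norm_minus_commute)
        also have "\<dots> = \<epsilon> * (K * \<epsilon> * B\<^sup>2)" by (simp add: power_mult_distrib power2_eq_square)
        also have "\<dots> \<le> \<epsilon> * (1/2)" using \<epsilon> eB(3) by (intro mult_left_mono) auto
        finally show ?thesis by simp
      qed
      with yU show "y \<in> {y\<in>U. \<forall>m. \<bar>f m y\<bar> \<le> \<epsilon>}" by auto
    qed
    have disj: "disjoint_family_on P S"
      unfolding disjoint_family_on_def
    proof (intro ballI impI)
      fix x y assume xy: "x \<in> S" "y \<in> S" "x \<noteq> y"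
      show "P x \<inter> P y = {}"
      proof (rule ccontr)
        assume "P x \<inter> P y \<noteq> {}"
        then obtain z where z: "z \<in> P x" "z \<in> P y" by auto
        have "dist x y \<le> dist x z + dist y z" by (rule dist_triangle2)
        then show False using Pb[OF xy(1) z(1)] Pb[OF xy(2) z(2)] eB(2) e(2)[OF xy] by linarith
      qed
    qed
    have "ennreal (4 * \<epsilon>\<^sup>2 * (\<Sum>x\<in>S. \<bar>det (T x)\<bar>)) = (\<Sum>x\<in>S. ennreal (4 * \<epsilon>\<^sup>2 * \<bar>det (T x)\<bar>))"
      by (simp add: sum_distrib_left)
    also have "\<dots> = (\<Sum>x\<in>S. emeasure lborel (P x))"
      unfolding P_def by (simp add: content_linear_box)
    also have "\<dots> = emeasure lborel (\<Union>x\<in>S. P x)"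
    proof (rule sum_emeasure[OF _ disj S(1)])
      show "P ` S \<subseteq> sets lborel"
        using content_linear_box(1) by (auto simp: P_def intro!: borel_closed compact_imp_closed)
    qed
    also have "\<dots> \<le> emeasure lborel {y\<in>U. \<forall>m. \<bar>f m y\<bar> \<le> \<epsilon>}"
      using sub E by (intro emeasure_mono) auto
    finally show "ennreal (4 * \<epsilon>\<^sup>2 * (\<Sum>x\<in>S. \<bar>det (T x)\<bar>)) \<le> emeasure lborel {y\<in>U. \<forall>m. \<bar>f m y\<bar> \<le> \<epsilon>}" .
  qed
qed

text \<open>The area divided by \<open>\<epsilon>\<^sup>2\<close> along
  \<open>\<epsilon> = 1 / (n + 1)\<close>; a sequence is what Fatou's lemma takes.\<close>

definition scaled_sublevel :: "(2 \<Rightarrow> real^2 \<Rightarrow> real) \<Rightarrow> (real^2) set \<Rightarrow> nat \<Rightarrow> ennreal" where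
  "scaled_sublevel f U n = ennreal ((real (Suc n))\<^sup>2) * emeasure lborel {y\<in>U. \<forall>m. \<bar>f m y\<bar> \<le> 1 / real (Suc n)}"

lemma liminf_scaled_sublevel_ge:
  fixes f :: "2 \<Rightarrow> real^2 \<Rightarrow> real" and g :: "2 \<Rightarrow> real^2 \<Rightarrow> real^2" and T :: "real^2 \<Rightarrow> real^2^2"
  assumes K: "K > 0" and S: "finite S" "S \<subseteq> U" and U: "open U"
    and zero: "\<And>x m. x \<in> S \<Longrightarrow> f m x = 0"
    and E: "\<And>\<epsilon>. {y\<in>U. \<forall>m. \<bar>f m y\<bar> \<le> \<epsilon>} \<in> sets borel"
    and Tay: "\<And>x y m. x \<in> S \<Longrightarrow> y \<in> U \<Longrightarrow> \<bar>f m y - f m x - g m x \<bullet> (y - x)\<bar> \<le> K * (norm (y - x))\<^sup>2"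
    and T: "\<And>x v m. x \<in> S \<Longrightarrow> v \<in> cbox (-1) 1 \<Longrightarrow> \<bar>g m x \<bullet> (T x *v v)\<bar> \<le> 1/2"
  shows "ennreal (4 * (\<Sum>x\<in>S. \<bar>det (T x)\<bar>)) \<le> liminf (scaled_sublevel f U)"
proof -
  obtain \<epsilon>0 where \<epsilon>0: "\<epsilon>0 > 0" "\<And>\<epsilon>. 0 < \<epsilon> \<Longrightarrow> \<epsilon> < \<epsilon>0 \<Longrightarrow>
    ennreal (4 * \<epsilon>\<^sup>2 * (\<Sum>x\<in>S. \<bar>det (T x)\<bar>)) \<le> emeasure lborel {y\<in>U. \<forall>m. \<bar>f m y\<bar> \<le> \<epsilon>}"
    using sublevel_measure_ge[OF assms] by blast
  have "(\<lambda>n. inverse (real (Suc n))) \<longlonglongrightarrow> 0" by (rule LIMSEQ_inverse_real_of_nat)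
  then have "eventually (\<lambda>n. inverse (real (Suc n)) < \<epsilon>0) sequentially" using \<epsilon>0(1) by (rule order_tendstoD)
  then have "eventually (\<lambda>n. ennreal (4 * (\<Sum>x\<in>S. \<bar>det (T x)\<bar>)) \<le> scaled_sublevel f U n) sequentially"
  proof eventually_elim
    case (elim n)
    have "ennreal (4 * (\<Sum>x\<in>S. \<bar>det (T x)\<bar>)) = ennreal ((real (Suc n))\<^sup>2) * ennreal (4 * (1 / real (Suc n))\<^sup>2 * (\<Sum>x\<in>S. \<bar>det (T x)\<bar>))"
      by (subst ennreal_mult[symmetric]) (auto simp: sum_nonneg power_divide simp del: of_nat_Suc)
    also have "\<dots> \<le> scaled_sublevel f U n"
      unfolding scaled_sublevel_def using elim by (intro mult_left_mono \<epsilon>0(2)) (auto simp: inverse_eq_divide)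
    finally show ?case .
  qed
  then show ?thesis by (intro Liminf_bounded)
qed

text \<open>A degenerate zero makes the right hand side infinite, so no
  separate argument is needed to exclude degenerate zeros.\<close>

lemma card_zeros_sq_le:
  fixes f :: "2 \<Rightarrow> real^2 \<Rightarrow> real" and g :: "2 \<Rightarrow> real^2 \<Rightarrow> real^2"
  assumes K: "K > 0" and S: "finite S" "S \<subseteq> U" "S \<subseteq> ball p 2" and U: "open U"
    and zero: "\<And>x m. x \<in> S \<Longrightarrow> f m x = 0"
    and E: "\<And>\<epsilon>. {y\<in>U. \<forall>m. \<bar>f m y\<bar> \<le> \<epsilon>} \<in> sets borel"
    and Tay: "\<And>x y m. x \<in> U \<Longrightarrow> y \<in> U \<Longrightarrow> \<bar>f m y - f m x - g m x \<bullet> (y - x)\<bar> \<le> K * (norm (y - x))\<^sup>2"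
    and L: "\<And>x y m. x \<in> U \<Longrightarrow> y \<in> U \<Longrightarrow> norm (g m y - g m x) \<le> K * norm (y - x)"
    and B: "\<And>x m. x \<in> U \<Longrightarrow> norm (g m x) \<le> K"
  shows "ennreal ((real (card S))\<^sup>2) \<le> ennreal (11520 * K\<^sup>2) * liminf (scaled_sublevel f U)"
proof (cases "\<exists>x\<in>S. jac g x = 0")
  case True
  then obtain x where x: "x \<in> S" "jac g x = 0" by auto
  have xU: "x \<in> U" using x S by auto
  \<comment> \<open>A unit vector in the kernel of the singular derivative.\<close>
  obtain z where z: "norm z = 1" "\<And>m. g m x \<bullet> z = 0"
  proof -
    have "\<exists>z. z \<noteq> 0 \<and> (\<forall>m. g m x \<bullet> z = 0)"
    proof (cases "g 1 x = 0")
      case True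
      show ?thesis
      proof (cases "g 2 x = 0")
        case t2: True
        show ?thesis by (rule exI[of _ "axis 1 1"]) (use True t2 in \<open>auto simp: forall_2 axis_eq_0_iff\<close>)
      next
        case False
        show ?thesis by (rule exI[of _ "vector [- (g 2 x $ 2), g 2 x $ 1]"]) 
          (use False True in \<open>auto simp: forall_2 inner2 vec_eq_iff\<close>)
      qed
    next
      case False
      show ?thesis by (rule exI[of _ "vector [- (g 1 x $ 2), g 1 x $ 1]"]) 
          (use False x in \<open>auto simp: forall_2 inner2 vec_eq_iff jac_def mult.commute\<close>)
    qed
    then obtain z where "z \<noteq> 0" "\<And>m. g m x \<bullet> z = 0" by blast
    then show ?thesis by (intro that[of "z /\<^sub>R norm z"]) auto
  qed
  have "ennreal (real n) \<le> liminf (scaled_sublevel f U)" for n :: nat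
  proof -
    define zp where "zp = (vector [- (z$2), z$1] :: real^2)"
    have zz: "(z$1)\<^sup>2 + (z$2)\<^sup>2 = 1" using norm2_sq[of z] z(1) by simp
    have nzp: "norm zp = 1" using norm2_sq[of zp] zz by (simp add: zp_def power2_eq_1_iff add.commute) (smt (verit) norm_ge_zero)
    \<comment> \<open>The parallelogram may be arbitrarily long in the kernel direction
      \<open>z\<close>, where the linear part vanishes, and has a fixed width across. The length is
      chosen so that the determinant is \<open>n / 2\<close>.\<close>
    define c where "c = real n * K"
    define T where "T = ((\<chi> i j. if j = 1 then c * z$i else zp$i / (2 * K)) :: real^2^2)"
    have Tv: "T *v v = (c * v$1) *\<^sub>R z + (v$2 / (2 * K)) *\<^sub>R zp" for v
      by (auto simp: T_def vec_eq_iff matrix_vector_mult_def sum_2)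
    have "det T = c * z$1 * zp$2 / (2 * K) - zp$1 / (2 * K) * (c * z$2)"
      by (simp add: det_2 T_def)
    also have "\<dots> = c / (2 * K) * ((z$1)\<^sup>2 + (z$2)\<^sup>2)" unfolding zp_def by (simp add: power2_eq_square algebra_simps add_divide_distrib)
    finally have dT: "det T = real n / 2" using K by (simp add: zz c_def)
    have "ennreal (4 * (\<Sum>x\<in>{x}. \<bar>det T\<bar>)) \<le> liminf (scaled_sublevel f U)"
    proof (rule liminf_scaled_sublevel_ge[OF K _ _ U _ E, where g=g])
      fix y v m assume "y \<in> {x}" and v: "v \<in> cbox (-1) (1::real^2)"
      then have y: "y = x" by simp
      have "\<bar>v$2\<bar> \<le> 1" using v by (auto simp: mem_box_cart abs_le_iff forall_2)
      have "\<bar>g m x \<bullet> (T *v v)\<bar> = \<bar>v$2\<bar> / (2 * K) * \<bar>g m x \<bullet> zp\<bar>"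
        using K by (simp add: Tv inner_add_right z abs_mult)
      also have "\<dots> \<le> 1 / (2 * K) * K"
      proof (rule mult_mono)
        have "\<bar>g m x \<bullet> zp\<bar> \<le> norm (g m x) * norm zp" by (rule Cauchy_Schwarz_ineq2)
        also have "\<dots> \<le> K" using B[OF xU] nzp by simp
        finally show "\<bar>g m x \<bullet> zp\<bar> \<le> K" .
      qed (use K \<open>\<bar>v$2\<bar> \<le> 1\<close> in \<open>auto intro: divide_right_mono\<close>)
      finally show "\<bar>g m y \<bullet> (T *v v)\<bar> \<le> 1/2" using K y by simp
    next
      fix y z m assume "y \<in> {x}" "z \<in> U"
      then show "\<bar>f m z - f m y - g m y \<bullet> (z - y)\<bar> \<le> K * (norm (z - y))\<^sup>2"
        using Tay[OF xU, of z m] by blast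
    qed (use x S zero in auto)
    moreover have "ennreal (real n) \<le> ennreal (4 * (\<Sum>x\<in>{x}. \<bar>det T\<bar>))" by (intro ennreal_leI) (simp add: dT)
    ultimately show ?thesis by (rule order_trans[rotated])
  qed
  then have "liminf (scaled_sublevel f U) = \<top>" by (rule ennreal_top_if_ge_nat)
  then show ?thesis using K by (simp add: ennreal_mult_top)
next
  case False
  \<comment> \<open>Half the inverse of the derivative: the linear part then maps the square to one
    of half its size, and \<open>4 * \<bar>det (T x)\<bar>\<close> is
    \<open>1 / \<bar>jac g x\<bar>\<close>.\<close>
  define T where "T x = ((\<chi> i j. (if i = 1 then (if j = 1 then g 2 x $ 2 else - (g 1 x $ 2)) else (if j = 1 then - (g 2 x $ 1) else g 1 x $ 1)) / (2 * jac g x)) :: real^2^2)" for x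
  have "ennreal (4 * (\<Sum>x\<in>S. \<bar>det (T x)\<bar>)) \<le> liminf (scaled_sublevel f U)"
  proof (rule liminf_scaled_sublevel_ge[OF K S(1,2) U zero E, where g=g])
    fix x and v :: "real^2" and m :: 2 assume x: "x \<in> S" and v: "v \<in> cbox (-1) 1"
    have vm: "\<bar>v$m\<bar> \<le> 1" using v by (auto simp: mem_box_cart abs_le_iff)
    have j: "jac g x \<noteq> 0" using False x by auto
    have "g m x \<bullet> (T x *v v) = v$m * jac g x / (2 * jac g x)"
      using exhaust_2[of m]
      by (auto simp: inner2 T_def matrix_vector_mult_def sum_2 jac_def algebra_simps add_divide_distrib[symmetric] diff_divide_distrib[symmetric])
    then show "\<bar>g m x \<bullet> (T x *v v)\<bar> \<le> 1/2" using j vm by simp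
  qed (use S Tay in auto)
  moreover have "\<bar>det (T x)\<bar> = 1 / (4 * \<bar>jac g x\<bar>)" if "x \<in> S" for x
  proof -
    have j: "jac g x \<noteq> 0" using False that by auto
    have "det (T x) = jac g x / (2 * jac g x * (2 * jac g x))"
    proof -
      have e: "p / q * (r / q) - (- u / q) * (- w / q) = (p * r - u * w) / (q * q)" for p q r u w :: real
        by (simp add: diff_divide_distrib)
      have "det (T x) = g 2 x $ 2 / (2 * jac g x) * (g 1 x $ 1 / (2 * jac g x))
          - (- (g 1 x $ 2) / (2 * jac g x)) * (- (g 2 x $ 1) / (2 * jac g x))"
        unfolding det_2 T_def by simp
      also have "\<dots> = (g 2 x $ 2 * g 1 x $ 1 - g 1 x $ 2 * g 2 x $ 1) / (2 * jac g x * (2 * jac g x))" by (rule e)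
      also have "g 2 x $ 2 * g 1 x $ 1 - g 1 x $ 2 * g 2 x $ 1 = jac g x" unfolding jac_def by simp
      finally show ?thesis .
    qed
    then show ?thesis using j by (simp add: abs_mult)
  qed
  ultimately have 1: "ennreal (\<Sum>x\<in>S. 1 / \<bar>jac g x\<bar>) \<le> liminf (scaled_sublevel f U)"
    by (simp add: sum_distrib_left)
  have T0: "\<bar>g m x \<bullet> (y - x)\<bar> \<le> K * (norm (y - x))\<^sup>2" if "x \<in> S" "y \<in> S" for x y m
    using Tay[of x y m] zero[OF that(1), of m] zero[OF that(2), of m] that S(2) by auto
  have 2: "(\<Sum>x\<in>S. \<bar>jac g x\<bar>) \<le> 11520 * K\<^sup>2"
  proof (rule sum_jac_le[OF K S(1,3) T0])
    show "norm (g m y - g m x) \<le> K * norm (y - x)" if "x \<in> S" "y \<in> S" for x y m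
      using L[of x y m] that S(2) by blast
  qed (use B S(2) False in auto)
  have "(real (card S))\<^sup>2 = (\<Sum>x\<in>S. sqrt \<bar>jac g x\<bar> * (1 / sqrt \<bar>jac g x\<bar>))\<^sup>2"
    using False by (simp add: sum.cong[where h="\<lambda>_. 1::real" and B=S])
  also have "\<dots> \<le> (\<Sum>x\<in>S. (sqrt \<bar>jac g x\<bar>)\<^sup>2) * (\<Sum>x\<in>S. (1 / sqrt \<bar>jac g x\<bar>)\<^sup>2)"
    by (rule Cauchy_Schwarz_ineq_sum)
  also have "\<dots> = (\<Sum>x\<in>S. \<bar>jac g x\<bar>) * (\<Sum>x\<in>S. 1 / \<bar>jac g x\<bar>)"
    by (simp add: power_divide)
  also have "\<dots> \<le> (11520 * K\<^sup>2) * (\<Sum>x\<in>S. 1 / \<bar>jac g x\<bar>)"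
    using 2 by (intro mult_right_mono) (auto intro: sum_nonneg)
  finally have "ennreal ((real (card S))\<^sup>2) \<le> ennreal ((11520 * K\<^sup>2) * (\<Sum>x\<in>S. 1 / \<bar>jac g x\<bar>))"
    by (rule ennreal_leI)
  also have "\<dots> = ennreal (11520 * K\<^sup>2) * ennreal (\<Sum>x\<in>S. 1 / \<bar>jac g x\<bar>)"
    by (rule ennreal_mult) (auto intro: sum_nonneg)
  also have "\<dots> \<le> ennreal (11520 * K\<^sup>2) * liminf (scaled_sublevel f U)"
    using 1 by (intro mult_left_mono) auto
  finally show ?thesis .
qed

section \<open>Iterated partial derivatives\<close>

text \<open>The head of the list is the derivative taken last.\<close>

fun iter_pd :: "2 list \<Rightarrow> (real^2 \<Rightarrow> real) \<Rightarrow> real^2 \<Rightarrow> real" where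
  "iter_pd [] f = f"
| "iter_pd (i # \<alpha>) f = pd i (iter_pd \<alpha> f)"

text \<open>\<open>Ck\<close> unfolds the innermost derivative and \<open>iter_pd\<close> the
  outermost one; this equation mediates between them in inductions on the order.\<close>

lemma iter_pd_snoc: "iter_pd (\<alpha> @ [i]) f = iter_pd \<alpha> (pd i f)"
  by (induction \<alpha>) auto

lemma Ck_continuous_iter_pd: "Ck k f \<Longrightarrow> length \<alpha> \<le> k \<Longrightarrow> continuous_on UNIV (iter_pd \<alpha> f)"
proof (induction k arbitrary: f \<alpha>)
  case (Suc k)
  then show ?case by (cases \<alpha> rule: rev_cases) (auto simp: iter_pd_snoc)
qed auto

lemma Ck_differentiable_iter_pd:
  "Ck k f \<Longrightarrow> length \<alpha> < k \<Longrightarrow> (\<lambda>t. iter_pd \<alpha> f (x + t *\<^sub>R axis i 1)) differentiable (at 0)"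
proof (induction k arbitrary: f \<alpha>)
  case (Suc k)
  then show ?case by (cases \<alpha> rule: rev_cases) (auto simp: iter_pd_snoc)
qed auto

lemma iter_pd_has_derivative:
  assumes "Ck k f" "length \<alpha> < k"
  shows "((\<lambda>t. iter_pd \<alpha> f (x + t *\<^sub>R axis i 1)) has_real_derivative iter_pd (i # \<alpha>) f (x + t *\<^sub>R axis i 1)) (at t)"
proof -
  let ?h = "\<lambda>s. iter_pd \<alpha> f ((x + t *\<^sub>R axis i 1) + s *\<^sub>R axis i 1)"
  have "?h differentiable (at 0)" by (rule Ck_differentiable_iter_pd[OF assms])
  then have "(?h has_real_derivative deriv ?h 0) (at 0)"
    by (simp add: DERIV_deriv_iff_real_differentiable)
  then have "((\<lambda>s. ?h (s + (- t))) has_real_derivative deriv ?h 0) (at t)"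
    using DERIV_shift[of ?h "deriv ?h 0" t "- t"] by simp
  then show ?thesis by (simp add: pd_def algebra_simps)
qed

text \<open>The difference quotient is written as a linear combination of two values, the form under
  which Gaussian spaces are closed.\<close>

lemma iter_pd_seq:
  assumes "Ck k f" "length \<alpha> < k"
  shows "(\<lambda>n. real (Suc n) * iter_pd \<alpha> f (x + (1 / real (Suc n)) *\<^sub>R axis i 1) + (- real (Suc n)) * iter_pd \<alpha> f x)
     \<longlonglongrightarrow> iter_pd (i # \<alpha>) f x"
proof -
  let ?h = "\<lambda>t. iter_pd \<alpha> f (x + t *\<^sub>R axis i 1)"
  have "(?h has_real_derivative iter_pd (i # \<alpha>) f (x + 0 *\<^sub>R axis i 1)) (at 0)"
    by (rule iter_pd_has_derivative[OF assms])
  then have "((\<lambda>t. (?h t - ?h 0) / t) \<longlongrightarrow> iter_pd (i # \<alpha>) f x) (at 0)"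
    by (simp add: has_field_derivative_iff)
  moreover have "filterlim (\<lambda>n. 1 / real (Suc n)) (at 0) sequentially"
    using LIMSEQ_inverse_real_of_nat by (auto simp: filterlim_at inverse_eq_divide simp del: of_nat_Suc)
  ultimately have "(\<lambda>n. (?h (1 / real (Suc n)) - ?h 0) / (1 / real (Suc n))) \<longlonglongrightarrow> iter_pd (i # \<alpha>) f x"
    by (rule filterlim_compose)
  then show ?thesis by (simp add: algebra_simps del: of_nat_Suc)
qed

lemma axis_mvt:
  assumes "Ck k f" "length \<alpha> < k"
  obtains \<xi> where "\<xi> \<in> closed_segment 0 s"
    "iter_pd \<alpha> f (x + s *\<^sub>R axis i 1) - iter_pd \<alpha> f x = s * iter_pd (i # \<alpha>) f (x + \<xi> *\<^sub>R axis i 1)"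
proof -
  let ?h = "\<lambda>t. iter_pd \<alpha> f (x + t *\<^sub>R axis i 1)" and ?h' = "\<lambda>t. iter_pd (i # \<alpha>) f (x + t *\<^sub>R axis i 1)"
  note d = iter_pd_has_derivative[OF assms, of x i]
  consider "s = 0" | "s > 0" | "s < 0" by linarith
  then show ?thesis
  proof cases
    case 1
    then show ?thesis by (intro that[of 0]) auto
  next
    case 2
    obtain z where "0 < z" "z < s" "?h s - ?h 0 = (s - 0) * ?h' z" using MVT2[OF 2, of ?h ?h'] d by blast
    then show ?thesis by (intro that[of z]) (auto simp: closed_segment_eq_real_ivl)
  next
    case 3
    obtain z where "s < z" "z < 0" "?h 0 - ?h s = (0 - s) * ?h' z" using MVT2[OF 3, of ?h ?h'] d by blast
    then show ?thesis by (intro that[of z]) (auto simp: closed_segment_eq_real_ivl algebra_simps)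
  qed
qed

text \<open>The increment is split along the two axis-parallel edges joining \<open>x\<close> to \<open>y\<close> inside a box.\<close>

lemma box_increment:
  fixes x y :: "real^2"
  assumes f: "Ck k f" "length \<alpha> < k" and xy: "x \<in> box a b" "y \<in> box a b"
  obtains u v where "u \<in> box a b" "v \<in> box a b" "norm (u - x) \<le> norm (y - x)" "norm (v - x) \<le> norm (y - x)"
    "iter_pd \<alpha> f y - iter_pd \<alpha> f x
      = (y$1 - x$1) * iter_pd (1 # \<alpha>) f u + (y$2 - x$2) * iter_pd (2 # \<alpha>) f v"
proof -
  define z where "z = x + (y$1 - x$1) *\<^sub>R axis 1 1"
  have zy: "y = z + (y$2 - x$2) *\<^sub>R axis 2 1"
    unfolding z_def by (simp add: vec_eq_iff forall_2 axis_def)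
  obtain \<xi> where \<xi>: "\<xi> \<in> closed_segment 0 (y$1 - x$1)"
    "iter_pd \<alpha> f z - iter_pd \<alpha> f x = (y$1 - x$1) * iter_pd (1 # \<alpha>) f (x + \<xi> *\<^sub>R axis 1 1)"
    unfolding z_def by (rule axis_mvt[OF f])
  obtain \<eta> where \<eta>: "\<eta> \<in> closed_segment 0 (y$2 - x$2)"
    "iter_pd \<alpha> f y - iter_pd \<alpha> f z = (y$2 - x$2) * iter_pd (2 # \<alpha>) f (z + \<eta> *\<^sub>R axis 2 1)"
    using axis_mvt[OF f, of "y$2 - x$2" z 2, folded zy] by metis
  have b1: "\<bar>\<xi>\<bar> \<le> \<bar>y$1 - x$1\<bar>" "\<bar>\<eta>\<bar> \<le> \<bar>y$2 - x$2\<bar>"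
    using \<xi>(1) \<eta>(1) by (auto simp: closed_segment_eq_real_ivl split: if_splits)
  define u where "u = x + \<xi> *\<^sub>R axis 1 1"
  define v where "v = z + \<eta> *\<^sub>R axis 2 1"
  have uc: "u$1 = x$1 + \<xi>" "u$2 = x$2" by (auto simp: u_def axis_def)
  have vc: "v$1 = y$1" "v$2 = x$2 + \<eta>" by (auto simp: v_def z_def axis_def)
  show ?thesis
  proof (rule that[of u v])
    show "u \<in> box a b" "v \<in> box a b"
      using xy \<xi>(1) \<eta>(1) by (auto simp: mem_box_cart forall_2 uc vc closed_segment_eq_real_ivl split: if_splits)
    have "(norm (u - x))\<^sup>2 \<le> (norm (y - x))\<^sup>2"
      unfolding norm2_sq using abs_le_square_iff[THEN iffD1, OF b1(1)] by (simp add: uc add_increasing2)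
    then show "norm (u - x) \<le> norm (y - x)" by (rule power2_le_imp_le) simp
    have "(norm (v - x))\<^sup>2 \<le> (norm (y - x))\<^sup>2"
      unfolding norm2_sq using abs_le_square_iff[THEN iffD1, OF b1(2)] by (simp add: vc add_increasing)
    then show "norm (v - x) \<le> norm (y - x)" by (rule power2_le_imp_le) simp
    show "iter_pd \<alpha> f y - iter_pd \<alpha> f x
      = (y$1 - x$1) * iter_pd (1 # \<alpha>) f u + (y$2 - x$2) * iter_pd (2 # \<alpha>) f v"
      unfolding u_def v_def using \<xi>(2) \<eta>(2) by simp
  qed
qed

lemma abs_comp_sum_le: "\<bar>y$1 - x$1\<bar> + \<bar>y$2 - x$2\<bar> \<le> 2 * norm (y - x :: real^2)"
  using component_le_norm_cart[of "y - x" 1] component_le_norm_cart[of "y - x" 2] by simp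

lemma abs_increment_le:
  assumes "\<bar>p\<bar> \<le> c" "\<bar>q\<bar> \<le> c"
  shows "\<bar>(y$1 - x$1) * p + (y$2 - x$2) * q\<bar> \<le> 2 * c * norm (y - x :: real^2)"
proof -
  have "\<bar>(y$1 - x$1) * p\<bar> \<le> \<bar>y$1 - x$1\<bar> * c" "\<bar>(y$2 - x$2) * q\<bar> \<le> \<bar>y$2 - x$2\<bar> * c"
    unfolding abs_mult using assms by (auto intro: mult_left_mono)
  then have "\<bar>(y$1 - x$1) * p + (y$2 - x$2) * q\<bar> \<le> c * (\<bar>y$1 - x$1\<bar> + \<bar>y$2 - x$2\<bar>)"
    by (simp add: algebra_simps abs_triangle_ineq[THEN order_trans])
  also have "\<dots> \<le> c * (2 * norm (y - x))" using assms abs_comp_sum_le by (intro mult_left_mono) auto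
  finally show ?thesis by simp
qed

lemma iter_pd_lipschitz:
  assumes "Ck k f" "length \<alpha> < k" "x \<in> box a b" "y \<in> box a b"
    and "\<And>i z. z \<in> box a b \<Longrightarrow> \<bar>iter_pd (i # \<alpha>) f z\<bar> \<le> c"
  shows "\<bar>iter_pd \<alpha> f y - iter_pd \<alpha> f x\<bar> \<le> 2 * c * norm (y - x)"
  using box_increment[OF assms(1-4)] assms(5) by (metis abs_increment_le)

text \<open>The mean value theorem along the two edges gives derivatives at intermediate points. The
  Lipschitz condition moves them to \<open>x\<close>, with an error proportional to the
  distance.\<close>

lemma iter_pd_taylor:
  assumes f: "Ck k f" "length \<alpha> < k" "x \<in> box a b" "y \<in> box a b"
    and L: "\<And>i z. z \<in> box a b \<Longrightarrow> \<bar>iter_pd (i # \<alpha>) f z - iter_pd (i # \<alpha>) f x\<bar> \<le> c * norm (z - x)" and c: "c \<ge> 0"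
  shows "\<bar>iter_pd \<alpha> f y - iter_pd \<alpha> f x - ((y$1 - x$1) * iter_pd (1 # \<alpha>) f x + (y$2 - x$2) * iter_pd (2 # \<alpha>) f x)\<bar>
     \<le> 2 * c * (norm (y - x))\<^sup>2"
proof -
  obtain u v where uv: "u \<in> box a b" "v \<in> box a b" "norm (u - x) \<le> norm (y - x)" "norm (v - x) \<le> norm (y - x)"
    "iter_pd \<alpha> f y - iter_pd \<alpha> f x
      = (y$1 - x$1) * iter_pd (1 # \<alpha>) f u + (y$2 - x$2) * iter_pd (2 # \<alpha>) f v"
    by (rule box_increment[OF f])
  have "\<bar>(y$1 - x$1) * (iter_pd (1 # \<alpha>) f u - iter_pd (1 # \<alpha>) f x) + (y$2 - x$2) * (iter_pd (2 # \<alpha>) f v - iter_pd (2 # \<alpha>) f x)\<bar>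
     \<le> 2 * (c * norm (y - x)) * norm (y - x)"
    using L[OF uv(1), of 1] L[OF uv(2), of 2] mult_left_mono[OF uv(3) c] mult_left_mono[OF uv(4) c]
    by (intro abs_increment_le) (auto intro: order_trans)
  then show ?thesis unfolding uv(5) by (simp add: algebra_simps power2_eq_square)
qed

section \<open>Zeros of the specular point equation in one cell\<close>

definition spec_fun :: "real \<Rightarrow> (real^2 \<Rightarrow> real) \<Rightarrow> 2 \<Rightarrow> real^2 \<Rightarrow> real" where
  "spec_fun k f m x = iter_pd [m] f x - k * x$m"

lemma spec_fun_continuous: "Ck 3 f \<Longrightarrow> continuous_on UNIV (spec_fun k f m)"
  unfolding spec_fun_def[abs_def] by (intro continuous_intros Ck_continuous_iter_pd[where k=3]) auto

text \<open>Half-open, so that integer translates tile the plane.\<close>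

definition cell :: "real^2 \<Rightarrow> (real^2) set" where
  "cell p = {x. \<forall>i. p$i \<le> x$i \<and> x$i < p$i + 1}"

text \<open>A margin of 1 around the cell: the sublevel sets are measured in an open set that
  contains every zero of the half-open cell.\<close>

definition nbhd :: "real^2 \<Rightarrow> (real^2) set" where
  "nbhd p = box (\<chi> i. p$i - 1) (\<chi> i. p$i + 2)"

text \<open>Counting measure gives infinite sets the value \<open>\<infinity>\<close>, unlike
  \<open>card\<close>, so an upper bound on this count also proves finiteness.\<close>

definition num_zeros :: "real \<Rightarrow> (real^2 \<Rightarrow> real) \<Rightarrow> (real^2) set \<Rightarrow> ennreal" where
  "num_zeros k f A = emeasure (count_space UNIV) {x\<in>A. \<forall>m. spec_fun k f m x = 0}"

lemma cell_subset: "cell p \<subseteq> nbhd p" "cell p \<subseteq> ball p 2"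
proof -
  show "cell p \<subseteq> nbhd p"
    unfolding cell_def nbhd_def by (auto simp: mem_box_cart algebra_simps intro: less_le_trans le_less_trans) (smt (verit))+
  show "cell p \<subseteq> ball p 2"
  proof
    fix x assume x: "x \<in> cell p"
    have "norm (p - x) \<le> \<bar>(p - x)$1\<bar> + \<bar>(p - x)$2\<bar>" by (rule norm2_le)
    also have "\<dots> < 1 + 1" using x[unfolded cell_def, simplified, rule_format, of 1] x[unfolded cell_def, simplified, rule_format, of 2]
      by (intro add_strict_mono) (auto simp: abs_if)
    finally show "x \<in> ball p 2" by (simp add: dist_norm)
  qed
qed

text \<open>The entries of the derivative of \<open>F\<close> are second derivatives of
  \<open>f\<close>, shifted by at most \<open>k \<le> 1 \<le> c\<close>. All constants that the
  counting bound asks for are then covered by \<open>K = 4 * c\<close>, and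
  \<open>184320 = 11520 * 16\<close>.\<close>

theorem num_zeros_cell_sq_le:
  assumes f: "Ck 3 f" and k: "0 < k" "k \<le> 1" and c: "c \<ge> 1"
    and bnd: "\<And>\<alpha> z. length \<alpha> \<in> {2,3} \<Longrightarrow> z \<in> nbhd p \<Longrightarrow> \<bar>iter_pd \<alpha> f z\<bar> \<le> c"
  shows "(num_zeros k f (cell p))\<^sup>2 \<le> ennreal (184320 * c\<^sup>2) * liminf (scaled_sublevel (spec_fun k f) (nbhd p))"
proof -
  define g where "g m x = (\<chi> j. iter_pd [j, m] f x - (if j = m then k else 0))" for m x
  let ?U = "nbhd p" and ?F = "spec_fun k f"
  have U: "open ?U" by (simp add: nbhd_def open_box)
  have lip: "\<bar>iter_pd [j, m] f y - iter_pd [j, m] f x\<bar> \<le> 2 * c * norm (y - x)" if "x \<in> ?U" "y \<in> ?U" for j m x y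
    using that bnd unfolding nbhd_def by (intro iter_pd_lipschitz[OF f]) (auto simp del: iter_pd.simps)
  have E: "{y\<in>?U. \<forall>m. \<bar>?F m y\<bar> \<le> \<epsilon>} \<in> sets borel" for \<epsilon>
  proof -
    have "closed {y. \<forall>m. \<bar>?F m y\<bar> \<le> \<epsilon>}"
      by (intro closed_Collect_all closed_Collect_le continuous_intros spec_fun_continuous f)
    then have "?U \<inter> {y. \<forall>m. \<bar>?F m y\<bar> \<le> \<epsilon>} \<in> sets borel"
      using U by (intro sets.Int borel_open borel_closed)
    then show ?thesis by (simp add: Collect_conj_eq)
  qed
  have Tay: "\<bar>?F m y - ?F m x - g m x \<bullet> (y - x)\<bar> \<le> 4 * c * (norm (y - x))\<^sup>2" if xy: "x \<in> ?U" "y \<in> ?U" for x y m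
  proof -
    have "\<bar>iter_pd [m] f y - iter_pd [m] f x - ((y$1 - x$1) * iter_pd [1, m] f x + (y$2 - x$2) * iter_pd [2, m] f x)\<bar>
     \<le> 2 * (2 * c) * (norm (y - x))\<^sup>2"
      using xy lip c unfolding nbhd_def by (intro iter_pd_taylor[OF f]) (auto simp del: iter_pd.simps)
    moreover have "?F m y - ?F m x - g m x \<bullet> (y - x) = iter_pd [m] f y - iter_pd [m] f x - ((y$1 - x$1) * iter_pd [1, m] f x + (y$2 - x$2) * iter_pd [2, m] f x)"
      using exhaust_2[of m] unfolding spec_fun_def g_def inner2 by (auto simp: algebra_simps simp del: iter_pd.simps)
    ultimately show ?thesis by simp
  qed
  have L: "norm (g m y - g m x) \<le> 4 * c * norm (y - x)" if "x \<in> ?U" "y \<in> ?U" for x y m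
  proof -
    have "norm (g m y - g m x) \<le> \<bar>(g m y - g m x)$1\<bar> + \<bar>(g m y - g m x)$2\<bar>" by (rule norm2_le)
    also have "\<dots> \<le> 2 * c * norm (y - x) + 2 * c * norm (y - x)"
      using lip[OF that] by (intro add_mono) (auto simp: g_def simp del: iter_pd.simps)
    finally show ?thesis by simp
  qed
  have B: "norm (g m x) \<le> 4 * c" if "x \<in> ?U" for x m
  proof -
    have "\<bar>g m x $ j\<bar> \<le> 2 * c" for j
      using bnd[of "[j, m]" x] that k c unfolding g_def by (auto simp del: iter_pd.simps)
    from this[of 1] this[of 2] show ?thesis using norm2_le[of "g m x"] by linarith
  qed
  let ?Z = "{x\<in>cell p. \<forall>m. ?F m x = 0}"
  let ?R = "ennreal (184320 * c\<^sup>2) * liminf (scaled_sublevel ?F ?U)"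
  \<comment> \<open>The counting bound is applied to finite subsets, so that infinitely many zeros
    force the right-hand side to be infinite.\<close>
  have fin: "ennreal ((real (card S))\<^sup>2) \<le> ?R" if S: "finite S" "S \<subseteq> ?Z" for S
  proof -
    have "ennreal ((real (card S))\<^sup>2) \<le> ennreal (11520 * (4 * c)\<^sup>2) * liminf (scaled_sublevel ?F ?U)"
      using S cell_subset[of p] c by (intro card_zeros_sq_le[where g=g and p=p] U E Tay L B) auto
    then show ?thesis by (simp add: power_mult_distrib)
  qed
  show ?thesis
  proof (cases "finite ?Z")
    case True
    then show ?thesis using fin[OF True order_refl]
      by (simp add: num_zeros_def emeasure_count_space_finite ennreal_of_nat_eq_real_of_nat ennreal_power)
  next
    case False
    have "ennreal (real n) \<le> ?R" for n
    proof -
      from infinite_arbitrarily_large[OF False, of n] obtain S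
        where S: "finite S" "S \<subseteq> ?Z" "card S = n" by (elim exE conjE)
      have "real n \<le> (real n)\<^sup>2" by (cases "n = 0") (auto simp: power2_eq_square)
      then have "ennreal (real n) \<le> ennreal ((real (card S))\<^sup>2)" using S(3) by (intro ennreal_leI) simp
      then show ?thesis using fin[OF S(1,2)] by (rule order_trans)
    qed
    then have "?R = \<top>" by (rule ennreal_top_if_ge_nat)
    then show ?thesis by (simp only: top_greatest)
  qed
qed

section \<open>Derivatives of the field\<close>

locale gaussian_surface = prob_space M for M :: "'a measure" +
  fixes W :: "'a \<Rightarrow> real^2 \<Rightarrow> real"
  assumes gaussian: "centered_gaussian_field M W"
    and stationary: "stationary_field M W"
    and smooth: "\<And>\<omega>. \<omega> \<in> space M \<Longrightarrow> Ck 3 (W \<omega>)"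
begin

definition Wspan :: "('a \<Rightarrow> real) set" where
  "Wspan = {X. \<exists>(n::nat) xs c. X = (\<lambda>\<omega>. \<Sum>i<n. c i * W \<omega> (xs i))}"

text \<open>Each differentiation costs one pointwise limit of difference quotients, so derivatives
  of order \<open>k\<close> live in the \<open>k\<close>-fold sequential closure of the
  span.\<close>

definition Wspace :: "nat \<Rightarrow> ('a \<Rightarrow> real) set" where
  "Wspace k = (lim_closure M ^^ k) Wspan"

definition dW :: "2 list \<Rightarrow> real^2 \<Rightarrow> 'a \<Rightarrow> real" where
  "dW \<alpha> x \<omega> = iter_pd \<alpha> (W \<omega>) x"

lemma sum_lessThan_add: "(\<Sum>i<n+m::nat. f i) = (\<Sum>i<n. f i) + (\<Sum>i<m. f (n + i) :: real)"
  by (induction m) (auto simp: algebra_simps)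

lemma W_measurable[measurable]: "(\<lambda>\<omega>. W \<omega> x) \<in> borel_measurable M"
  using gaussian by (simp add: centered_gaussian_field_def)

lemma distributed_normal_gauss:
  assumes D: "distributed M lborel X (normal_density 0 \<sigma>)" and \<sigma>: "\<sigma> > 0"
  shows "gauss M X"
  unfolding gauss_def gauss_var_def
proof (intro exI[of _ "\<sigma>\<^sup>2"] conjI allI)
  show X[measurable]: "X \<in> borel_measurable M" using D by (simp add: distributed_def)
  fix t
  have "distributed M lborel (\<lambda>x. (X x - 0) / \<sigma>) std_normal_density"
    using D normal_standard_normal_convert[OF \<sigma>, of X 0] by simp
  then have d: "distr M lborel (\<lambda>x. X x / \<sigma>) = std_normal_distribution"
    by (simp add: distributed_def)
  have "(CLINT \<omega>|M. iexp (t * X \<omega>)) = (CLINT \<omega>|M. iexp (t * \<sigma> * (X \<omega> / \<sigma>)))"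
    using \<sigma> by simp
  also have "\<dots> = (CLINT y|distr M lborel (\<lambda>x. X x / \<sigma>). iexp (t * \<sigma> * y))"
    by (subst integral_distr) auto
  also have "\<dots> = char std_normal_distribution (t * \<sigma>)"
    unfolding d char_def ..
  finally show "(CLINT \<omega>|M. iexp (t * X \<omega>)) = complex_of_real (exp (- (t\<^sup>2 * \<sigma>\<^sup>2) / 2))"
    by (simp add: char_std_normal_distribution power_mult_distrib)
qed simp

lemma AE_zero_gauss:
  assumes [measurable]: "X \<in> borel_measurable M" and ae: "AE \<omega> in M. X \<omega> = 0"
  shows "gauss M X"
  unfolding gauss_def gauss_var_def
proof (intro exI[of _ 0] conjI allI)
  fix t
  have "(CLINT \<omega>|M. iexp (t * X \<omega>)) = (CLINT \<omega>|M. 1)"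
    using ae by (intro integral_cong_AE) auto
  then show "(CLINT \<omega>|M. iexp (t * X \<omega>)) = complex_of_real (exp (- (t\<^sup>2 * 0) / 2))"
    by (simp add: prob_space)
qed auto

lemma gauss_space_Wspan: "gauss_space M Wspan"
  unfolding gauss_space_def
proof (intro conjI ballI allI)
  show "Wspan \<noteq> {}" by (auto simp: Wspan_def)
next
  fix X assume "X \<in> Wspan"
  then obtain n xs c where X: "X = (\<lambda>\<omega>. \<Sum>i<n::nat. c i * W \<omega> (xs i))" by (auto simp: Wspan_def)
  have [measurable]: "X \<in> borel_measurable M" unfolding X by measurable
  have "(AE \<omega> in M. X \<omega> = 0) \<or> (\<exists>\<sigma>>0. distributed M lborel X (normal_density 0 \<sigma>))"
    using gaussian unfolding X centered_gaussian_field_def by blast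
  then show "gauss M X" using AE_zero_gauss[of X] distributed_normal_gauss[of X] by auto
next
  fix X Y and a b :: real assume "X \<in> Wspan" "Y \<in> Wspan"
  then obtain n xs c m ys d where X: "X = (\<lambda>\<omega>. \<Sum>i<n::nat. c i * W \<omega> (xs i))" "Y = (\<lambda>\<omega>. \<Sum>i<m::nat. d i * W \<omega> (ys i))"
    by (auto simp: Wspan_def)
  \<comment> \<open>The two finite sums are concatenated, the second one shifted by
    \<open>n\<close>.\<close>
  have e: "(\<lambda>\<omega>. a * X \<omega> + b * Y \<omega>) = (\<lambda>\<omega>. \<Sum>i<n+m. (if i < n then a * c i else b * d (i - n)) * W \<omega> (if i < n then xs i else ys (i - n)))"
    unfolding sum_lessThan_add X by (simp add: sum_distrib_left mult.assoc)
  show "(\<lambda>\<omega>. a * X \<omega> + b * Y \<omega>) \<in> Wspan"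
    unfolding Wspan_def
    by (rule CollectI, rule exI[of _ "n + m"], rule exI[of _ "\<lambda>i. if i < n then xs i else ys (i - n)"],
        rule exI[of _ "\<lambda>i. if i < n then a * c i else b * d (i - n)"], rule e)
qed

lemma gauss_space_Wspace: "gauss_space M (Wspace k)"
  unfolding Wspace_def by (induction k) (auto intro: gauss_space_Wspan gauss_space_lim_closure)

lemma Wspace_Suc: "Wspace (Suc k) = lim_closure M (Wspace k)"
  by (simp add: Wspace_def)

lemma Wspace_mono: "k \<le> l \<Longrightarrow> Wspace k \<subseteq> Wspace l"
  by (induction l) (auto simp: le_Suc_eq Wspace_Suc intro: lim_closure_superset[THEN subsetD])

lemma dW_quotient_lim:
  assumes "length \<alpha> < 3" "\<omega> \<in> space M"
  shows "(\<lambda>n. real (Suc n) * dW \<alpha> (x + (1 / real (Suc n)) *\<^sub>R axis i 1) \<omega> + (- real (Suc n)) * dW \<alpha> x \<omega>)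
    \<longlonglongrightarrow> dW (i # \<alpha>) x \<omega>"
  unfolding dW_def by (rule iter_pd_seq[OF smooth]) (use assms in auto)

lemma dW_in_Wspace_length: "length \<alpha> \<le> 3 \<Longrightarrow> dW \<alpha> x \<in> Wspace (length \<alpha>)"
proof (induction \<alpha> arbitrary: x)
  case Nil
  have e: "dW [] x = (\<lambda>\<omega>. \<Sum>i<1::nat. 1 * W \<omega> x)" by (auto simp: dW_def)
  show ?case unfolding Wspace_def Wspan_def list.size funpow_0
    by (rule CollectI, rule exI[of _ "1::nat"], rule exI[of _ "\<lambda>_. x"], rule exI[of _ "\<lambda>_. 1"], rule e)
next
  case (Cons i \<alpha>)
  show ?case
    unfolding list.size(4) add_Suc_right add_0_right Wspace_Suc One_nat_def lim_closure_def mem_Collect_eq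
    using Cons by (intro exI[of _ "\<lambda>n \<omega>. real (Suc n) * dW \<alpha> (x + (1 / real (Suc n)) *\<^sub>R axis i 1) \<omega> + (- real (Suc n)) * dW \<alpha> x \<omega>"] conjI allI ballI
      dW_quotient_lim gauss_spaceD(2)[OF gauss_space_Wspace]) auto
qed

lemma dW_in_Wspace: "length \<alpha> \<le> 3 \<Longrightarrow> dW \<alpha> x \<in> Wspace 3"
  using dW_in_Wspace_length Wspace_mono by blast

lemmas GS = gauss_space_Wspace[of 3]

lemma dW_measurable[measurable]: "length \<alpha> \<le> 3 \<Longrightarrow> dW \<alpha> x \<in> borel_measurable M"
  using gaussD(1)[OF gauss_spaceD(1)[OF GS dW_in_Wspace]] .

lemma dW_continuous: "\<omega> \<in> space M \<Longrightarrow> length \<alpha> \<le> 3 \<Longrightarrow> continuous_on A (\<lambda>x. dW \<alpha> x \<omega>)"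
  unfolding dW_def using Ck_continuous_iter_pd[OF smooth] continuous_on_subset by blast

section \<open>Covariances of the derivatives\<close>

definition cov :: "2 list \<Rightarrow> real^2 \<Rightarrow> 2 list \<Rightarrow> real^2 \<Rightarrow> real" where
  "cov \<alpha> x \<beta> y = expectation (\<lambda>\<omega>. dW \<alpha> x \<omega> * dW \<beta> y \<omega>)"

lemma cov_sym: "cov \<alpha> x \<beta> y = cov \<beta> y \<alpha> x"
  by (simp add: cov_def mult.commute)

text \<open>Differentiation in the first argument passes through the covariance, because covariances
  are continuous under pointwise limits in a Gaussian space. It carries stationarity and finite
  range over to the derivatives.\<close>

lemma cov_lim:
  assumes "length \<alpha> < 3" "length \<beta> \<le> 3"
  shows "(\<lambda>n. real (Suc n) * cov \<alpha> (x + (1 / real (Suc n)) *\<^sub>R axis i 1) \<beta> y - real (Suc n) * cov \<alpha> x \<beta> y)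
    \<longlonglongrightarrow> cov (i # \<alpha>) x \<beta> y"
proof -
  let ?Q = "\<lambda>n \<omega>. real (Suc n) * dW \<alpha> (x + (1 / real (Suc n)) *\<^sub>R axis i 1) \<omega> + (- real (Suc n)) * dW \<alpha> x \<omega>"
  have m: "dW \<alpha> z \<in> Wspace 3" "dW \<beta> z \<in> Wspace 3" for z using assms by (auto intro: dW_in_Wspace)
  have "(\<lambda>n. expectation (\<lambda>\<omega>. ?Q n \<omega> * dW \<beta> y \<omega>)) \<longlonglongrightarrow> expectation (\<lambda>\<omega>. dW (i # \<alpha>) x \<omega> * dW \<beta> y \<omega>)"
    by (rule gauss_space_cov_lim[OF GS]) (use m assms dW_quotient_lim in \<open>auto intro!: gauss_spaceD(2)[OF GS]\<close>)
  moreover have "expectation (\<lambda>\<omega>. ?Q n \<omega> * dW \<beta> y \<omega>)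
     = real (Suc n) * cov \<alpha> (x + (1 / real (Suc n)) *\<^sub>R axis i 1) \<beta> y - real (Suc n) * cov \<alpha> x \<beta> y" for n
  proof -
    have "expectation (\<lambda>\<omega>. ?Q n \<omega> * dW \<beta> y \<omega>)
      = expectation (\<lambda>\<omega>. real (Suc n) * (dW \<alpha> (x + (1 / real (Suc n)) *\<^sub>R axis i 1) \<omega> * dW \<beta> y \<omega>) - real (Suc n) * (dW \<alpha> x \<omega> * dW \<beta> y \<omega>))"
      by (intro Bochner_Integration.integral_cong) (auto simp only: algebra_simps)
    then show ?thesis
      using gauss_space_prod_integrable[OF GS m] unfolding cov_def by (simp del: of_nat_Suc)
  qed
  ultimately show ?thesis unfolding cov_def by simp
qed

lemma cov_base_stationary: "cov [] (x + h) [] (y + h) = cov [] x [] y"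
proof -
  define xs where "xs = (\<lambda>i::nat. if i = 0 then x else y)"
  let ?P = "PiM {..<2::nat} (\<lambda>_. borel :: real measure)"
  have mf: "(\<lambda>f. f 0 * f 1) \<in> borel_measurable ?P" by measurable
  have e: "expectation (\<lambda>\<omega>. W \<omega> (xs 0 + g) * W \<omega> (xs 1 + g))
     = (LINT f|distr M ?P (\<lambda>\<omega>. \<lambda>i\<in>{..<2}. W \<omega> (xs i + g)). f 0 * f 1)" for g
    by (subst integral_distr) (use mf in auto)
  have "distr M ?P (\<lambda>\<omega>. \<lambda>i\<in>{..<2}. W \<omega> (xs i + h)) = distr M ?P (\<lambda>\<omega>. \<lambda>i\<in>{..<2}. W \<omega> (xs i))"
    using stationary unfolding stationary_field_def by blast
  then have "expectation (\<lambda>\<omega>. W \<omega> (xs 0 + h) * W \<omega> (xs 1 + h)) = expectation (\<lambda>\<omega>. W \<omega> (xs 0 + 0) * W \<omega> (xs 1 + 0))"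
    unfolding e by simp
  then show ?thesis by (simp add: cov_def dW_def xs_def)
qed

lemma cov_stationary_step:
  assumes "length \<alpha> < 3" "length \<beta> \<le> 3" "\<And>x y. cov \<alpha> (x + h) \<beta> (y + h) = cov \<alpha> x \<beta> y"
  shows "cov (i # \<alpha>) (x + h) \<beta> (y + h) = cov (i # \<alpha>) x \<beta> y"
proof -
  have e: "cov \<alpha> (x + h + d) \<beta> (y + h) = cov \<alpha> (x + d) \<beta> y" for d
    using assms(3)[of "x + d" y] by (simp add: add_ac)
  show ?thesis
    using cov_lim[OF assms(1,2), of "x + h" i "y + h"] cov_lim[OF assms(1,2), of x i y]
    unfolding e assms(3) by (rule LIMSEQ_unique)
qed

text \<open>Derivatives are added first to \<open>\<beta>\<close>, with \<open>\<alpha>\<close>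
  empty and the arguments exchanged by symmetry, and then to \<open>\<alpha>\<close>; every step is
  thus a differentiation in the first argument.\<close>

lemma cov_stationary:
  "length \<alpha> \<le> 3 \<Longrightarrow> length \<beta> \<le> 3 \<Longrightarrow> cov \<alpha> (x + h) \<beta> (y + h) = cov \<alpha> x \<beta> y"
proof (induction \<alpha> arbitrary: x y)
  case Nil
  from Nil(2) show ?case
  proof (induction \<beta> arbitrary: x y)
    case Nil
    then show ?case by (rule_tac cov_base_stationary)
  next
    case (Cons i \<beta>)
    have "cov (i # \<beta>) (y + h) [] (x + h) = cov (i # \<beta>) y [] x"
    proof (rule cov_stationary_step)
      fix x y show "cov \<beta> (x + h) [] (y + h) = cov \<beta> x [] y"
        using Cons.IH[of y x] Cons.prems by (simp add: cov_sym[of \<beta>])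
    qed (use Cons.prems in auto)
    then show ?case by (simp add: cov_sym[of "[]"])
  qed
next
  case (Cons i \<alpha>)
  then show ?case by (intro cov_stationary_step) auto
qed

text \<open>The condition \<open>norm (x - y) > \<delta>\<close> is open, so it persists for small
  displacements of \<open>x\<close> and the difference quotients are eventually 0.\<close>

lemma cov_far_step:
  assumes "length \<alpha> < 3" "length \<beta> \<le> 3" "\<And>x y. norm (x - y) > \<delta> \<Longrightarrow> cov \<alpha> x \<beta> y = 0" "norm (x - y) > \<delta>"
  shows "cov (i # \<alpha>) x \<beta> y = 0"
proof -
  have "(\<lambda>n. norm (x + inverse (real (Suc n)) *\<^sub>R axis i 1 - y)) \<longlonglongrightarrow> norm (x + 0 *\<^sub>R axis i 1 - y)"
    by (intro tendsto_intros LIMSEQ_inverse_real_of_nat)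
  then have "eventually (\<lambda>n. norm (x + inverse (real (Suc n)) *\<^sub>R axis i 1 - y) > \<delta>) sequentially"
    using assms(4) by (intro order_tendstoD(1)) auto
  then have "eventually (\<lambda>n. real (Suc n) * cov \<alpha> (x + (1 / real (Suc n)) *\<^sub>R axis i 1) \<beta> y - real (Suc n) * cov \<alpha> x \<beta> y = 0) sequentially"
    by eventually_elim (use assms(3,4) in \<open>auto simp: inverse_eq_divide\<close>)
  then have "(\<lambda>n. real (Suc n) * cov \<alpha> (x + (1 / real (Suc n)) *\<^sub>R axis i 1) \<beta> y - real (Suc n) * cov \<alpha> x \<beta> y) \<longlonglongrightarrow> 0"
    by (rule tendsto_eventually)
  then show ?thesis using cov_lim[OF assms(1,2), of x i y] LIMSEQ_unique by blast
qed

lemma cov_far: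
  assumes "delta_dependent M W \<delta>"
  shows "length \<alpha> \<le> 3 \<Longrightarrow> length \<beta> \<le> 3 \<Longrightarrow> norm (x - y) > \<delta> \<Longrightarrow> cov \<alpha> x \<beta> y = 0"
proof (induction \<alpha> arbitrary: x y)
  case Nil
  from Nil(2,3) show ?case
  proof (induction \<beta> arbitrary: x y)
    case Nil
    then show ?case using assms by (simp add: delta_dependent_def cov_def dW_def)
  next
    case (Cons i \<beta>)
    have "cov (i # \<beta>) y [] x = 0"
    proof (rule cov_far_step[of _ _ \<delta>])
      fix x y :: "real^2" assume "norm (x - y) > \<delta>"
      then show "cov \<beta> x [] y = 0"
        using Cons.IH[of y x] Cons.prems by (simp add: cov_sym[of \<beta>] norm_minus_commute)
    qed (use Cons.prems in \<open>auto simp: norm_minus_commute\<close>)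
    then show ?case by (simp add: cov_sym[of "[]"])
  qed
next
  case (Cons i \<alpha>)
  show ?case by (rule cov_far_step[of _ _ \<delta>]) (use Cons in auto)
qed

lemma cov_at: "length \<alpha> \<le> 3 \<Longrightarrow> length \<beta> \<le> 3 \<Longrightarrow> cov \<alpha> x \<beta> x = cov \<alpha> 0 \<beta> 0"
  using cov_stationary[of \<alpha> \<beta> 0 x 0] by simp

end

section \<open>Regression on the gradient\<close>

text \<open>The image under \<open>S\<close> of \<open>M\<close> restricted to \<open>E\<close>, and
  the law of \<open>S\<close> scaled by \<open>prob E\<close>, are finite measures on the line with
  the same distribution function. The hypothesis is phrased with half-lines because bounds on a
  supremum are the events for which independence is obtained.\<close>

lemma (in prob_space) indep_nn_integral:
  assumes S[measurable]: "S \<in> borel_measurable M" and E[measurable]: "E \<in> sets M" and f[measurable]: "f \<in> borel_measurable borel"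
    and ind: "\<And>s::real. prob ({\<omega>\<in>space M. S \<omega> \<le> s} \<inter> E) = prob {\<omega>\<in>space M. S \<omega> \<le> s} * prob E"
  shows "(\<integral>\<^sup>+\<omega>. f (S \<omega>) * indicator E \<omega> \<partial>M) = ennreal (prob E) * (\<integral>\<^sup>+\<omega>. f (S \<omega>) \<partial>M)"
proof -
  let ?D = "distr (density M (indicator E)) borel S" and ?D' = "density (distr M borel S) (\<lambda>_. ennreal (prob E))"
  have e1: "emeasure ?D B = emeasure M (S -` B \<inter> space M \<inter> E)" if [measurable]: "B \<in> sets borel" for B
  proof -
    have "emeasure ?D B = (\<integral>\<^sup>+\<omega>. indicator E \<omega> * indicator (S -` B \<inter> space M) \<omega> \<partial>M)"
      by (subst emeasure_distr) (auto simp: emeasure_density)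
    also have "\<dots> = (\<integral>\<^sup>+\<omega>. indicator (S -` B \<inter> space M \<inter> E) \<omega> \<partial>M)"
      by (intro nn_integral_cong) (auto simp: indicator_def)
    finally show ?thesis by simp
  qed
  have e2: "emeasure ?D' B = ennreal (prob E) * emeasure M (S -` B \<inter> space M)" if [measurable]: "B \<in> sets borel" for B
    by (subst emeasure_density) (auto simp: nn_integral_cmult emeasure_distr)
  have "finite_borel_measure ?D" using e1[of UNIV]
    by (intro finite_borel_measure.intro finite_measureI finite_borel_measure_axioms.intro) (auto simp: emeasure_eq_measure)
  moreover have "finite_borel_measure ?D'" using e2[of UNIV]
    by (intro finite_borel_measure.intro finite_measureI finite_borel_measure_axioms.intro) (auto simp: emeasure_eq_measure ennreal_mult[symmetric])
  moreover have "cdf ?D = cdf ?D'"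
  proof
    fix s
    have s: "S -` {..s} \<inter> space M = {\<omega>\<in>space M. S \<omega> \<le> s}" by auto
    have "emeasure ?D {..s} = ennreal (prob ({\<omega>\<in>space M. S \<omega> \<le> s} \<inter> E))"
      by (subst e1) (auto simp: s emeasure_eq_measure)
    also have "\<dots> = emeasure ?D' {..s}"
      by (subst e2) (auto simp: s emeasure_eq_measure ind ennreal_mult mult.commute)
    finally show "cdf ?D s = cdf ?D' s" by (simp add: cdf_def measure_def)
  qed
  ultimately have eq: "?D = ?D'" by (rule cdf_unique')
  have "(\<integral>\<^sup>+\<omega>. f (S \<omega>) * indicator E \<omega> \<partial>M) = (\<integral>\<^sup>+x. f x \<partial>?D)"
    by (subst nn_integral_distr, (auto)[2]) (subst nn_integral_density, auto simp: mult.commute)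
  also have "\<dots> = (\<integral>\<^sup>+x. f x \<partial>?D')" by (simp only: eq)
  also have "\<dots> = ennreal (prob E) * (\<integral>\<^sup>+\<omega>. f (S \<omega>) \<partial>M)"
    by (subst nn_integral_density) (auto simp: nn_integral_cmult nn_integral_distr)
  finally show ?thesis .
qed

text \<open>The second moments of \<open>X + Y\<close> and \<open>X - Y\<close> are
  nonnegative.\<close>

lemma (in prob_space) gauss_space_cov_bound:
  assumes G: "gauss_space M V" "X \<in> V" "Y \<in> V"
  shows "\<bar>expectation (\<lambda>\<omega>. X \<omega> * Y \<omega>)\<bar> \<le> (expectation (\<lambda>\<omega>. X \<omega> * X \<omega>) + expectation (\<lambda>\<omega>. Y \<omega> * Y \<omega>)) / 2"
proof -
  note i = gauss_space_prod_integrable[OF G(1)]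
  have "0 \<le> expectation (\<lambda>\<omega>. (X \<omega> + Y \<omega>)\<^sup>2)" "0 \<le> expectation (\<lambda>\<omega>. (X \<omega> - Y \<omega>)\<^sup>2)"
    by (auto intro!: Bochner_Integration.integral_nonneg)
  moreover have "expectation (\<lambda>\<omega>. (X \<omega> + Y \<omega>)\<^sup>2) = expectation (\<lambda>\<omega>. X \<omega> * X \<omega> + (X \<omega> * Y \<omega> + X \<omega> * Y \<omega>) + Y \<omega> * Y \<omega>)"
    by (simp add: power2_eq_square algebra_simps)
  moreover have "expectation (\<lambda>\<omega>. (X \<omega> - Y \<omega>)\<^sup>2) = expectation (\<lambda>\<omega>. X \<omega> * X \<omega> - (X \<omega> * Y \<omega> + X \<omega> * Y \<omega>) + Y \<omega> * Y \<omega>)"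
    by (simp add: power2_eq_square algebra_simps)
  ultimately show ?thesis using i[OF G(2,2)] i[OF G(2,3)] i[OF G(3,3)] by (simp add: abs_le_iff)
qed

section \<open>A countable family of higher derivatives over one cell\<close>

definition dense_pts :: "(real^2) set" where
  "dense_pts = (SOME B. countable B \<and> (\<forall>X. open X \<longrightarrow> X \<noteq> {} \<longrightarrow> (\<exists>d\<in>B. d \<in> X)))"

lemma dense_pts: "countable dense_pts" "open X \<Longrightarrow> X \<noteq> {} \<Longrightarrow> \<exists>d\<in>dense_pts. d \<in> X"
proof -
  have "\<exists>B::(real^2) set. countable B \<and> (\<forall>X. open X \<longrightarrow> X \<noteq> {} \<longrightarrow> (\<exists>d\<in>B. d \<in> X))"
    using countable_dense_exists by blast
  from someI_ex[OF this] show "countable dense_pts" "open X \<Longrightarrow> X \<noteq> {} \<Longrightarrow> \<exists>d\<in>dense_pts. d \<in> X"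
    unfolding dense_pts_def by auto
qed

lemma finite_multi_indices: "finite {\<alpha> :: 2 list. length \<alpha> \<le> n}"
  using finite_lists_length_le[of "UNIV :: 2 set" n] by simp

text \<open>Indices are pairs of a derivative of order 2 or 3 and a dense point of the box around 0.
  The same enumeration, translated by \<open>p\<close>, serves every cell, so that stationarity
  compares the families term by term.\<close>

definition idx :: "nat \<Rightarrow> 2 list \<times> (real^2)" where
  "idx = from_nat_into ({\<alpha>. length \<alpha> \<in> {2,3}} \<times> (dense_pts \<inter> nbhd 0))"

lemma nbhd_nonempty: "0 \<in> nbhd 0" by (simp add: nbhd_def mem_box_cart)

lemma range_idx: "range idx = {\<alpha>. length \<alpha> \<in> {2,3}} \<times> (dense_pts \<inter> nbhd 0)"
  unfolding idx_def
proof (rule range_from_nat_into)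
  have "\<exists>d\<in>dense_pts. d \<in> nbhd 0" using nbhd_nonempty by (intro dense_pts) (auto simp: nbhd_def open_box)
  moreover have "length [1,1::2] \<in> {2,3}" by simp
  ultimately show "{\<alpha>::2 list. length \<alpha> \<in> {2, 3}} \<times> (dense_pts \<inter> nbhd 0) \<noteq> {}" by blast
  have "finite {\<alpha> :: 2 list. length \<alpha> \<in> {2,3}}"
    by (rule finite_subset[OF _ finite_multi_indices[of 3]]) auto
  then show "countable ({\<alpha>::2 list. length \<alpha> \<in> {2, 3}} \<times> (dense_pts \<inter> nbhd 0))"
    by (intro countable_SIGMA countable_finite countable_Int1 dense_pts)
qed

lemma idx_length: "length (fst (idx n)) \<in> {2,3}" "length (fst (idx n)) \<le> 3"
proof -
  have "idx n \<in> range idx" by simp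
  then show "length (fst (idx n)) \<in> {2,3}" "length (fst (idx n)) \<le> 3" unfolding range_idx by auto
qed

lemma idx_nbhd: "snd (idx n) \<in> nbhd 0"
proof -
  have "idx n \<in> range idx" by simp
  then show ?thesis unfolding range_idx by auto
qed

lemma idx_dense:
  assumes "length \<alpha> \<in> {2,3}" "open X" "X \<noteq> {}" "X \<subseteq> nbhd 0"
  shows "\<exists>n. fst (idx n) = \<alpha> \<and> snd (idx n) \<in> X"
proof -
  obtain d where d: "d \<in> dense_pts" "d \<in> X" using dense_pts(2)[OF assms(2,3)] by auto
  then have "(\<alpha>, d) \<in> range idx" unfolding range_idx using assms by auto
  then obtain n where "(\<alpha>, d) = idx n" by auto
  then show ?thesis using d by (intro exI[of _ n]) (auto simp flip: \<open>(\<alpha>, d) = idx n\<close>)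
qed

lemma nbhd_translate: "p + y \<in> nbhd p \<longleftrightarrow> y \<in> nbhd 0"
  by (auto simp: nbhd_def mem_box_cart)

context gaussian_surface
begin

definition hi :: "real^2 \<Rightarrow> nat \<Rightarrow> 'a \<Rightarrow> real" where
  "hi p n = dW (fst (idx n)) (p + snd (idx n))"

lemma hi_in_Wspace: "hi p n \<in> Wspace 3"
  unfolding hi_def by (intro dW_in_Wspace idx_length)

text \<open>There are finitely many derivatives, each continuous on the compact closure of the
  box.\<close>

lemma hi_bdd:
  assumes \<omega>: "\<omega> \<in> space M"
  shows "bdd_above (range (\<lambda>n. \<bar>hi p n \<omega>\<bar>))"
proof -
  let ?C = "cbox (\<chi> i. p$i - 1) (\<chi> i. p$i + 2)"
  have "\<exists>b. \<forall>z\<in>?C. \<bar>dW \<alpha> z \<omega>\<bar> \<le> b" if "length \<alpha> \<le> 3" for \<alpha>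
  proof -
    have "compact ((\<lambda>z. dW \<alpha> z \<omega>) ` ?C)"
      by (intro compact_continuous_image dW_continuous \<omega> that compact_cbox)
    then have "bounded ((\<lambda>z. dW \<alpha> z \<omega>) ` ?C)" by (rule compact_imp_bounded)
    then show ?thesis by (auto simp: bounded_iff)
  qed
  then obtain b where b: "\<And>\<alpha> z. length \<alpha> \<le> 3 \<Longrightarrow> z \<in> ?C \<Longrightarrow> \<bar>dW \<alpha> z \<omega>\<bar> \<le> b \<alpha>" by metis
  define c where "c = (\<Sum>\<alpha>\<in>{\<alpha>. length \<alpha> \<le> 3}. \<bar>b \<alpha>\<bar>)"
  show ?thesis
  proof (rule bdd_aboveI2)
    fix n
    have "p + snd (idx n) \<in> nbhd p" using idx_nbhd by (simp add: nbhd_translate)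
    then have "p + snd (idx n) \<in> ?C" unfolding nbhd_def using box_subset_cbox by blast
    then have "\<bar>hi p n \<omega>\<bar> \<le> b (fst (idx n))" unfolding hi_def by (intro b idx_length)
    also have "\<dots> \<le> \<bar>b (fst (idx n))\<bar>" by simp
    also have "\<dots> \<le> c" unfolding c_def using idx_length(2)[of n] finite_multi_indices
      by (intro member_le_sum[where f="\<lambda>\<alpha>. \<bar>b \<alpha>\<bar>"]) auto
    finally show "\<bar>hi p n \<omega>\<bar> \<le> c" .
  qed
qed

text \<open>If the bound failed at \<open>z\<close>, continuity would make it fail on an open set,
  which contains a dense point.\<close>

lemma dW_le_sup:
  assumes \<omega>: "\<omega> \<in> space M" and z: "z \<in> nbhd p" and \<alpha>: "length \<alpha> \<in> {2,3}"
  shows "\<bar>dW \<alpha> z \<omega>\<bar> \<le> sup_abs (hi p) \<omega>"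
proof (rule ccontr)
  let ?s = "sup_abs (hi p) \<omega>"
  assume n: "\<not> \<bar>dW \<alpha> z \<omega>\<bar> \<le> ?s"
  define X where "X = nbhd 0 \<inter> {y. ?s < \<bar>dW \<alpha> (p + y) \<omega>\<bar>}"
  have l3: "length \<alpha> \<le> 3" using \<alpha> by auto
  have "continuous_on UNIV (\<lambda>y. dW \<alpha> (p + y) \<omega>)"
    by (rule continuous_on_compose2[OF dW_continuous[OF \<omega> l3, of UNIV]]) (auto intro!: continuous_intros)
  then have "open {y. ?s < \<bar>dW \<alpha> (p + y) \<omega>\<bar>}"
    by (intro open_Collect_less continuous_intros)
  then have "open X" unfolding X_def by (intro open_Int) (auto simp: nbhd_def open_box)
  moreover have "z - p \<in> X" unfolding X_def using n z nbhd_translate[of p "z - p"] by simp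
  ultimately obtain m where "fst (idx m) = \<alpha>" "snd (idx m) \<in> X"
    using idx_dense[OF \<alpha>, of X] X_def by blast
  then have "?s < \<bar>hi p m \<omega>\<bar>" unfolding hi_def X_def by auto
  moreover have "\<bar>hi p m \<omega>\<bar> \<le> ?s" using sup_abs_le_iff[where X="hi p" and s="?s", OF hi_bdd[OF \<omega>]] by auto
  ultimately show False by simp
qed

lemma hi_measurable[measurable]: "hi p n \<in> borel_measurable M"
  unfolding hi_def by (intro dW_measurable idx_length)

definition hi_moment :: real where
  "hi_moment = enn2real (\<integral>\<^sup>+\<omega>. ennreal ((sup_abs (hi 0) \<omega>)\<^sup>2) \<partial>M)"

text \<open>The families for \<open>p\<close> and for 0 have equal covariances, so their suprema
  share one law; its second moment is finite by Fernique's argument.\<close>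

lemma hi_moment: "(\<integral>\<^sup>+\<omega>. ennreal ((sup_abs (hi p) \<omega>)\<^sup>2) \<partial>M) = ennreal hi_moment" "hi_moment \<ge> 0"
proof -
  have "(\<integral>\<^sup>+\<omega>. ennreal ((sup_abs (hi p) \<omega>)\<^sup>2) \<partial>M) = (\<integral>\<^sup>+\<omega>. ennreal ((sup_abs (hi 0) \<omega>)\<^sup>2) \<partial>M)"
  proof (rule sup_abs_law_eq[OF GS hi_in_Wspace hi_in_Wspace hi_bdd hi_bdd])
    fix i j
    show "expectation (\<lambda>\<omega>. hi p i \<omega> * hi p j \<omega>) = expectation (\<lambda>\<omega>. hi 0 i \<omega> * hi 0 j \<omega>)"
      using cov_stationary[OF idx_length(2) idx_length(2), of i "snd (idx i)" p j "snd (idx j)"]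
      by (simp add: hi_def cov_def add.commute)
  qed auto
  also have "\<dots> < \<top>" by (rule fernique[OF GS hi_in_Wspace hi_bdd])
  finally show "(\<integral>\<^sup>+\<omega>. ennreal ((sup_abs (hi p) \<omega>)\<^sup>2) \<partial>M) = ennreal hi_moment"
    using \<open>(\<integral>\<^sup>+\<omega>. ennreal ((sup_abs (hi p) \<omega>)\<^sup>2) \<partial>M) = (\<integral>\<^sup>+\<omega>. ennreal ((sup_abs (hi 0) \<omega>)\<^sup>2) \<partial>M)\<close>
    unfolding hi_moment_def by (simp add: less_top)
qed (simp add: hi_moment_def)

definition hi_var :: real where
  "hi_var = (\<Sum>\<alpha>\<in>{\<alpha>. length \<alpha> \<le> 3}. cov \<alpha> 0 \<alpha> 0)"

lemma cov_self_nonneg: "cov \<alpha> x \<alpha> x \<ge> 0"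
  unfolding cov_def by (intro Bochner_Integration.integral_nonneg) simp

lemma hi_var: "expectation (\<lambda>\<omega>. hi p n \<omega> * hi p n \<omega>) \<le> hi_var"
proof -
  have "expectation (\<lambda>\<omega>. hi p n \<omega> * hi p n \<omega>) = cov (fst (idx n)) 0 (fst (idx n)) 0"
    unfolding hi_def using cov_at[OF idx_length(2) idx_length(2), of n "p + snd (idx n)" n] by (simp add: cov_def)
  also have "\<dots> \<le> hi_var" unfolding hi_var_def using idx_length(2)[of n] finite_multi_indices cov_self_nonneg
    by (intro member_le_sum[where f="\<lambda>\<alpha>. cov \<alpha> 0 \<alpha> 0"]) auto
  finally show ?thesis .
qed

end

locale nondegenerate_surface = gaussian_surface +
  assumes nondegenerate: "invertible (covmat M (\<lambda>\<omega>. grad (W \<omega>) 0))"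
begin

text \<open>Gram--Schmidt for the two components of the gradient: \<open>gv\<close> and \<open>gw\<close> are the variances of the
  first component and of the residual \<open>res\<close> of the second one.\<close>

definition gv :: real where "gv = cov [1] 0 [1] 0"
definition gb :: real where "gb = cov [1] 0 [2] 0 / gv"
definition gw :: real where "gw = cov [2] 0 [2] 0 - gb * cov [1] 0 [2] 0"
definition res :: "real^2 \<Rightarrow> 'a \<Rightarrow> real" where "res x \<omega> = dW [2] x \<omega> - gb * dW [1] x \<omega>"

lemma grad_in_Wspace: "dW [m] x \<in> Wspace 3"
  by (rule dW_in_Wspace) simp

lemma covmat_grad: "covmat M (\<lambda>\<omega>. grad (W \<omega>) 0) $ i $ j = cov [i] 0 [j] 0"
proof -
  have "grad (W \<omega>) 0 $ m = dW [m] 0 \<omega>" for m \<omega> by (simp add: grad_def dW_def)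
  then show ?thesis using gaussD(4)[OF gauss_spaceD(1)[OF GS grad_in_Wspace]] by (simp add: covmat_def cov_def)
qed

lemma grad_det: "gv * cov [2] 0 [2] 0 \<noteq> cov [1] 0 [2] 0 * cov [1] 0 [2] 0"
  using nondegenerate unfolding invertible_det_nz det_2 covmat_grad gv_def by (simp add: cov_sym[of "[2]" 0 "[1]" 0])

text \<open>If the variance vanished, the first component of the gradient would be 0 almost surely
  and the covariance matrix singular.\<close>

lemma gv_pos: "gv > 0"
proof -
  have "gv \<noteq> 0"
  proof
    assume "gv = 0"
    then have "gauss_var M (dW [1] 0) 0"
      using gaussD(5)[OF gauss_spaceD(1)[OF GS grad_in_Wspace, of 1 0]] by (simp add: gv_def cov_def power2_eq_square)
    then have "AE \<omega> in M. dW [1] 0 \<omega> = 0" by (rule gauss_var_0)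
    then have "cov [1] 0 [2] 0 = expectation (\<lambda>\<omega>. 0)"
      unfolding cov_def by (intro integral_cong_AE) auto
    then show False using grad_det \<open>gv = 0\<close> by simp
  qed
  then show ?thesis using cov_self_nonneg[of "[1]" 0] by (simp add: gv_def)
qed

lemma cov_grad_at: "expectation (\<lambda>\<omega>. dW [m] x \<omega> * dW [l] x \<omega>) = cov [m] 0 [l] 0"
  using cov_at[of "[m]" "[l]" x] by (simp add: cov_def)

lemma res_in_Wspace: "res x \<in> Wspace 3"
proof -
  have "(\<lambda>\<omega>. 1 * dW [2] x \<omega> + (- gb) * dW [1] x \<omega>) \<in> Wspace 3"
    by (intro gauss_spaceD(2)[OF GS] grad_in_Wspace)
  then show ?thesis by (simp add: res_def[abs_def])
qed

lemma res_cov: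
  "expectation (\<lambda>\<omega>. dW [1] x \<omega> * res x \<omega>) = 0"
  "expectation (\<lambda>\<omega>. res x \<omega> * dW [1] x \<omega>) = 0"
  "expectation (\<lambda>\<omega>. res x \<omega> * res x \<omega>) = gw"
proof -
  note i = gauss_space_prod_integrable[OF GS grad_in_Wspace grad_in_Wspace]
  have "expectation (\<lambda>\<omega>. dW [1] x \<omega> * res x \<omega>) = expectation (\<lambda>\<omega>. dW [1] x \<omega> * dW [2] x \<omega> - gb * (dW [1] x \<omega> * dW [1] x \<omega>))"
    by (simp add: res_def algebra_simps)
  also have "\<dots> = cov [1] 0 [2] 0 - gb * gv" using i by (simp add: cov_grad_at gv_def)
  also have "\<dots> = 0" using gv_pos by (simp add: gb_def)
  finally show 1: "expectation (\<lambda>\<omega>. dW [1] x \<omega> * res x \<omega>) = 0" .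
  then show "expectation (\<lambda>\<omega>. res x \<omega> * dW [1] x \<omega>) = 0" by (simp add: mult.commute)
  have "expectation (\<lambda>\<omega>. res x \<omega> * res x \<omega>) = expectation (\<lambda>\<omega>. (dW [2] x \<omega> * dW [2] x \<omega> - gb * (dW [1] x \<omega> * dW [2] x \<omega>)) - gb * (dW [1] x \<omega> * res x \<omega>))"
    by (simp add: res_def algebra_simps)
  also have "\<dots> = gw" using i 1 gauss_space_prod_integrable[OF GS grad_in_Wspace res_in_Wspace, of 1 x x] by (simp add: cov_grad_at gw_def)
  finally show "expectation (\<lambda>\<omega>. res x \<omega> * res x \<omega>) = gw" .
qed

text \<open>\<open>gv * gw\<close> is the determinant of the covariance matrix of the
  gradient.\<close>

lemma gw_pos: "gw > 0"
proof -
  have "gw \<ge> 0" unfolding res_cov(3)[of 0, symmetric] by (intro Bochner_Integration.integral_nonneg) simp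
  moreover have "gw \<noteq> 0" using grad_det gv_pos by (auto simp: gw_def gb_def field_simps)
  ultimately show ?thesis by simp
qed

lemma res_measurable[measurable]: "res x \<in> borel_measurable M"
  using gaussD(1)[OF gauss_spaceD(1)[OF GS res_in_Wspace]] .

section \<open>Probability that the gradient is near a given value\<close>

definition grad_near :: "real^2 \<Rightarrow> real \<Rightarrow> real \<Rightarrow> real \<Rightarrow> 'a set" where
  "grad_near x u v r = {\<omega>\<in>space M. \<bar>dW [1] x \<omega> - u\<bar> \<le> r \<and> \<bar>dW [2] x \<omega> - v\<bar> \<le> r}"

lemma grad_near_sets[measurable]: "grad_near x u v r \<in> sets M"
  unfolding grad_near_def by measurable

text \<open>The event is enlarged to a rectangle in the independent variables
  \<open>dW [1] x\<close> and \<open>res x\<close>; the interval for the latter has half-width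
  \<open>(1 + \<bar>gb\<bar>) * r\<close>. Each factor contributes one power of
  \<open>r\<close>.\<close>

lemma grad_near_prob:
  "\<exists>C>0. \<forall>x u v r. 0 < r \<longrightarrow> r \<le> 1 \<longrightarrow> prob (grad_near x u v r) \<le> C * r\<^sup>2 * exp (- 2 * (\<bar>u\<bar> + \<bar>v\<bar>))"
proof -
  \<comment> \<open>Rate \<open>2 * (1 + \<bar>gb\<bar>)\<close> for the first component: the
    surplus over 2 compensates the loss in passing from \<open>v - gb * u\<close> back to
    \<open>v\<close>.\<close>
  define c1 where "c1 = 2 * (1 / sqrt (2 * pi * gv)) * exp ((2 * (1 + \<bar>gb\<bar>))\<^sup>2 * gv / 2 + (2 * (1 + \<bar>gb\<bar>)) * 1)"
  define c2 where "c2 = 2 * (1 / sqrt (2 * pi * gw)) * exp (2\<^sup>2 * gw / 2 + 2 * (1 + \<bar>gb\<bar>))"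
  have c: "c1 > 0" "c2 > 0" unfolding c1_def c2_def using gv_pos gw_pos by auto
  show ?thesis
  proof (intro exI[of _ "c1 * (c2 * (1 + \<bar>gb\<bar>))"] conjI allI impI)
    show "0 < c1 * (c2 * (1 + \<bar>gb\<bar>))" using c by (simp add: add_pos_nonneg)
    fix x u v r :: real and y :: "real^2" assume r: "0 < r" "r \<le> 1"
    let ?r = "(1 + \<bar>gb\<bar>) * r" and ?w = "v - gb * u"
    have r': "0 < ?r" "?r \<le> 1 + \<bar>gb\<bar>" using r by (auto simp: add_pos_nonneg mult_left_le)
    \<comment> \<open>The dummy index \<open>i\<close> casts two single variables as constant
      families.\<close>
    have "grad_near y u v r \<subseteq> {\<omega>\<in>space M. \<forall>i::nat. dW [1] y \<omega> \<in> {u-r..u+r} \<and> res y \<omega> \<in> {?w-?r..?w+?r}}"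
    proof
      fix \<omega> assume w: "\<omega> \<in> grad_near y u v r"
      have "\<bar>gb * (dW [1] y \<omega> - u)\<bar> \<le> \<bar>gb\<bar> * r" unfolding abs_mult using w by (intro mult_left_mono) (auto simp: grad_near_def)
      then have "\<bar>res y \<omega> - ?w\<bar> \<le> ?r" using w by (auto simp: grad_near_def res_def algebra_simps)
      moreover have "\<bar>dW [1] y \<omega> - u\<bar> \<le> r" "\<omega> \<in> space M" using w by (auto simp: grad_near_def)
      ultimately show "\<omega> \<in> {\<omega>\<in>space M. \<forall>i::nat. dW [1] y \<omega> \<in> {u-r..u+r} \<and> res y \<omega> \<in> {?w-?r..?w+?r}}"
        by (auto simp: abs_le_iff)
    qed
    then have "prob (grad_near y u v r) \<le> prob {\<omega>\<in>space M. \<forall>i::nat. dW [1] y \<omega> \<in> {u-r..u+r} \<and> res y \<omega> \<in> {?w-?r..?w+?r}}"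
      by (rule finite_measure_mono) measurable
    also have "\<dots> = prob {\<omega>\<in>space M. \<forall>i::nat. dW [1] y \<omega> \<in> {u-r..u+r}} * prob {\<omega>\<in>space M. \<forall>i::nat. res y \<omega> \<in> {?w-?r..?w+?r}}"
      by (rule gauss_space_indep[OF GS]) (auto intro: grad_in_Wspace res_in_Wspace simp: res_cov)
    also have "\<dots> \<le> (c1 * r * exp (- (2 * (1 + \<bar>gb\<bar>)) * \<bar>u\<bar>)) * (c2 * ?r * exp (- 2 * \<bar>?w\<bar>))"
    proof (rule mult_mono)
      show "prob {\<omega>\<in>space M. \<forall>i::nat. dW [1] y \<omega> \<in> {u-r..u+r}} \<le> c1 * r * exp (- (2 * (1 + \<bar>gb\<bar>)) * \<bar>u\<bar>)"
        unfolding c1_def simp_thms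
        by (rule gauss_interval_bound[OF gauss_spaceD(1)[OF GS grad_in_Wspace]])
          (use r gv_pos in \<open>auto simp: power2_eq_square cov_grad_at gv_def\<close>)
      show "prob {\<omega>\<in>space M. \<forall>i::nat. res y \<omega> \<in> {?w-?r..?w+?r}} \<le> c2 * ?r * exp (- 2 * \<bar>?w\<bar>)"
        unfolding c2_def simp_thms
        by (rule gauss_interval_bound[OF gauss_spaceD(1)[OF GS res_in_Wspace]])
          (use r' gw_pos in \<open>auto simp: power2_eq_square res_cov\<close>)
    qed (use c r in auto)
    also have "\<dots> = c1 * (c2 * (1 + \<bar>gb\<bar>)) * r\<^sup>2 * exp (- (2 * (1 + \<bar>gb\<bar>)) * \<bar>u\<bar> + - 2 * \<bar>?w\<bar>)"
      by (simp only: exp_add power2_eq_square mult_ac)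
    also have "\<dots> \<le> c1 * (c2 * (1 + \<bar>gb\<bar>)) * r\<^sup>2 * exp (- 2 * (\<bar>u\<bar> + \<bar>v\<bar>))"
    proof (intro mult_left_mono exp_le_cancel_iff[THEN iffD2])
      have "\<bar>v\<bar> \<le> \<bar>?w\<bar> + \<bar>gb\<bar> * \<bar>u\<bar>" using abs_triangle_ineq[of ?w "gb * u"] by (simp add: abs_mult)
      then show "- (2 * (1 + \<bar>gb\<bar>)) * \<bar>u\<bar> + - 2 * \<bar>?w\<bar> \<le> - 2 * (\<bar>u\<bar> + \<bar>v\<bar>)" by (simp add: algebra_simps)
    qed (use c in auto)
    finally show "prob (grad_near y u v r) \<le> c1 * (c2 * (1 + \<bar>gb\<bar>)) * r\<^sup>2 * exp (- 2 * (\<bar>u\<bar> + \<bar>v\<bar>))" .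
  qed
qed

text \<open>\<open>reg\<close> is the residual of the regression of a higher derivative near \<open>p\<close> on the gradient at \<open>x\<close>,
  hence independent of this gradient.\<close>

definition ca :: "real^2 \<Rightarrow> real^2 \<Rightarrow> nat \<Rightarrow> real" where
  "ca p x n = expectation (\<lambda>\<omega>. hi p n \<omega> * dW [1] x \<omega>) / gv"
definition cb :: "real^2 \<Rightarrow> real^2 \<Rightarrow> nat \<Rightarrow> real" where
  "cb p x n = expectation (\<lambda>\<omega>. hi p n \<omega> * res x \<omega>) / gw"

definition reg :: "real^2 \<Rightarrow> real^2 \<Rightarrow> nat \<Rightarrow> 'a \<Rightarrow> real" where
  "reg p x n \<omega> = hi p n \<omega> - (ca p x n * dW [1] x \<omega> + cb p x n * res x \<omega>)"

text \<open>Bounds for the regression coefficients that are uniform in \<open>p\<close>,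
  \<open>x\<close> and \<open>n\<close>, because by stationarity the variances do not depend on the
  position.\<close>

definition ma :: real where "ma = (hi_var + gv) / 2 / gv"
definition mb :: real where "mb = (hi_var + gw) / 2 / gw"

lemma ca_bound: "\<bar>ca p x n\<bar> \<le> ma"
proof -
  have "\<bar>expectation (\<lambda>\<omega>. hi p n \<omega> * dW [1] x \<omega>)\<bar> \<le> (hi_var + gv) / 2"
    using gauss_space_cov_bound[OF GS hi_in_Wspace grad_in_Wspace, of p n 1 x] hi_var[of p n]
    by (simp add: cov_grad_at gv_def)
  then show ?thesis unfolding ca_def ma_def abs_divide abs_of_pos[OF gv_pos]
    by (rule divide_right_mono[OF _ less_imp_le[OF gv_pos]])
qed

lemma cb_bound: "\<bar>cb p x n\<bar> \<le> mb"
proof -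
  have "\<bar>expectation (\<lambda>\<omega>. hi p n \<omega> * res x \<omega>)\<bar> \<le> (hi_var + gw) / 2"
    using gauss_space_cov_bound[OF GS hi_in_Wspace res_in_Wspace, of p n x] hi_var[of p n]
    by (simp add: res_cov)
  then show ?thesis unfolding cb_def mb_def abs_divide abs_of_pos[OF gw_pos]
    by (rule divide_right_mono[OF _ less_imp_le[OF gw_pos]])
qed

lemma ma_mb_nonneg: "ma \<ge> 0" "mb \<ge> 0"
  using ca_bound[of 0 0 0] cb_bound[of 0 0 0] by linarith+

lemma reg_in_Wspace: "reg p x n \<in> Wspace 3"
  unfolding reg_def
  by (intro gauss_spaceD(6)[OF GS] gauss_spaceD(2)[OF GS] hi_in_Wspace grad_in_Wspace res_in_Wspace)

lemma reg_measurable[measurable]: "reg p x n \<in> borel_measurable M"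
  using gaussD(1)[OF gauss_spaceD(1)[OF GS reg_in_Wspace]] .

text \<open>\<open>dW [1] x\<close> and \<open>res x\<close> are orthogonal, so the two coefficients
  of the projection are found separately; \<open>dW [2] x\<close> is a combination of these two
  variables.\<close>

lemma reg_cov:
  "expectation (\<lambda>\<omega>. dW [1] x \<omega> * reg p x n \<omega>) = 0"
  "expectation (\<lambda>\<omega>. dW [2] x \<omega> * reg p x n \<omega>) = 0"
proof -
  note i = gauss_space_prod_integrable[OF GS]
  have "expectation (\<lambda>\<omega>. dW [1] x \<omega> * reg p x n \<omega>)
     = expectation (\<lambda>\<omega>. hi p n \<omega> * dW [1] x \<omega> - (ca p x n * (dW [1] x \<omega> * dW [1] x \<omega>) + cb p x n * (dW [1] x \<omega> * res x \<omega>)))"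
    by (simp add: reg_def algebra_simps)
  also have "\<dots> = expectation (\<lambda>\<omega>. hi p n \<omega> * dW [1] x \<omega>) - ca p x n * gv"
    using i[OF hi_in_Wspace grad_in_Wspace] i[OF grad_in_Wspace grad_in_Wspace] i[OF grad_in_Wspace res_in_Wspace]
    by (simp add: res_cov cov_grad_at gv_def)
  also have "\<dots> = 0" using gv_pos by (simp add: ca_def)
  finally show 1: "expectation (\<lambda>\<omega>. dW [1] x \<omega> * reg p x n \<omega>) = 0" .
  have "expectation (\<lambda>\<omega>. res x \<omega> * reg p x n \<omega>)
     = expectation (\<lambda>\<omega>. hi p n \<omega> * res x \<omega> - (ca p x n * (dW [1] x \<omega> * res x \<omega>) + cb p x n * (res x \<omega> * res x \<omega>)))"
    by (simp add: reg_def algebra_simps)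
  also have "\<dots> = expectation (\<lambda>\<omega>. hi p n \<omega> * res x \<omega>) - cb p x n * gw"
    using i[OF hi_in_Wspace res_in_Wspace] i[OF res_in_Wspace res_in_Wspace] i[OF grad_in_Wspace res_in_Wspace]
    by (simp add: res_cov)
  also have "\<dots> = 0" using gw_pos by (simp add: cb_def)
  finally have 2: "expectation (\<lambda>\<omega>. res x \<omega> * reg p x n \<omega>) = 0" .
  have "expectation (\<lambda>\<omega>. dW [2] x \<omega> * reg p x n \<omega>) = expectation (\<lambda>\<omega>. res x \<omega> * reg p x n \<omega> + gb * (dW [1] x \<omega> * reg p x n \<omega>))"
    by (simp add: res_def algebra_simps)
  also have "\<dots> = 0" using i[OF res_in_Wspace reg_in_Wspace] i[OF grad_in_Wspace reg_in_Wspace] by (simp add: 1 2)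
  finally show "expectation (\<lambda>\<omega>. dW [2] x \<omega> * reg p x n \<omega>) = 0" .
qed

lemma reg_diff_le: "\<bar>ca p x n * dW [1] x \<omega> + cb p x n * res x \<omega>\<bar> \<le> ma * \<bar>dW [1] x \<omega>\<bar> + mb * \<bar>res x \<omega>\<bar>"
proof -
  have "\<bar>ca p x n * dW [1] x \<omega>\<bar> \<le> ma * \<bar>dW [1] x \<omega>\<bar>" "\<bar>cb p x n * res x \<omega>\<bar> \<le> mb * \<bar>res x \<omega>\<bar>"
    unfolding abs_mult by (auto intro: mult_right_mono ca_bound cb_bound)
  then show ?thesis by linarith
qed

lemma hi_le_sup: "\<omega> \<in> space M \<Longrightarrow> \<bar>hi p n \<omega>\<bar> \<le> sup_abs (hi p) \<omega>"
  using sup_abs_le_iff[where X="hi p", OF hi_bdd] by blast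

lemma reg_bdd: "\<omega> \<in> space M \<Longrightarrow> bdd_above (range (\<lambda>n. \<bar>reg p x n \<omega>\<bar>))"
  using hi_le_sup[of \<omega> p] reg_diff_le[of p x _ \<omega>]
  by (intro bdd_aboveI2[where M="sup_abs (hi p) \<omega> + (ma * \<bar>dW [1] x \<omega>\<bar> + mb * \<bar>res x \<omega>\<bar>)"])
    (auto simp: reg_def intro!: order_trans[OF abs_triangle_ineq4] add_mono)

lemma sup_hi_le_reg:
  assumes "\<omega> \<in> space M"
  shows "sup_abs (hi p) \<omega> \<le> sup_abs (reg p x) \<omega> + (ma * \<bar>dW [1] x \<omega>\<bar> + mb * \<bar>res x \<omega>\<bar>)"
  unfolding sup_abs_le_iff[where X="hi p", OF hi_bdd[OF assms]]
proof
  fix n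
  have "\<bar>reg p x n \<omega>\<bar> \<le> sup_abs (reg p x) \<omega>" using sup_abs_le_iff[where X="reg p x", OF reg_bdd[OF assms]] by blast
  then show "\<bar>hi p n \<omega>\<bar> \<le> sup_abs (reg p x) \<omega> + (ma * \<bar>dW [1] x \<omega>\<bar> + mb * \<bar>res x \<omega>\<bar>)"
    using reg_diff_le[of p x n \<omega>] unfolding reg_def by linarith
qed

lemma sup_reg_le_hi:
  assumes "\<omega> \<in> space M"
  shows "sup_abs (reg p x) \<omega> \<le> sup_abs (hi p) \<omega> + (ma * \<bar>dW [1] x \<omega>\<bar> + mb * \<bar>res x \<omega>\<bar>)"
  unfolding sup_abs_le_iff[where X="reg p x", OF reg_bdd[OF assms]]
proof
  fix n
  show "\<bar>reg p x n \<omega>\<bar> \<le> sup_abs (hi p) \<omega> + (ma * \<bar>dW [1] x \<omega>\<bar> + mb * \<bar>res x \<omega>\<bar>)"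
    using reg_diff_le[of p x n \<omega>] hi_le_sup[OF assms, of p n] unfolding reg_def by linarith
qed

definition reg_moment :: real where
  "reg_moment = 3 * (hi_moment + ma\<^sup>2 * gv + mb\<^sup>2 * gw)"

lemma reg_moment_nonneg: "reg_moment \<ge> 0"
  unfolding reg_moment_def using hi_moment(2) gv_pos gw_pos by simp

text \<open>The residual differs from the higher derivative by bounded multiples of two Gaussians of
  fixed variance; squaring a sum of three terms costs the factor 3.\<close>

lemma reg_moment: "(\<integral>\<^sup>+\<omega>. ennreal ((sup_abs (reg p x) \<omega>)\<^sup>2) \<partial>M) \<le> ennreal reg_moment"
proof -
  have sq: "integrable M (\<lambda>\<omega>. (dW [1] x \<omega>)\<^sup>2)" "integrable M (\<lambda>\<omega>. (res x \<omega>)\<^sup>2)"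
    "expectation (\<lambda>\<omega>. (dW [1] x \<omega>)\<^sup>2) = gv" "expectation (\<lambda>\<omega>. (res x \<omega>)\<^sup>2) = gw"
    using gaussD(2)[OF gauss_spaceD(1)[OF GS grad_in_Wspace]] gaussD(2)[OF gauss_spaceD(1)[OF GS res_in_Wspace]]
    by (auto simp: power2_eq_square cov_grad_at gv_def res_cov)
  have nn: "(\<integral>\<^sup>+\<omega>. ennreal ((dW [1] x \<omega>)\<^sup>2) \<partial>M) = ennreal gv" "(\<integral>\<^sup>+\<omega>. ennreal ((res x \<omega>)\<^sup>2) \<partial>M) = ennreal gw"
    using sq by (simp_all add: nn_integral_eq_integral)
  have "(\<integral>\<^sup>+\<omega>. ennreal ((sup_abs (reg p x) \<omega>)\<^sup>2) \<partial>M)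
     \<le> (\<integral>\<^sup>+\<omega>. ennreal 3 * (ennreal ((sup_abs (hi p) \<omega>)\<^sup>2) + ennreal (ma\<^sup>2) * ennreal ((dW [1] x \<omega>)\<^sup>2) + ennreal (mb\<^sup>2) * ennreal ((res x \<omega>)\<^sup>2)) \<partial>M)"
  proof (rule nn_integral_mono)
    fix \<omega> assume \<omega>: "\<omega> \<in> space M"
    define a b c where "a = sup_abs (hi p) \<omega>" and "b = ma * \<bar>dW [1] x \<omega>\<bar>" and "c = mb * \<bar>res x \<omega>\<bar>"
    have "(sup_abs (reg p x) \<omega>)\<^sup>2 \<le> (a + (b + c))\<^sup>2"
      unfolding a_def b_def c_def using sup_reg_le_hi[OF \<omega>, of p x] by (intro power_mono sup_abs_nonneg)
    also have "\<dots> \<le> 3 * (a\<^sup>2 + b\<^sup>2 + c\<^sup>2)"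
      using zero_le_power2[of "a - b"] zero_le_power2[of "a - c"] zero_le_power2[of "b - c"]
      unfolding power2_eq_square by (simp add: algebra_simps)
    finally have "(sup_abs (reg p x) \<omega>)\<^sup>2 \<le> 3 * ((sup_abs (hi p) \<omega>)\<^sup>2 + ma\<^sup>2 * (dW [1] x \<omega>)\<^sup>2 + mb\<^sup>2 * (res x \<omega>)\<^sup>2)"
      unfolding a_def b_def c_def by (simp add: power_mult_distrib)
    then have "ennreal ((sup_abs (reg p x) \<omega>)\<^sup>2) \<le> ennreal (3 * ((sup_abs (hi p) \<omega>)\<^sup>2 + ma\<^sup>2 * (dW [1] x \<omega>)\<^sup>2 + mb\<^sup>2 * (res x \<omega>)\<^sup>2))"
      by (rule ennreal_leI)
    then show "ennreal ((sup_abs (reg p x) \<omega>)\<^sup>2) \<le> ennreal 3 * (ennreal ((sup_abs (hi p) \<omega>)\<^sup>2) + ennreal (ma\<^sup>2) * ennreal ((dW [1] x \<omega>)\<^sup>2) + ennreal (mb\<^sup>2) * ennreal ((res x \<omega>)\<^sup>2))"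
      by (simp add: ennreal_mult ennreal_plus)
  qed
  also have "\<dots> = ennreal 3 * (ennreal hi_moment + ennreal (ma\<^sup>2) * ennreal gv + ennreal (mb\<^sup>2) * ennreal gw)"
    by (simp add: nn_integral_cmult nn_integral_add hi_moment(1) nn del: ennreal_numeral)
  also have "\<dots> = ennreal reg_moment"
    unfolding reg_moment_def using hi_moment(2) gv_pos gw_pos
    by (simp add: ennreal_mult[symmetric] ennreal_plus[symmetric] del: ennreal_plus ennreal_numeral)
  finally show ?thesis .
qed

text \<open>Vanishing covariances make the whole residual family independent of the gradient at
  \<open>x\<close>, and a bound on the supremum is a rectangle.\<close>

lemma reg_indep: "prob ({\<omega>\<in>space M. sup_abs (reg p x) \<omega> \<le> s} \<inter> grad_near x u v r)
   = prob {\<omega>\<in>space M. sup_abs (reg p x) \<omega> \<le> s} * prob (grad_near x u v r)"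
proof -
  \<comment> \<open>The two components are padded to a sequence by repeating the second one from
    index 1 on.\<close>
  define X where "X = (\<lambda>i::nat. if i = 0 then dW [1] x else dW [2] x)"
  define A where "A = (\<lambda>i::nat. if i = 0 then {u-r..u+r} else {v-r..v+r})"
  have X: "(\<forall>i. X i \<omega> \<in> A i) \<longleftrightarrow> \<bar>dW [1] x \<omega> - u\<bar> \<le> r \<and> \<bar>dW [2] x \<omega> - v\<bar> \<le> r" for \<omega>
  proof -
    have "(\<forall>i. X i \<omega> \<in> A i) \<longleftrightarrow> dW [1] x \<omega> \<in> {u-r..u+r} \<and> dW [2] x \<omega> \<in> {v-r..v+r}"
      unfolding X_def A_def by (auto split: if_splits)
    then show ?thesis by (auto simp: abs_le_iff)
  qed
  have R: "sup_abs (reg p x) \<omega> \<le> s \<longleftrightarrow> (\<forall>i. reg p x i \<omega> \<in> {-s..s})" if "\<omega> \<in> space M" for \<omega>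
    using sup_abs_le_iff[where X="reg p x", OF reg_bdd[OF that]] by (simp add: abs_le_Icc)
  have "prob {\<omega>\<in>space M. \<forall>i. X i \<omega> \<in> A i \<and> reg p x i \<omega> \<in> {-s..s}}
    = prob {\<omega>\<in>space M. \<forall>i. X i \<omega> \<in> A i} * prob {\<omega>\<in>space M. \<forall>i. reg p x i \<omega> \<in> {-s..s}}"
    by (rule gauss_space_indep[OF GS]) (auto simp: X_def A_def reg_cov intro: grad_in_Wspace reg_in_Wspace)
  moreover have "{\<omega>\<in>space M. \<forall>i. X i \<omega> \<in> A i \<and> reg p x i \<omega> \<in> {-s..s}} = {\<omega>\<in>space M. sup_abs (reg p x) \<omega> \<le> s} \<inter> grad_near x u v r"
    unfolding all_conj_distrib X grad_near_def using R by blast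
  moreover have "{\<omega>\<in>space M. \<forall>i. X i \<omega> \<in> A i} = grad_near x u v r" unfolding X grad_near_def ..
  moreover have "{\<omega>\<in>space M. \<forall>i. reg p x i \<omega> \<in> {-s..s}} = {\<omega>\<in>space M. sup_abs (reg p x) \<omega> \<le> s}" using R by blast
  ultimately show ?thesis by (simp add: mult.commute)
qed

text \<open>Put \<open>t = \<bar>u\<bar> + \<bar>v\<bar>\<close>. On the event each gradient
  component is at most \<open>1 + t\<close> in absolute value, so the supremum of the higher
  derivatives exceeds the independent residual supremum by at most a multiple of
  \<open>1 + t\<close>. Of the decay \<open>exp (- 2 * t)\<close> half is spent on
  \<open>(1 + t)\<^sup>2 \<le> 4 * exp t\<close>.\<close>

lemma weighted_near_bound:
  "\<exists>C>0. \<forall>p x u v r. 0 < r \<longrightarrow> r \<le> 1 \<longrightarrow>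
     (\<integral>\<^sup>+\<omega>. ennreal ((1 + sup_abs (hi p) \<omega>)\<^sup>2) * indicator (grad_near x u v r) \<omega> \<partial>M)
       \<le> ennreal (C * r\<^sup>2 * exp (- (\<bar>u\<bar> + \<bar>v\<bar>)))"
proof -
  obtain C1 where C1: "C1 > 0" "\<And>x u v r. 0 < r \<Longrightarrow> r \<le> 1 \<Longrightarrow> prob (grad_near x u v r) \<le> C1 * r\<^sup>2 * exp (- 2 * (\<bar>u\<bar> + \<bar>v\<bar>))"
    using grad_near_prob by blast
  define T0 where "T0 = 1 + ma + mb * (1 + \<bar>gb\<bar>)"
  have T0: "T0 > 0" unfolding T0_def using ma_mb_nonneg by (simp add: add_pos_nonneg)
  show ?thesis
  \<comment> \<open>In \<open>8 * T0\<^sup>2\<close> the factor is 2, from squaring a sum of two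
    terms, times 4, from \<open>(1 + t)\<^sup>2 \<le> 4 * exp t\<close>.\<close>
  proof (intro exI[of _ "(2 * reg_moment + 8 * T0\<^sup>2) * C1"] conjI allI impI)
    show "0 < (2 * reg_moment + 8 * T0\<^sup>2) * C1" using C1 T0 reg_moment_nonneg by (simp add: add_nonneg_pos)
    fix p x :: "real^2" and u v r :: real assume r: "0 < r" "r \<le> 1"
    let ?E = "grad_near x u v r"
    define t where "t = \<bar>u\<bar> + \<bar>v\<bar>"
    have t0: "t \<ge> 0" by (simp add: t_def)
    define q where "q = (T0 * (1 + t))\<^sup>2"
    have pt: "ennreal ((1 + sup_abs (hi p) \<omega>)\<^sup>2) * indicator ?E \<omega>
        \<le> ennreal (2 * (sup_abs (reg p x) \<omega>)\<^sup>2) * indicator ?E \<omega> + ennreal (2 * q) * indicator ?E \<omega>" if \<omega>: "\<omega> \<in> space M" for \<omega>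
    proof (cases "\<omega> \<in> ?E")
      case True
      then have e: "\<bar>dW [1] x \<omega>\<bar> \<le> 1 + t" "\<bar>dW [2] x \<omega>\<bar> \<le> 1 + t" using r unfolding grad_near_def t_def by auto
      have "\<bar>res x \<omega>\<bar> \<le> \<bar>dW [2] x \<omega>\<bar> + \<bar>gb\<bar> * \<bar>dW [1] x \<omega>\<bar>" unfolding res_def abs_mult[symmetric] by linarith
      also have "\<dots> \<le> (1 + t) + \<bar>gb\<bar> * (1 + t)" using e by (intro add_mono mult_left_mono) auto
      also have "\<dots> = (1 + \<bar>gb\<bar>) * (1 + t)" by (simp add: algebra_simps)
      finally have er: "\<bar>res x \<omega>\<bar> \<le> (1 + \<bar>gb\<bar>) * (1 + t)" .
      have "1 + (ma * \<bar>dW [1] x \<omega>\<bar> + mb * \<bar>res x \<omega>\<bar>) \<le> (1 + t) + (ma * (1 + t) + mb * ((1 + \<bar>gb\<bar>) * (1 + t)))"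
        using e er ma_mb_nonneg t0 by (intro add_mono mult_left_mono) auto
      also have "\<dots> = T0 * (1 + t)" unfolding T0_def by (simp add: algebra_simps)
      finally have "1 + sup_abs (hi p) \<omega> \<le> sup_abs (reg p x) \<omega> + T0 * (1 + t)"
        using sup_hi_le_reg[OF \<omega>, of p x] by linarith
      then have "(1 + sup_abs (hi p) \<omega>)\<^sup>2 \<le> (sup_abs (reg p x) \<omega> + T0 * (1 + t))\<^sup>2"
        using sup_abs_nonneg[of "hi p" \<omega>] by (intro power_mono) auto
      also have "\<dots> \<le> 2 * (sup_abs (reg p x) \<omega>)\<^sup>2 + 2 * q"
        using zero_le_power2[of "sup_abs (reg p x) \<omega> - T0 * (1 + t)"] unfolding q_def power2_sum power2_diff by linarith
      finally have "ennreal ((1 + sup_abs (hi p) \<omega>)\<^sup>2) \<le> ennreal (2 * (sup_abs (reg p x) \<omega>)\<^sup>2 + 2 * q)" by (rule ennreal_leI)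
      then show ?thesis using True by (simp add: ennreal_plus q_def)
    qed simp
    have "(\<integral>\<^sup>+\<omega>. ennreal ((1 + sup_abs (hi p) \<omega>)\<^sup>2) * indicator ?E \<omega> \<partial>M)
      \<le> (\<integral>\<^sup>+\<omega>. ennreal (2 * (sup_abs (reg p x) \<omega>)\<^sup>2) * indicator ?E \<omega> + ennreal (2 * q) * indicator ?E \<omega> \<partial>M)"
      by (intro nn_integral_mono pt)
    also have "\<dots> = (\<integral>\<^sup>+\<omega>. ennreal (2 * (sup_abs (reg p x) \<omega>)\<^sup>2) * indicator ?E \<omega> \<partial>M) + ennreal (2 * q) * ennreal (prob ?E)"
      by (simp add: nn_integral_add nn_integral_cmult_indicator emeasure_eq_measure)
    also have "(\<integral>\<^sup>+\<omega>. ennreal (2 * (sup_abs (reg p x) \<omega>)\<^sup>2) * indicator ?E \<omega> \<partial>M)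
      = ennreal (prob ?E) * (\<integral>\<^sup>+\<omega>. ennreal (2 * (sup_abs (reg p x) \<omega>)\<^sup>2) \<partial>M)"
      by (rule indep_nn_integral[where f="\<lambda>s. ennreal (2 * s\<^sup>2)"]) (auto simp: reg_indep)
    also have "(\<integral>\<^sup>+\<omega>. ennreal (2 * (sup_abs (reg p x) \<omega>)\<^sup>2) \<partial>M) = ennreal 2 * (\<integral>\<^sup>+\<omega>. ennreal ((sup_abs (reg p x) \<omega>)\<^sup>2) \<partial>M)"
      by (simp add: ennreal_mult nn_integral_cmult del: ennreal_numeral)
    also have "ennreal (prob ?E) * (ennreal 2 * (\<integral>\<^sup>+\<omega>. ennreal ((sup_abs (reg p x) \<omega>)\<^sup>2) \<partial>M)) + ennreal (2 * q) * ennreal (prob ?E)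
      \<le> ennreal (prob ?E) * (ennreal 2 * ennreal reg_moment) + ennreal (2 * q) * ennreal (prob ?E)"
      by (intro add_mono mult_left_mono reg_moment) auto
    also have "\<dots> = ennreal (prob ?E * (2 * reg_moment + 2 * q))"
      using reg_moment_nonneg by (simp add: ennreal_mult[symmetric] ennreal_plus[symmetric] q_def algebra_simps del: ennreal_plus ennreal_numeral)
    also have "\<dots> \<le> ennreal ((2 * reg_moment + 8 * T0\<^sup>2) * C1 * r\<^sup>2 * exp (- (\<bar>u\<bar> + \<bar>v\<bar>)))"
    proof (rule ennreal_leI)
      have "1 + t \<le> 2 * exp (t / 2)" using exp_ge_add_one_self[of "t / 2"] t0 by linarith
      then have "(1 + t)\<^sup>2 \<le> (2 * exp (t / 2))\<^sup>2" using t0 by (intro power_mono) auto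
      also have "\<dots> = 4 * exp t" by (simp add: power_mult_distrib power2_eq_square exp_add[symmetric])
      finally have "q \<le> T0\<^sup>2 * (4 * exp t)" unfolding q_def power_mult_distrib by (intro mult_left_mono) auto
      moreover have "reg_moment \<le> reg_moment * exp t" using reg_moment_nonneg t0 by (simp add: mult_le_cancel_left1)
      ultimately have "2 * reg_moment + 2 * q \<le> (2 * reg_moment + 8 * T0\<^sup>2) * exp t" by (simp add: algebra_simps)
      then have "prob ?E * (2 * reg_moment + 2 * q) \<le> (C1 * r\<^sup>2 * exp (- 2 * t)) * ((2 * reg_moment + 8 * T0\<^sup>2) * exp t)"
        using C1(2)[OF r, of x u v] C1(1) reg_moment_nonneg unfolding t_def[symmetric] by (intro mult_mono) (auto simp: q_def)
      also have "\<dots> = (2 * reg_moment + 8 * T0\<^sup>2) * C1 * r\<^sup>2 * (exp (- 2 * t) * exp t)" by (simp only: mult_ac)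
      also have "exp (- 2 * t) * exp t = exp (- t)" by (simp add: exp_add[symmetric])
      finally show "prob ?E * (2 * reg_moment + 2 * q) \<le> (2 * reg_moment + 8 * T0\<^sup>2) * C1 * r\<^sup>2 * exp (- (\<bar>u\<bar> + \<bar>v\<bar>))"
        unfolding t_def .
    qed
    finally show "(\<integral>\<^sup>+\<omega>. ennreal ((1 + sup_abs (hi p) \<omega>)\<^sup>2) * indicator ?E \<omega> \<partial>M)
       \<le> ennreal ((2 * reg_moment + 8 * T0\<^sup>2) * C1 * r\<^sup>2 * exp (- (\<bar>u\<bar> + \<bar>v\<bar>)))" .
  qed
qed

end

section \<open>Second moment in one cell\<close>

lemma ennreal_mult_liminf_le: "(c::ennreal) * liminf x \<le> liminf (\<lambda>n. c * x n)"
  unfolding liminf_SUP_INF SUP_mult_left_ennreal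
  by (intro SUP_mono) (auto intro!: INF_greatest mult_left_mono INF_lower)

lemma emeasure_nbhd: "emeasure lborel (nbhd p) \<le> ennreal 9"
proof -
  let ?C = "cbox (\<chi> i. p$i - 1) (\<chi> i. p$i + 2) :: (real^2) set"
  have "emeasure lborel (nbhd p) \<le> emeasure lborel ?C"
    unfolding nbhd_def by (intro emeasure_mono box_subset_cbox) auto
  also have "\<dots> = ennreal (measure lborel ?C)"
    using emeasure_compact_finite[OF compact_cbox] by (intro emeasure_eq_ennreal_measure) (simp add: less_top)
  also have "measure lborel ?C = 9"
    using content_cbox_cart[of "\<chi> i. p$i - 1" "\<chi> i. p$i + 2"] by (simp add: UNIV_2 interval_eq_empty_cart not_less)
  finally show ?thesis .
qed

lemma nth_measurable[measurable]: "(\<lambda>x::real^2. x $ i) \<in> borel_measurable borel"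
  by (intro borel_measurable_continuous_onI continuous_intros)

context nondegenerate_surface
begin

section \<open>Joint measurability of the gradient and the second moment\<close>

definition grid :: "nat \<Rightarrow> int \<Rightarrow> int \<Rightarrow> real^2" where
  "grid n a b = (\<chi> j. (if j = 1 then of_int a else of_int b) / real (Suc n))"

lemma grid_lim:
  "(\<lambda>n. grid n \<lfloor>real (Suc n) * x$1\<rfloor> \<lfloor>real (Suc n) * x$2\<rfloor>) \<longlonglongrightarrow> x"
proof (rule vec_tendstoI)
  fix i :: 2
  have f: "(\<lambda>n. of_int \<lfloor>real (Suc n) * y\<rfloor> / real (Suc n)) \<longlonglongrightarrow> y" for y :: real
  proof (rule LIMSEQ_I)
    fix e :: real assume "e > 0"
    then obtain n0 where n0: "inverse (real (Suc n0)) < e" using reals_Archimedean by blast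
    show "\<exists>no. \<forall>n\<ge>no. norm (of_int \<lfloor>real (Suc n) * y\<rfloor> / real (Suc n) - y) < e"
    proof (intro exI allI impI)
      fix n assume n: "n0 \<le> n"
      have "\<bar>of_int \<lfloor>real (Suc n) * y\<rfloor> - real (Suc n) * y\<bar> \<le> 1" by linarith
      then have "\<bar>of_int \<lfloor>real (Suc n) * y\<rfloor> - real (Suc n) * y\<bar> / real (Suc n) \<le> 1 / real (Suc n)" by (rule divide_right_mono) simp
      also have "\<dots> \<le> inverse (real (Suc n0))" using n by (simp add: inverse_eq_divide frac_le)
      also have "\<dots> < e" by (rule n0)
      also have "\<bar>of_int \<lfloor>real (Suc n) * y\<rfloor> - real (Suc n) * y\<bar> / real (Suc n) = \<bar>of_int \<lfloor>real (Suc n) * y\<rfloor> / real (Suc n) - y\<bar>"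
      proof -
        have "of_int \<lfloor>real (Suc n) * y\<rfloor> / real (Suc n) - y = (of_int \<lfloor>real (Suc n) * y\<rfloor> - real (Suc n) * y) / real (Suc n)"
          by (simp add: diff_divide_distrib del: of_nat_Suc)
        then show ?thesis by (simp only: abs_divide abs_of_nat)
      qed
      finally show "norm (of_int \<lfloor>real (Suc n) * y\<rfloor> / real (Suc n) - y) < e" by simp
    qed
  qed
  show "(\<lambda>n. grid n \<lfloor>real (Suc n) * x$1\<rfloor> \<lfloor>real (Suc n) * x$2\<rfloor> $ i) \<longlonglongrightarrow> x $ i"
    using exhaust_2[of i] f[of "x$1"] f[of "x$2"] by (auto simp: grid_def)
qed

text \<open>The gradient is measurable in \<open>\<omega>\<close> and continuous in the point, hence
  a pointwise limit of its values on countable grids, where joint measurability follows from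
  countability.\<close>

lemma grad_joint_measurable[measurable]:
  "(\<lambda>q. dW [m] (snd q) (fst q)) \<in> borel_measurable (M \<Otimes>\<^sub>M lborel)"
proof (rule borel_measurable_LIMSEQ_real)
  fix n
  let ?f = "\<lambda>j::2. \<lambda>q::'a \<times> (real^2). \<lfloor>real (Suc n) * snd q $ j\<rfloor>"
  have [measurable]: "?f j \<in> measurable (M \<Otimes>\<^sub>M lborel) (count_space UNIV)" for j by measurable
  have "(\<lambda>q. dW [m] (grid n a (?f 2 q)) (fst q)) \<in> borel_measurable (M \<Otimes>\<^sub>M lborel)" for a
    by (rule measurable_compose_countable[where g="?f 2" and f="\<lambda>b q. dW [m] (grid n a b) (fst q)"]) measurable
  then show "(\<lambda>q. dW [m] (grid n (?f 1 q) (?f 2 q)) (fst q)) \<in> borel_measurable (M \<Otimes>\<^sub>M lborel)"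
    by (rule measurable_compose_countable[where g="?f 1" and f="\<lambda>a q. dW [m] (grid n a (?f 2 q)) (fst q)"]) measurable
next
  fix q assume "q \<in> space (M \<Otimes>\<^sub>M lborel :: ('a \<times> (real^2)) measure)"
  then have "fst q \<in> space M" by (auto simp: space_pair_measure)
  then have "continuous_on UNIV (\<lambda>x. dW [m] x (fst q))" by (rule dW_continuous) simp
  then have "isCont (\<lambda>x. dW [m] x (fst q)) (snd q)" by (simp add: continuous_on_eq_continuous_at)
  then show "(\<lambda>n. dW [m] (grid n \<lfloor>real (Suc n) * snd q $ 1\<rfloor> \<lfloor>real (Suc n) * snd q $ 2\<rfloor>) (fst q)) \<longlonglongrightarrow> dW [m] (snd q) (fst q)"
    by (rule isCont_tendsto_compose) (rule grid_lim)
qed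

text \<open>For fixed \<open>x\<close> the inner expectation is the weighted bound with centre
  \<open>k *\<^sub>R x\<close> and radius \<open>1 / (n + 1)\<close>, whose square cancels the
  scaling of the sublevel area. The result is uniform in \<open>n\<close>, so it passes through the
  lower limit.\<close>

theorem num_zeros_second_moment:
  "\<exists>C>0. \<forall>k p. 0 < k \<longrightarrow> k \<le> 1 \<longrightarrow>
     (\<integral>\<^sup>+\<omega>. (num_zeros k (W \<omega>) (cell p))\<^sup>2 \<partial>M) \<le> ennreal (C * exp (- k * (\<bar>p$1\<bar> + \<bar>p$2\<bar>)))"
proof -
  obtain C where C: "C > 0" "\<And>p x u v r. 0 < r \<Longrightarrow> r \<le> 1 \<Longrightarrow>
     (\<integral>\<^sup>+\<omega>. ennreal ((1 + sup_abs (hi p) \<omega>)\<^sup>2) * indicator (grad_near x u v r) \<omega> \<partial>M)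
       \<le> ennreal (C * r\<^sup>2 * exp (- (\<bar>u\<bar> + \<bar>v\<bar>)))"
    using weighted_near_bound by blast
  show ?thesis
  \<comment> \<open>184320 comes from the pathwise bound and 9 is the area of the neighbourhood.
    \<open>exp 4\<close> pays for replacing \<open>x\<close> by \<open>p\<close>: each coordinate
    changes by at most 2, and \<open>k \<le> 1\<close>.\<close>
  proof (intro exI[of _ "184320 * C * exp 4 * 9"] conjI allI impI)
    show "0 < 184320 * C * exp 4 * 9" using C by simp
    fix k :: real and p :: "real^2" assume k: "0 < k" "k \<le> 1"
    let ?c = "\<lambda>\<omega>. 1 + sup_abs (hi p) \<omega>" and ?U = "nbhd p"
    have Us[measurable]: "?U \<in> sets borel" by (simp add: nbhd_def open_box borel_open)
    define E where "E n x = grad_near x (k * x$1) (k * x$2) (1 / real (Suc n))" for n x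
    define h where "h n \<omega> x = ennreal ((?c \<omega>)\<^sup>2) * (indicator ?U x * indicator (E n x) \<omega>)" for n \<omega> x
    have hm[measurable]: "case_prod (h n) \<in> borel_measurable (M \<Otimes>\<^sub>M lborel)" for n
    proof -
      have "Measurable.pred (M \<Otimes>\<^sub>M lborel) (\<lambda>q. fst q \<in> space M \<and> \<bar>dW [1] (snd q) (fst q) - k * snd q $ 1\<bar> \<le> 1 / real (Suc n)
         \<and> \<bar>dW [2] (snd q) (fst q) - k * snd q $ 2\<bar> \<le> 1 / real (Suc n))"
        by measurable
      then have "(\<lambda>q. indicator (E n (snd q)) (fst q) :: ennreal) \<in> borel_measurable (M \<Otimes>\<^sub>M lborel)"
        unfolding E_def grad_near_def indicator_def mem_Collect_eq by measurable
      then show ?thesis unfolding h_def case_prod_beta by measurable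
    qed
    define u where "u n \<omega> = ennreal (184320 * (real (Suc n))\<^sup>2) * (\<integral>\<^sup>+x. h n \<omega> x \<partial>lborel)" for n \<omega>
    have um[measurable]: "u n \<in> borel_measurable M" for n unfolding u_def[abs_def]
      using lborel.borel_measurable_nn_integral[OF hm[of n]] by measurable
    have bound: "(num_zeros k (W \<omega>) (cell p))\<^sup>2 \<le> liminf (\<lambda>n. u n \<omega>)" if \<omega>: "\<omega> \<in> space M" for \<omega>
    proof -
      have "(num_zeros k (W \<omega>) (cell p))\<^sup>2 \<le> ennreal (184320 * (?c \<omega>)\<^sup>2) * liminf (scaled_sublevel (spec_fun k (W \<omega>)) ?U)"
      proof (rule num_zeros_cell_sq_le[OF smooth[OF \<omega>] k])
        show "1 \<le> ?c \<omega>" using sup_abs_nonneg[of "hi p" \<omega>] by simp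
        fix \<alpha> :: "2 list" and z assume "length \<alpha> \<in> {2,3}" "z \<in> ?U"
        then show "\<bar>iter_pd \<alpha> (W \<omega>) z\<bar> \<le> ?c \<omega>" using dW_le_sup[OF \<omega>, of z p \<alpha>] by (simp add: dW_def)
      qed
      also have "\<dots> \<le> liminf (\<lambda>n. ennreal (184320 * (?c \<omega>)\<^sup>2) * scaled_sublevel (spec_fun k (W \<omega>)) ?U n)"
        by (rule ennreal_mult_liminf_le)
      also have "(\<lambda>n. ennreal (184320 * (?c \<omega>)\<^sup>2) * scaled_sublevel (spec_fun k (W \<omega>)) ?U n) = (\<lambda>n. u n \<omega>)"
      proof
        fix n
        let ?S = "{y \<in> ?U. \<forall>m. \<bar>spec_fun k (W \<omega>) m y\<bar> \<le> 1 / real (Suc n)}"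
        \<comment> \<open>One relation, read as a set of points for fixed \<open>\<omega>\<close>
          and as an event for fixed \<open>x\<close>; this lets Fubini exchange area and
          probability.\<close>
        have ind: "indicator ?U x * indicator (E n x) \<omega> = (indicator ?S x :: ennreal)" for x
          using \<omega> by (auto simp: indicator_def E_def grad_near_def spec_fun_def dW_def forall_2)
        have "closed {y. \<forall>m. \<bar>spec_fun k (W \<omega>) m y\<bar> \<le> 1 / real (Suc n)}"
          by (intro closed_Collect_all closed_Collect_le continuous_intros spec_fun_continuous smooth \<omega>)
        then have "?U \<inter> {y. \<forall>m. \<bar>spec_fun k (W \<omega>) m y\<bar> \<le> 1 / real (Suc n)} \<in> sets borel"
          by (intro sets.Int Us borel_closed)
        then have S: "?S \<in> sets borel" by (simp add: Collect_conj_eq)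
        have "(\<integral>\<^sup>+x. h n \<omega> x \<partial>lborel) = ennreal ((?c \<omega>)\<^sup>2) * emeasure lborel ?S"
          unfolding h_def ind using S by (simp add: nn_integral_cmult_indicator)
        then show "ennreal (184320 * (?c \<omega>)\<^sup>2) * scaled_sublevel (spec_fun k (W \<omega>)) ?U n = u n \<omega>"
          unfolding u_def scaled_sublevel_def by (simp add: ennreal_mult mult_ac)
      qed
      finally show ?thesis .
    qed
    have int: "(\<integral>\<^sup>+\<omega>. u n \<omega> \<partial>M) \<le> ennreal (184320 * C * exp 4 * 9 * exp (- k * (\<bar>p$1\<bar> + \<bar>p$2\<bar>)))" for n
    proof -
      interpret P: pair_sigma_finite M lborel by unfold_locales
      let ?e = "C * (1 / real (Suc n))\<^sup>2 * (exp 4 * exp (- k * (\<bar>p$1\<bar> + \<bar>p$2\<bar>)))"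
      have "(\<integral>\<^sup>+\<omega>. u n \<omega> \<partial>M) = ennreal (184320 * (real (Suc n))\<^sup>2) * (\<integral>\<^sup>+\<omega>. (\<integral>\<^sup>+x. h n \<omega> x \<partial>lborel) \<partial>M)"
        unfolding u_def using lborel.borel_measurable_nn_integral[OF hm[of n]] by (intro nn_integral_cmult) auto
      also have "(\<integral>\<^sup>+\<omega>. (\<integral>\<^sup>+x. h n \<omega> x \<partial>lborel) \<partial>M) = (\<integral>\<^sup>+x. (\<integral>\<^sup>+\<omega>. h n \<omega> x \<partial>M) \<partial>lborel)"
        by (rule P.Fubini'[OF hm, symmetric])
      also have "\<dots> \<le> (\<integral>\<^sup>+x. ennreal ?e * indicator ?U x \<partial>lborel)"
      proof (rule nn_integral_mono)
        fix x
        show "(\<integral>\<^sup>+\<omega>. h n \<omega> x \<partial>M) \<le> ennreal ?e * indicator ?U x"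
        proof (cases "x \<in> ?U")
          case True
          have "(\<integral>\<^sup>+\<omega>. h n \<omega> x \<partial>M) \<le> ennreal (C * (1 / real (Suc n))\<^sup>2 * exp (- (\<bar>k * x$1\<bar> + \<bar>k * x$2\<bar>)))"
            using C(2)[of "1 / real (Suc n)" p x "k * x$1" "k * x$2"] True unfolding h_def E_def by (simp del: of_nat_Suc)
          also have "\<dots> \<le> ennreal ?e"
          proof (intro ennreal_leI mult_left_mono)
            have px: "\<bar>p$i\<bar> \<le> \<bar>x$i\<bar> + 2" for i
              using True unfolding nbhd_def by (auto simp: mem_box_cart dest!: spec[of _ i])
            have "k * (\<bar>p$1\<bar> + \<bar>p$2\<bar>) \<le> k * (\<bar>x$1\<bar> + \<bar>x$2\<bar> + 4)" using px[of 1] px[of 2] k by (intro mult_left_mono) auto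
            also have "\<dots> \<le> k * \<bar>x$1\<bar> + k * \<bar>x$2\<bar> + 4" using k by (simp add: algebra_simps)
            finally have "- (\<bar>k * x$1\<bar> + \<bar>k * x$2\<bar>) \<le> 4 + - k * (\<bar>p$1\<bar> + \<bar>p$2\<bar>)" using k by (simp add: abs_mult)
            then show "exp (- (\<bar>k * x$1\<bar> + \<bar>k * x$2\<bar>)) \<le> exp 4 * exp (- k * (\<bar>p$1\<bar> + \<bar>p$2\<bar>))"
              unfolding exp_add[symmetric] by (simp only: exp_le_cancel_iff)
          qed (use C in auto)
          finally show ?thesis using True by simp
        qed (simp add: h_def)
      qed
      also have "\<dots> = ennreal ?e * emeasure lborel ?U" by (simp add: nn_integral_cmult_indicator)
      also have "\<dots> \<le> ennreal ?e * ennreal 9" by (intro mult_left_mono emeasure_nbhd) auto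
      also have "ennreal (184320 * (real (Suc n))\<^sup>2) * (ennreal ?e * ennreal 9) = ennreal (184320 * (real (Suc n))\<^sup>2 * (?e * 9))"
        using C by (simp add: ennreal_mult[symmetric] del: ennreal_numeral)
      also have "184320 * (real (Suc n))\<^sup>2 * (?e * 9) = 184320 * C * exp 4 * 9 * exp (- k * (\<bar>p$1\<bar> + \<bar>p$2\<bar>))"
        by (simp add: power_divide del: of_nat_Suc)
      finally show ?thesis by (simp add: mult_left_mono)
    qed
    have "(\<integral>\<^sup>+\<omega>. (num_zeros k (W \<omega>) (cell p))\<^sup>2 \<partial>M) \<le> (\<integral>\<^sup>+\<omega>. liminf (\<lambda>n. u n \<omega>) \<partial>M)"
      by (intro nn_integral_mono bound)
    also have "\<dots> \<le> liminf (\<lambda>n. \<integral>\<^sup>+\<omega>. u n \<omega> \<partial>M)" by (rule nn_integral_liminf) simp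
    also have "\<dots> \<le> liminf (\<lambda>n. ennreal (184320 * C * exp 4 * 9 * exp (- k * (\<bar>p$1\<bar> + \<bar>p$2\<bar>))))"
      by (intro Liminf_mono always_eventually allI int)
    also have "\<dots> = ennreal (184320 * C * exp 4 * 9 * exp (- k * (\<bar>p$1\<bar> + \<bar>p$2\<bar>)))" by (simp add: Liminf_const)
    finally show "(\<integral>\<^sup>+\<omega>. (num_zeros k (W \<omega>) (cell p))\<^sup>2 \<partial>M) \<le> ennreal (184320 * C * exp 4 * 9 * exp (- k * (\<bar>p$1\<bar> + \<bar>p$2\<bar>)))" .
  qed
qed

end

section \<open>Measurability and independence of the zero counts\<close>

definition half_box :: "real^2 \<Rightarrow> real^2 \<Rightarrow> (real^2) set" where
  "half_box l h = {x. \<forall>i. l$i \<le> x$i \<and> x$i < h$i}"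

text \<open>A half-open box is exhausted by compact ones, on which minima are attained. The
  denominator \<open>n + 2\<close> keeps every box nondegenerate, including the one for
  \<open>n = 0\<close>.\<close>

lemma half_box_eq_UN:
  "half_box l h = (\<Union>n::nat. cbox l (\<chi> i. h$i - (h$i - l$i) / real (n + 2)))" if lh: "\<And>i. l$i < h$i"
proof safe
  fix x assume x: "x \<in> half_box l h"
  have "\<exists>n0. \<forall>n\<ge>n0. x$i \<le> h$i - (h$i - l$i) / real (n + 2)" for i
  proof -
    have "h$i - x$i > 0" using x by (simp add: half_box_def)
    obtain n0 :: nat where n0: "(h$i - l$i) / (h$i - x$i) \<le> real n0" using real_arch_simple by blast
    have "(h$i - l$i) / real (n + 2) \<le> h$i - x$i" if "n \<ge> n0" for n
    proof -
      have "(h$i - l$i) / (h$i - x$i) \<le> real (n + 2)" using n0 that by linarith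
      then show ?thesis using \<open>h$i - x$i > 0\<close> by (simp add: field_simps)
    qed
    then show ?thesis by (intro exI[of _ n0]) (auto simp: algebra_simps)
  qed
  then obtain n1 n2 where "\<And>n. n \<ge> n1 \<Longrightarrow> x$1 \<le> h$1 - (h$1 - l$1) / real (n + 2)"
     "\<And>n. n \<ge> n2 \<Longrightarrow> x$2 \<le> h$2 - (h$2 - l$2) / real (n + 2)" by metis
  then show "x \<in> (\<Union>n::nat. cbox l (\<chi> i. h$i - (h$i - l$i) / real (n + 2)))"
    using x by (intro UN_I[of "max n1 n2"]) (auto simp: mem_box_cart half_box_def forall_2)
next
  fix x and n :: nat assume x: "x \<in> cbox l (\<chi> i. h$i - (h$i - l$i) / real (n + 2))"
  have "h$i - (h$i - l$i) / real (n + 2) < h$i" for i using lh[of i] by simp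
  then show "x \<in> half_box l h" using x unfolding half_box_def mem_box_cart by (auto intro: le_less_trans)
qed

text \<open>By compactness the sum of the absolute values of the two components attains its minimum,
  which is 0 iff both are arbitrarily small at dense points of the open box. This makes the
  existence of a zero a countable condition.\<close>

lemma zero_in_cbox_iff:
  assumes lh: "\<And>i. l$i < h$i" and f: "Ck 3 f"
  shows "(\<exists>x\<in>cbox l h. \<forall>m. spec_fun k f m x = 0) \<longleftrightarrow>
    (\<forall>j::nat. \<exists>d\<in>dense_pts \<inter> box l h. \<forall>m. \<bar>spec_fun k f m d\<bar> < 1 / real (Suc j))"
proof safe
  fix x and j :: nat assume x: "x \<in> cbox l h" "\<forall>m. spec_fun k f m x = 0"
  define O1 where "O1 = {y. \<bar>spec_fun k f 1 y\<bar> < 1 / real (Suc j) \<and> \<bar>spec_fun k f 2 y\<bar> < 1 / real (Suc j)}"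
  have O1: "open O1" unfolding O1_def
    by (intro open_Collect_conj open_Collect_less continuous_intros spec_fun_continuous f)
  have "x \<in> O1" unfolding O1_def using x by simp
  moreover have "closure (box l h) = cbox l h"
    using lh by (intro closure_box) (auto simp: interval_ne_empty_cart)
  ultimately have "O1 \<inter> box l h \<noteq> {}" using open_Int_closure_eq_empty[OF O1, of "box l h"] x by blast
  then obtain d where "d \<in> dense_pts" "d \<in> O1 \<inter> box l h"
    using dense_pts(2)[of "O1 \<inter> box l h"] O1 by (auto simp: open_box open_Int)
  then show "\<exists>d\<in>dense_pts \<inter> box l h. \<forall>m. \<bar>spec_fun k f m d\<bar> < 1 / real (Suc j)"
    unfolding O1_def by (intro bexI[of _ d]) (auto simp: forall_2)
next
  assume *: "\<forall>j::nat. \<exists>d\<in>dense_pts \<inter> box l h. \<forall>m. \<bar>spec_fun k f m d\<bar> < 1 / real (Suc j)"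
  let ?g = "\<lambda>y. \<bar>spec_fun k f 1 y\<bar> + \<bar>spec_fun k f 2 y\<bar>"
  have "cbox l h \<noteq> {}" using lh by (auto simp: interval_ne_empty_cart less_imp_le)
  moreover have "continuous_on (cbox l h) ?g"
    by (intro continuous_intros continuous_on_subset[OF spec_fun_continuous[OF f]]) auto
  ultimately obtain x where x: "x \<in> cbox l h" "\<And>y. y \<in> cbox l h \<Longrightarrow> ?g x \<le> ?g y"
    using continuous_attains_inf[OF compact_cbox, of l h ?g] by blast
  have "?g x \<le> e" if "e > 0" for e
  proof -
    obtain j where j: "inverse (real (Suc j)) < e / 2" using reals_Archimedean[of "e / 2"] \<open>e > 0\<close> by auto
    obtain d where d: "d \<in> box l h" "\<And>m. \<bar>spec_fun k f m d\<bar> < 1 / real (Suc j)" using * by blast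
    have "?g x \<le> ?g d" using x(2) d(1) box_subset_cbox by blast
    then show ?thesis using d(2)[of 1] d(2)[of 2] j by (simp add: inverse_eq_divide)
  qed
  then have "?g x \<le> 0" by (rule field_le_epsilon[of _ 0, simplified])
  then show "\<exists>x\<in>cbox l h. \<forall>m. spec_fun k f m x = 0"
    using x(1) by (intro bexI[of _ x]) (auto simp: forall_2)
qed

section \<open>Counting zeros by subdivision\<close>

definition subcell :: "real^2 \<Rightarrow> nat \<Rightarrow> nat \<times> nat \<Rightarrow> (real^2) set" where
  "subcell p n s = half_box (\<chi> j. p$j + real (if j = 1 then fst s else snd s) / real (Suc n))
     (\<chi> j. p$j + real (Suc (if j = 1 then fst s else snd s)) / real (Suc n))"

text \<open>In terms of integer parts, disjointness and covering of the subcells are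
  immediate.\<close>

lemma mem_subcell:
  "x \<in> subcell p n s \<longleftrightarrow> \<lfloor>real (Suc n) * (x$1 - p$1)\<rfloor> = int (fst s) \<and> \<lfloor>real (Suc n) * (x$2 - p$2)\<rfloor> = int (snd s)"
proof -
  have "p + real a / real (Suc n) \<le> y \<and> y < p + real (Suc a) / real (Suc n) \<longleftrightarrow> \<lfloor>real (Suc n) * (y - p)\<rfloor> = int a"
    for p y :: real and a
  proof -
    have "p + real a / real (Suc n) \<le> y \<longleftrightarrow> real a \<le> real (Suc n) * (y - p)"
      by (simp add: field_simps del: of_nat_Suc)
    moreover have "y < p + real (Suc a) / real (Suc n) \<longleftrightarrow> real (Suc n) * (y - p) < real a + 1"
      by (simp add: field_simps del: of_nat_Suc) (simp add: algebra_simps)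
    ultimately show ?thesis by (auto simp: floor_eq_iff simp del: of_nat_Suc)
  qed
  then show ?thesis unfolding subcell_def half_box_def by (simp add: forall_2)
qed

lemma subcell_subset: "fst s \<le> n \<Longrightarrow> snd s \<le> n \<Longrightarrow> subcell p n s \<subseteq> cell p"
proof
  fix x assume s: "fst s \<le> n" "snd s \<le> n" and x: "x \<in> subcell p n s"
  have *: "p \<le> y \<and> y < p + 1" if a: "a \<le> n" "\<lfloor>real (Suc n) * (y - p)\<rfloor> = int a" for p y :: real and a
  proof -
    have "0 \<le> real (Suc n) * (y - p)" "real (Suc n) * (y - p) < real a + 1" using a(2) by linarith+
    moreover have "real a + 1 \<le> real (Suc n) * 1" using a(1) by simp
    ultimately have "0 \<le> real (Suc n) * (y - p)" "real (Suc n) * (y - p) < real (Suc n) * 1" by linarith+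
    then have "0 \<le> y - p" "y - p < 1"
      by (simp add: zero_le_mult_iff del: of_nat_Suc, blast intro: mult_left_less_imp_less of_nat_0_le_iff)
    then show ?thesis by linarith
  qed
  show "x \<in> cell p" unfolding cell_def using x s *[of "fst s" "x$1" "p$1"] *[of "snd s" "x$2" "p$2"]
    by (auto simp: mem_subcell forall_2)
qed

lemma cell_subcell:
  assumes "x \<in> cell p"
  shows "\<exists>s\<in>{..n} \<times> {..n}. x \<in> subcell p n s"
proof -
  have *: "\<exists>a\<le>n. \<lfloor>real (Suc n) * (y - p)\<rfloor> = int a" if "p \<le> y" "y < p + 1" for p y :: real
  proof (intro exI[of _ "nat \<lfloor>real (Suc n) * (y - p)\<rfloor>"] conjI)
    have "0 \<le> real (Suc n) * (y - p)" using that by simp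
    then show "\<lfloor>real (Suc n) * (y - p)\<rfloor> = int (nat \<lfloor>real (Suc n) * (y - p)\<rfloor>)" by simp
    define z where "z = real (Suc n) * (y - p)"
    have "z < real (Suc n) * 1" unfolding z_def using that by (intro mult_strict_left_mono) auto
    then have "\<lfloor>z\<rfloor> \<le> int n" by (simp add: floor_le_iff)
    then have "\<lfloor>real (Suc n) * (y - p)\<rfloor> \<le> int n" by (simp only: z_def)
    then show "nat \<lfloor>real (Suc n) * (y - p)\<rfloor> \<le> n" by (simp only: nat_le_iff)
  qed
  have "p$1 \<le> x$1" "x$1 < p$1 + 1" "p$2 \<le> x$2" "x$2 < p$2 + 1" using assms by (auto simp: cell_def)
  then obtain a b where "a \<le> n" "\<lfloor>real (Suc n) * (x$1 - p$1)\<rfloor> = int a" "b \<le> n" "\<lfloor>real (Suc n) * (x$2 - p$2)\<rfloor> = int b"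
    using *[of "p$1" "x$1"] *[of "p$2" "x$2"] by blast
  then show ?thesis by (intro bexI[of _ "(a, b)"]) (auto simp: mem_subcell)
qed

text \<open>The number of subcells that meet the zero set never exceeds the count, and it reaches
  the size of any finite set of zeros once the mesh separates its points. The count is thereby
  written through countably many existence statements, which are measurable.\<close>

lemma num_zeros_eq_SUP:
  "num_zeros k f (cell p) = (SUP n. \<Sum>s\<in>{..n} \<times> {..n}. indicator {s. \<exists>x\<in>subcell p n s. \<forall>m. spec_fun k f m x = 0} s)"
proof (rule antisym)
  define Z where "Z = {x\<in>cell p. \<forall>m. spec_fun k f m x = 0}"
  define T where "T n = {s\<in>{..n} \<times> {..n}. \<exists>x\<in>subcell p n s. \<forall>m. spec_fun k f m x = 0}" for n
  have sum: "(\<Sum>s\<in>{..n} \<times> {..n}. indicator {s. \<exists>x\<in>subcell p n s. \<forall>m. spec_fun k f m x = 0} s) = (of_nat (card (T n)) :: ennreal)" for n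
    unfolding T_def indicator_def by (simp add: sum.If_cases Collect_conj_eq)
  have finT: "finite (T n)" for n unfolding T_def by simp
  have up: "of_nat (card (T n)) \<le> num_zeros k f (cell p)" for n
  proof -
    have "\<exists>x. x \<in> subcell p n s \<and> (\<forall>m. spec_fun k f m x = 0)" if "s \<in> T n" for s using that by (auto simp: T_def)
    then obtain z where z: "\<And>s. s \<in> T n \<Longrightarrow> z s \<in> subcell p n s" "\<And>s m. s \<in> T n \<Longrightarrow> spec_fun k f m (z s) = 0" by metis
    have "inj_on z (T n)"
    proof (rule inj_onI)
      fix s t assume "s \<in> T n" "t \<in> T n" "z s = z t"
      then show "s = t" using z(1)[of s] z(1)[of t] by (simp add: mem_subcell prod_eq_iff)
    qed
    moreover have "z ` T n \<subseteq> Z"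
    proof (rule image_subsetI)
      fix s assume s: "s \<in> T n"
      then have "subcell p n s \<subseteq> cell p" by (intro subcell_subset) (auto simp: T_def)
      then show "z s \<in> Z" using z s unfolding Z_def by blast
    qed
    ultimately have "emeasure (count_space UNIV) (z ` T n) \<le> emeasure (count_space UNIV) Z" "card (z ` T n) = card (T n)"
      by (auto intro!: emeasure_mono card_image)
    then show ?thesis using finT[of n] by (simp add: num_zeros_def Z_def)
  qed
  then show "(SUP n. \<Sum>s\<in>{..n} \<times> {..n}. indicator {s. \<exists>x\<in>subcell p n s. \<forall>m. spec_fun k f m x = 0} s) \<le> num_zeros k f (cell p)"
    unfolding sum by (rule SUP_least)
  have low: "of_nat (card S) \<le> (SUP n. of_nat (card (T n)) :: ennreal)" if S: "finite S" "S \<subseteq> Z" for S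
  proof -
    obtain e where e: "e > 0" "\<And>x y. x \<in> S \<Longrightarrow> y \<in> S \<Longrightarrow> x \<noteq> y \<Longrightarrow> e \<le> dist x y"
      using finite_separation[OF S(1)] by blast
    \<comment> \<open>Two points in one subcell differ by less than \<open>1 / (n + 1)\<close> in
      each coordinate, hence have distance less than \<open>e\<close>.\<close>
    obtain n where n: "inverse (real (Suc n)) < e / 2" using reals_Archimedean[of "e / 2"] e(1) by auto
    have "\<exists>s. s \<in> {..n} \<times> {..n} \<and> x \<in> subcell p n s" if "x \<in> S" for x
      using cell_subcell[of x p n] that S(2) by (auto simp: Z_def)
    then obtain c where c: "\<And>x. x \<in> S \<Longrightarrow> c x \<in> {..n} \<times> {..n}" "\<And>x. x \<in> S \<Longrightarrow> x \<in> subcell p n (c x)" by metis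
    have "inj_on c S"
    proof (rule inj_onI, rule ccontr)
      fix x y assume xy: "x \<in> S" "y \<in> S" "c x = c y" "x \<noteq> y"
      have cl: "\<bar>a - b\<bar> < 1 / real (Suc n)" if "\<lfloor>real (Suc n) * (a - q)\<rfloor> = \<lfloor>real (Suc n) * (b - q)\<rfloor>" for a b q :: real
      proof -
        have "\<bar>real (Suc n) * (a - q) - real (Suc n) * (b - q)\<bar> < 1" using that by linarith
        moreover have "real (Suc n) * (a - q) - real (Suc n) * (b - q) = real (Suc n) * (a - b)" by (simp only: right_diff_distrib)
        ultimately have "real (Suc n) * \<bar>a - b\<bar> < 1" by (simp only: abs_mult abs_of_nat)
        then show ?thesis by (simp add: field_simps del: of_nat_Suc)
      qed
      have "dist x y \<le> \<bar>(x - y)$1\<bar> + \<bar>(x - y)$2\<bar>" unfolding dist_norm by (rule norm2_le)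
      also have "\<dots> < 1 / real (Suc n) + 1 / real (Suc n)"
        using cl[of "x$1" "p$1" "y$1"] cl[of "x$2" "p$2" "y$2"] c(2)[OF xy(1)] c(2)[OF xy(2)] xy(3)
        by (intro add_strict_mono) (auto simp: mem_subcell)
      also have "\<dots> < e" using n by (simp add: inverse_eq_divide)
      finally show False using e(2)[OF xy(1,2,4)] by simp
    qed
    moreover have "c ` S \<subseteq> T n" using c S(2) unfolding T_def Z_def by blast
    ultimately have "card S \<le> card (T n)" using card_inj_on_le finT by blast
    then have "of_nat (card S) \<le> (of_nat (card (T n)) :: ennreal)" by simp
    then show ?thesis by (rule order_trans) (rule SUP_upper, simp)
  qed
  show "num_zeros k f (cell p) \<le> (SUP n. \<Sum>s\<in>{..n} \<times> {..n}. indicator {s. \<exists>x\<in>subcell p n s. \<forall>m. spec_fun k f m x = 0} s)"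
    unfolding sum
  proof (cases "finite Z")
    case True
    then show "num_zeros k f (cell p) \<le> (SUP n. of_nat (card (T n)))" using low[OF True order_refl] by (simp add: num_zeros_def Z_def)
  next
    case False
    have "ennreal (real j) \<le> (SUP n. of_nat (card (T n)))" for j
    proof -
      from infinite_arbitrarily_large[OF False, of j] obtain S where S: "finite S" "S \<subseteq> Z" "card S = j" by (elim exE conjE)
      then show ?thesis using low[OF S(1,2)] by (simp add: ennreal_of_nat_eq_real_of_nat)
    qed
    then have "(SUP n. of_nat (card (T n)) :: ennreal) = \<top>" by (rule ennreal_top_if_ge_nat)
    then show "num_zeros k f (cell p) \<le> (SUP n. of_nat (card (T n)))" by (simp only: top_greatest)
  qed
qed

section \<open>Sigma-algebras generated by the gradient on a set\<close>

context gaussian_surface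
begin

text \<open>Countably many coordinates are allowed, matching the rectangles of
  \<open>gauss_space_indep\<close>; interleaving makes the family closed under intersection.\<close>

definition cyl :: "(real^2) set \<Rightarrow> 'a set set" where
  "cyl A = {S. \<exists>m y B. (\<forall>i::nat. y i \<in> A) \<and> (\<forall>i. B i \<in> sets borel) \<and> S = {\<omega>\<in>space M. \<forall>i. dW [m i] (y i) \<omega> \<in> B i}}"

definition obs :: "(real^2) set \<Rightarrow> 'a measure" where
  "obs A = sigma (space M) (cyl A)"

lemma cyl_events: "cyl A \<subseteq> events"
  unfolding cyl_def
proof safe
  fix m y and B :: "nat \<Rightarrow> real set" assume [rule_format, measurable]: "\<forall>i. B i \<in> sets borel"
  show "{\<omega>\<in>space M. \<forall>i. dW [m i] (y i) \<omega> \<in> B i} \<in> events" by measurable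
qed

lemma space_obs: "space (obs A) = space M" and sets_obs: "sets (obs A) = sigma_sets (space M) (cyl A)"
  using cyl_events[of A] sets.space_closed[of M] by (auto simp: obs_def space_measure_of_conv sets_measure_of)

lemma grad_obs: "y \<in> A \<Longrightarrow> dW [m] y \<in> borel_measurable (obs A)"
proof (rule measurableI)
  fix B :: "real set" assume "y \<in> A" "B \<in> sets borel"
  then have "dW [m] y -` B \<inter> space (obs A) \<in> cyl A"
    unfolding cyl_def space_obs by (intro CollectI exI[of _ "\<lambda>_. m"] exI[of _ "\<lambda>_. y"] exI[of _ "\<lambda>_. B"]) auto
  then show "dW [m] y -` B \<inter> space (obs A) \<in> sets (obs A)" by (auto simp: sets_obs)
qed simp

lemma Int_stable_cyl: "Int_stable (cyl A)"
proof (rule Int_stableI)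
  fix S S' assume "S \<in> cyl A" "S' \<in> cyl A"
  then obtain m y B m' y' B' where S: "\<And>i::nat. y i \<in> A" "\<And>i. B i \<in> sets borel" "S = {\<omega>\<in>space M. \<forall>i. dW [m i] (y i) \<omega> \<in> B i}"
    and S': "\<And>i::nat. y' i \<in> A" "\<And>i. B' i \<in> sets borel" "S' = {\<omega>\<in>space M. \<forall>i. dW [m' i] (y' i) \<omega> \<in> B' i}"
    unfolding cyl_def by blast
  have "S \<inter> S' = {\<omega>\<in>space M. \<forall>i. dW [fst (interleave (\<lambda>i. (m i, y i)) (\<lambda>i. (m' i, y' i)) i)] (snd (interleave (\<lambda>i. (m i, y i)) (\<lambda>i. (m' i, y' i)) i)) \<omega> \<in> interleave B B' i}"
    unfolding all_interleave[of "\<lambda>q b. dW [fst q] (snd q) \<omega> \<in> b" for \<omega>] S(3) S'(3) by auto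
  then show "S \<inter> S' \<in> cyl A"
    unfolding cyl_def mem_Collect_eq
    by (intro exI[of _ "\<lambda>i. fst (interleave (\<lambda>i. (m i, y i)) (\<lambda>i. (m' i, y' i)) i)"]
        exI[of _ "\<lambda>i. snd (interleave (\<lambda>i. (m i, y i)) (\<lambda>i. (m' i, y' i)) i)"] exI[of _ "interleave B B'"])
      (use S S' in \<open>auto simp: interleave_def\<close>)
qed

text \<open>Gradients at points farther apart than \<open>\<delta>\<close> are uncorrelated, so the
  cylinder events are independent; they generate and are closed under intersection.\<close>

lemma obs_indep:
  assumes \<delta>: "delta_dependent M W \<delta>" and far: "\<And>x y. x \<in> A \<Longrightarrow> y \<in> A' \<Longrightarrow> norm (x - y) > \<delta>"
  shows "indep_set (sets (obs A)) (sets (obs A'))"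
  unfolding sets_obs
proof (intro indep_set_sigma_sets indep_setI cyl_events Int_stable_cyl)
  fix S S' assume "S \<in> cyl A" "S' \<in> cyl A'"
  then obtain m y B m' y' B' where S: "\<And>i::nat. y i \<in> A" "\<And>i. B i \<in> sets borel" "S = {\<omega>\<in>space M. \<forall>i. dW [m i] (y i) \<omega> \<in> B i}"
    and S': "\<And>i::nat. y' i \<in> A'" "\<And>i. B' i \<in> sets borel" "S' = {\<omega>\<in>space M. \<forall>i. dW [m' i] (y' i) \<omega> \<in> B' i}"
    unfolding cyl_def by blast
  have "prob {\<omega>\<in>space M. \<forall>i. dW [m i] (y i) \<omega> \<in> B i \<and> dW [m' i] (y' i) \<omega> \<in> B' i} = prob S * prob S'"
    unfolding S(3) S'(3)
  proof (rule gauss_space_indep[OF GS])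
    fix i j show "expectation (\<lambda>\<omega>. dW [m i] (y i) \<omega> * dW [m' j] (y' j) \<omega>) = 0"
      using cov_far[OF \<delta>, of "[m i]" "[m' j]" "y i" "y' j"] far[OF S(1) S'(1)] by (simp add: cov_def)
  qed (auto intro: dW_in_Wspace S S')
  moreover have "{\<omega>\<in>space M. \<forall>i. dW [m i] (y i) \<omega> \<in> B i \<and> dW [m' i] (y' i) \<omega> \<in> B' i} = S \<inter> S'"
    unfolding S(3) S'(3) by auto
  ultimately show "prob (S \<inter> S') = prob S * prob S'" by simp
qed

text \<open>Existence of a zero is a countable combination of conditions on the gradient at dense
  points of the box, so the event is determined by the gradient on \<open>A\<close>.\<close>

lemma zero_half_box_obs:
  assumes lh: "\<And>i. l$i < h$i" and sub: "half_box l h \<subseteq> A"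
  shows "{\<omega>\<in>space (obs A). \<exists>x\<in>half_box l h. \<forall>m. spec_fun k (W \<omega>) m x = 0} \<in> sets (obs A)"
proof -
  define hn where "hn n = (\<chi> i. h$i - (h$i - l$i) / real (n + 2))" for n :: nat
  have hb: "half_box l h = (\<Union>n. cbox l (hn n))" unfolding hn_def by (rule half_box_eq_UN[OF lh])
  have lhn: "l$i < hn n $ i" for n i
  proof -
    have "(h$i - l$i) / real (n + 2) < (h$i - l$i) / 1" using lh[of i] by (intro divide_strict_left_mono) auto
    then show ?thesis unfolding hn_def by simp
  qed
  have eq: "{\<omega>\<in>space (obs A). \<exists>x\<in>half_box l h. \<forall>m. spec_fun k (W \<omega>) m x = 0}
     = (\<Union>n. \<Inter>j::nat. \<Union>d\<in>dense_pts \<inter> box l (hn n). {\<omega>\<in>space (obs A). \<bar>dW [1] d \<omega> - k * d$1\<bar> < 1 / real (Suc j) \<and> \<bar>dW [2] d \<omega> - k * d$2\<bar> < 1 / real (Suc j)})" (is "?L = ?R")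
  proof -
    have e: "(\<exists>x\<in>half_box l h. \<forall>m. spec_fun k (W \<omega>) m x = 0) \<longleftrightarrow>
      (\<exists>n. \<forall>j::nat. \<exists>d\<in>dense_pts \<inter> box l (hn n). \<bar>dW [1] d \<omega> - k * d$1\<bar> < 1 / real (Suc j) \<and> \<bar>dW [2] d \<omega> - k * d$2\<bar> < 1 / real (Suc j))"
      if "\<omega> \<in> space M" for \<omega>
    proof -
      have "(\<exists>x\<in>half_box l h. \<forall>m. spec_fun k (W \<omega>) m x = 0) \<longleftrightarrow> (\<exists>n. \<exists>x\<in>cbox l (hn n). \<forall>m. spec_fun k (W \<omega>) m x = 0)"
        unfolding hb by blast
      also have "\<dots> \<longleftrightarrow> (\<exists>n. \<forall>j::nat. \<exists>d\<in>dense_pts \<inter> box l (hn n). \<forall>m. \<bar>spec_fun k (W \<omega>) m d\<bar> < 1 / real (Suc j))"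
        by (intro ex_cong1 zero_in_cbox_iff lhn smooth that)
      finally show ?thesis by (simp only: forall_2 spec_fun_def dW_def)
    qed
    show ?thesis
    proof (intro set_eqI)
      fix \<omega>
      show "\<omega> \<in> ?L \<longleftrightarrow> \<omega> \<in> ?R"
        using e[of \<omega>] by (cases "\<omega> \<in> space M") (simp_all add: space_obs del: of_nat_Suc)
    qed
  qed
  show ?thesis
    unfolding eq
  proof (intro sets.countable_UN sets.countable_INT image_subsetI sets.countable_UN' countable_Int1 dense_pts(1))
    fix n j d assume "d \<in> dense_pts \<inter> box l (hn n)"
    then have "d \<in> half_box l h" unfolding hb using box_subset_cbox by blast
    then have [measurable]: "dW [m] d \<in> borel_measurable (obs A)" for m using sub by (intro grad_obs) auto
    show "{\<omega>\<in>space (obs A). \<bar>dW [1] d \<omega> - k * d$1\<bar> < 1 / real (Suc j) \<and> \<bar>dW [2] d \<omega> - k * d$2\<bar> < 1 / real (Suc j)} \<in> sets (obs A)"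
      by measurable
  qed auto
qed

lemma num_zeros_obs: "(\<lambda>\<omega>. num_zeros k (W \<omega>) (cell p)) \<in> borel_measurable (obs (cell p))"
  unfolding num_zeros_eq_SUP
proof (intro borel_measurable_SUP borel_measurable_sum)
  fix n :: nat and s :: "nat \<times> nat" assume s: "s \<in> {..n} \<times> {..n}"
  let ?S = "{\<omega>\<in>space (obs (cell p)). \<exists>x\<in>subcell p n s. \<forall>m. spec_fun k (W \<omega>) m x = 0}"
  have "?S \<in> sets (obs (cell p))"
    using subcell_subset[of s n p] s unfolding subcell_def by (intro zero_half_box_obs) (auto simp: divide_strict_right_mono)
  then have "(indicator ?S :: 'a \<Rightarrow> ennreal) \<in> borel_measurable (obs (cell p))" by simp
  then show "(\<lambda>\<omega>. indicator {s. \<exists>x\<in>subcell p n s. \<forall>m. spec_fun k (W \<omega>) m x = 0} s :: ennreal) \<in> borel_measurable (obs (cell p))"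
    by (rule measurable_cong[THEN iffD1, rotated]) (auto simp: indicator_def)
qed auto

lemma obs_subalgebra: "f \<in> measurable (obs A) N \<Longrightarrow> f \<in> measurable M N"
proof (erule measurable_mono[THEN subsetD, rotated -1])
  show "sets (obs A) \<subseteq> sets M" unfolding sets_obs by (rule sets.sigma_sets_subset[OF cyl_events])
qed (auto simp: space_obs)

lemma num_zeros_measurable[measurable]: "(\<lambda>\<omega>. num_zeros k (W \<omega>) (cell p)) \<in> borel_measurable M"
  by (rule obs_subalgebra[OF num_zeros_obs])

text \<open>Each count is a function of the gradient on its own cell. In the extended reals the
  product formula is meaningful for counts that may be infinite.\<close>

lemma num_zeros_indep:
  assumes \<delta>: "delta_dependent M W \<delta>" and far: "\<And>x y. x \<in> cell p \<Longrightarrow> y \<in> cell q \<Longrightarrow> norm (x - y) > \<delta>"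
  shows "(\<integral>\<^sup>+\<omega>. num_zeros k (W \<omega>) (cell p) * num_zeros k (W \<omega>) (cell q) \<partial>M)
    = (\<integral>\<^sup>+\<omega>. num_zeros k (W \<omega>) (cell p) \<partial>M) * (\<integral>\<^sup>+\<omega>. num_zeros k (W \<omega>) (cell q) \<partial>M)"
proof -
  let ?X = "\<lambda>\<omega>. num_zeros k (W \<omega>) (cell p)" and ?Y = "\<lambda>\<omega>. num_zeros k (W \<omega>) (cell q)"
  have sub: "sigma_sets (space M) {(\<lambda>\<omega>. num_zeros k (W \<omega>) (cell r)) -` B \<inter> space M |B. B \<in> sets borel} \<subseteq> sets (obs (cell r))" for r
    using sets.sigma_sets_subset[of "{(\<lambda>\<omega>. num_zeros k (W \<omega>) (cell r)) -` B \<inter> space M |B. B \<in> sets borel}" "obs (cell r)"]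
      measurable_sets[OF num_zeros_obs] by (auto simp: space_obs)
  have "indep_set (sets (obs (cell p))) (sets (obs (cell q)))"
    by (rule obs_indep[OF \<delta> far])
  then have "indep_set (sigma_sets (space M) {?X -` B \<inter> space M |B. B \<in> sets borel}) (sigma_sets (space M) {?Y -` B \<inter> space M |B. B \<in> sets borel})"
    unfolding indep_set_def by (rule indep_sets_mono_sets) (use sub in \<open>auto split: bool.split\<close>)
  then have "indep_var borel ?X borel ?Y" unfolding indep_var_eq by (intro conjI num_zeros_measurable)
  \<comment> \<open>\<open>indep_var\<close> carries a case distinction between the two target
    spaces, both of which are \<open>borel\<close>.\<close>
  then have iv: "indep_vars (\<lambda>_. borel) (case_bool ?X ?Y) UNIV"
    unfolding indep_var_def by (rule back_subst[of "\<lambda>N. indep_vars N _ _"]) (auto split: bool.split)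
  show ?thesis using indep_vars_nn_integral[OF _ iv] by (simp add: UNIV_bool mult.commute)
qed

end

section \<open>Summation over the cells\<close>

lemma ennreal_mult_le_sq_sum: "(x::ennreal) * y \<le> x\<^sup>2 + y\<^sup>2"
proof (cases "x \<le> y")
  case True
  then have "x * y \<le> y * y" by (rule mult_right_mono) simp
  then show ?thesis by (simp add: power2_eq_square add_increasing)
next
  case False
  then have "x * y \<le> x * x" by (intro mult_left_mono) auto
  then show ?thesis by (simp add: power2_eq_square add_increasing2)
qed

lemma borel_measurable_nn_integral_countable:
  fixes f :: "'i::countable \<Rightarrow> 'a \<Rightarrow> ennreal"
  assumes "\<And>i. f i \<in> borel_measurable M"
  shows "(\<lambda>\<omega>. \<integral>\<^sup>+i. f i \<omega> \<partial>count_space UNIV) \<in> borel_measurable M"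
proof -
  interpret sigma_finite_measure "count_space (UNIV :: 'i set)"
    by (rule sigma_finite_measure_count_space)
  have "case_prod (\<lambda>\<omega> i. f i \<omega>) \<in> borel_measurable (M \<Otimes>\<^sub>M count_space UNIV)"
    using measurable_pair_swap[OF measurable_pair_measure_countable1[of UNIV "case_prod f" M borel]] assms
    by (auto simp: case_prod_beta)
  then show ?thesis by (rule borel_measurable_nn_integral)
qed

text \<open>The integer 0 is counted in both sums, which an upper bound tolerates.\<close>

lemma nn_integral_int_le:
  fixes f :: "int \<Rightarrow> ennreal"
  shows "(\<integral>\<^sup>+a. f a \<partial>count_space UNIV) \<le> (\<Sum>n. f (int n)) + (\<Sum>n. f (- int n))"
proof -
  have b: "(\<integral>\<^sup>+a. f a * indicator (range g) a \<partial>count_space UNIV) = (\<Sum>n. f (g n))" if "inj g" for g :: "nat \<Rightarrow> int"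
  proof -
    have "(\<integral>\<^sup>+a. f a * indicator (range g) a \<partial>count_space UNIV) = (\<integral>\<^sup>+a. f a \<partial>count_space (range g))"
      by (simp add: nn_integral_count_space_indicator)
    also have "\<dots> = (\<integral>\<^sup>+n. f (g n) \<partial>count_space UNIV)"
      by (rule nn_integral_bij_count_space[symmetric]) (use that in \<open>simp add: bij_betw_def\<close>)
    finally show ?thesis by (simp add: nn_integral_count_space_nat)
  qed
  have "(\<integral>\<^sup>+a. f a \<partial>count_space UNIV) \<le> (\<integral>\<^sup>+a. f a * indicator (range int) a + f a * indicator (range (\<lambda>n. - int n)) a \<partial>count_space UNIV)"
  proof (rule nn_integral_mono)
    fix a :: int
    have "a \<in> range int \<or> a \<in> range (\<lambda>n. - int n)" by (cases a rule: int_cases2) auto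
    then show "f a \<le> f a * indicator (range int) a + f a * indicator (range (\<lambda>n. - int n)) a"
      by (auto simp: indicator_def)
  qed
  also have "\<dots> = (\<Sum>n. f (int n)) + (\<Sum>n. f (- int n))"
    by (simp add: nn_integral_add b inj_def)
  finally show ?thesis .
qed

text \<open>Two geometric series of ratio \<open>q = exp (- k)\<close>, where
  \<open>1 - q \<ge> k / 2\<close> for \<open>k \<le> 1\<close>.\<close>

lemma sum_exp_int_le:
  assumes k: "0 < k" "k \<le> 1"
  shows "(\<integral>\<^sup>+a. ennreal (exp (- k * \<bar>real_of_int a\<bar>)) \<partial>count_space UNIV) \<le> ennreal (4 / k)"
proof -
  define q where "q = exp (- k)"
  have q: "0 < q" "q < 1" unfolding q_def using k by auto
  have "1 + k \<le> exp k" by (rule exp_ge_add_one_self)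
  then have "q \<le> 1 / (1 + k)" unfolding q_def exp_minus using k by (simp add: inverse_eq_divide frac_le)
  also have "\<dots> \<le> 1 - k / 2"
  proof -
    have "k * k \<le> k" using mult_left_mono[OF k(2), of k] k by simp
    then have "1 \<le> (1 - k / 2) * (1 + k)" by (simp add: algebra_simps)
    then show ?thesis using k by (simp add: pos_divide_le_eq)
  qed
  finally have qk: "k / 2 \<le> 1 - q" by simp
  have e: "exp (- k * \<bar>real_of_int (int n)\<bar>) = q ^ n" "exp (- k * \<bar>real_of_int (- int n)\<bar>) = q ^ n" for n
    unfolding q_def by (simp_all add: exp_of_nat_mult[symmetric] mult.commute)
  have g: "(\<Sum>n. ennreal (q ^ n)) = ennreal (1 / (1 - q))"
    using q by (subst suminf_ennreal2) (auto intro: summable_geometric simp: suminf_geometric)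
  have "(\<integral>\<^sup>+a. ennreal (exp (- k * \<bar>real_of_int a\<bar>)) \<partial>count_space UNIV) \<le> ennreal (1 / (1 - q)) + ennreal (1 / (1 - q))"
    using nn_integral_int_le[of "\<lambda>a. ennreal (exp (- k * \<bar>real_of_int a\<bar>))"] unfolding e g .
  also have "\<dots> = ennreal (2 / (1 - q))" using q by (simp add: ennreal_plus[symmetric] del: ennreal_plus)
  also have "\<dots> \<le> ennreal (4 / k)"
  proof (rule ennreal_leI)
    have "2 / (1 - q) \<le> 2 / (k / 2)" using qk k q by (intro divide_left_mono) auto
    then show "2 / (1 - q) \<le> 4 / k" by simp
  qed
  finally show ?thesis .
qed

definition lattice_pt :: "int \<times> int \<Rightarrow> real^2" where
  "lattice_pt s = (\<chi> j. of_int (if j = 1 then fst s else snd s))"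

lemma mem_lattice_cell: "x \<in> cell (lattice_pt s) \<longleftrightarrow> \<lfloor>x$1\<rfloor> = fst s \<and> \<lfloor>x$2\<rfloor> = snd s"
  by (auto simp: cell_def lattice_pt_def forall_2 floor_eq_iff)

lemma num_zeros_lattice:
  "num_zeros k f UNIV = (\<integral>\<^sup>+s. num_zeros k f (cell (lattice_pt s)) \<partial>count_space UNIV)"
proof -
  let ?Z = "\<lambda>s. {x\<in>cell (lattice_pt s). \<forall>m. spec_fun k f m x = 0}"
  have "{x. \<forall>m. spec_fun k f m x = 0} = (\<Union>s. ?Z s)"
    by (auto simp: mem_lattice_cell)
  moreover have "emeasure (count_space UNIV) (\<Union>s. ?Z s) = (\<integral>\<^sup>+s. emeasure (count_space UNIV) (?Z s) \<partial>count_space UNIV)"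
    by (rule emeasure_UN_countable) (auto simp: disjoint_family_on_def mem_lattice_cell prod_eq_iff)
  ultimately show ?thesis unfolding num_zeros_def by simp
qed

section \<open>Near and far pairs of cells\<close>

definition near_pairs :: "int \<Rightarrow> ((int \<times> int) \<times> (int \<times> int)) set" where
  "near_pairs R = {(s, t). \<bar>fst s - fst t\<bar> \<le> R \<and> \<bar>snd s - snd t\<bar> \<le> R}"

lemma near_pairs_sym: "(s, t) \<in> near_pairs R \<longleftrightarrow> (t, s) \<in> near_pairs R"
  by (auto simp: near_pairs_def abs_minus_commute)

lemma near_pairs_count:
  assumes "R \<ge> 0"
  shows "(\<integral>\<^sup>+t. indicator (near_pairs R) (s, t) \<partial>count_space UNIV) = ennreal ((real_of_int (2 * R + 1))\<^sup>2)"
proof -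
  let ?B = "{fst s - R..fst s + R} \<times> {snd s - R..snd s + R}"
  have "(\<integral>\<^sup>+t. indicator (near_pairs R) (s, t) \<partial>count_space UNIV) = (\<integral>\<^sup>+t. indicator ?B t \<partial>count_space UNIV)"
    by (intro nn_integral_cong) (auto simp: indicator_def near_pairs_def abs_le_iff)
  also have "\<dots> = of_nat (card ?B)" by simp
  also have "card ?B = nat (2 * R + 1) * nat (2 * R + 1)" by (simp add: card_cartesian_product algebra_simps)
  also have "(of_nat (nat (2 * R + 1) * nat (2 * R + 1)) :: ennreal) = ennreal ((real_of_int (2 * R + 1))\<^sup>2)"
    using assms by (subst ennreal_of_nat_eq_real_of_nat) (simp add: power2_eq_square)
  finally show ?thesis .
qed

text \<open>Integer parts that differ by more than the integer \<open>R\<close> differ by at least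
  \<open>R + 1\<close>, so the coordinates themselves differ by more than \<open>R\<close>.\<close>

lemma far_cells:
  assumes "\<delta> \<le> real_of_int R" "(s, t) \<notin> near_pairs R" "x \<in> cell (lattice_pt s)" "y \<in> cell (lattice_pt t)"
  shows "norm (x - y) > \<delta>"
proof -
  have *: "\<bar>a - b\<bar> > real_of_int R" if "\<bar>\<lfloor>a\<rfloor> - \<lfloor>b\<rfloor>\<bar> > R" for a b :: real
  proof -
    have "\<bar>\<lfloor>a\<rfloor> - \<lfloor>b\<rfloor>\<bar> \<ge> R + 1" using that by simp
    then have "\<bar>real_of_int \<lfloor>a\<rfloor> - real_of_int \<lfloor>b\<rfloor>\<bar> \<ge> real_of_int R + 1" by linarith
    then show ?thesis by linarith
  qed
  have "\<exists>i. \<bar>(x - y)$i\<bar> > real_of_int R"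
    using assms(2-4) *[of "x$1" "y$1"] *[of "x$2" "y$2"] by (auto simp: near_pairs_def mem_lattice_cell not_le)
  then obtain i where "\<bar>(x - y)$i\<bar> > real_of_int R" by blast
  then show ?thesis using assms(1) component_le_norm_cart[of "x - y" i] by linarith
qed

context nondegenerate_surface
begin

text \<open>The count is a natural number or infinite, so it is at most its square; this yields
  first moments from second moments.\<close>

lemma num_zeros_le_sq: "num_zeros k f A \<le> (num_zeros k f A)\<^sup>2"
proof -
  let ?Z = "{x\<in>A. \<forall>m. spec_fun k f m x = 0}"
  show ?thesis
  proof (cases "finite ?Z")
    case True
    have "real (card ?Z) \<le> (real (card ?Z))\<^sup>2" by (cases "card ?Z = 0") (auto simp: power2_eq_square)
    then show ?thesis using True
      by (simp add: num_zeros_def ennreal_of_nat_eq_real_of_nat ennreal_power ennreal_leI)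
  next
    case False
    then show ?thesis by (simp add: num_zeros_def power2_eq_square)
  qed
qed

text \<open>The variance bound is phrased as an upper bound on the second moment, so that no
  difference of extended reals appears. In the double sum over cells the far pairs contribute at
  most the square of the mean, and each cell has \<open>(2 * R + 1)\<^sup>2\<close> near
  partners.\<close>

lemma num_zeros_total_moment:
  assumes \<delta>: "delta_dependent M W \<delta>"
  shows "\<exists>D>0. \<forall>k. 0 < k \<longrightarrow> k \<le> 1 \<longrightarrow>
    (\<integral>\<^sup>+\<omega>. num_zeros k (W \<omega>) UNIV \<partial>M) < \<top> \<and>
    (\<integral>\<^sup>+\<omega>. (num_zeros k (W \<omega>) UNIV)\<^sup>2 \<partial>M) \<le> ennreal (D / k\<^sup>2) + (\<integral>\<^sup>+\<omega>. num_zeros k (W \<omega>) UNIV \<partial>M)\<^sup>2"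
proof -
  obtain C where C: "C > 0" "\<And>k p. 0 < k \<Longrightarrow> k \<le> 1 \<Longrightarrow>
     (\<integral>\<^sup>+\<omega>. (num_zeros k (W \<omega>) (cell p))\<^sup>2 \<partial>M) \<le> ennreal (C * exp (- k * (\<bar>p$1\<bar> + \<bar>p$2\<bar>)))"
    using num_zeros_second_moment by blast
  \<comment> \<open>The range \<open>\<delta>\<close> is rounded up to a nonnegative integer number
    of cells.\<close>
  define R where "R = \<lceil>\<bar>\<delta>\<bar>\<rceil>"
  have R: "R \<ge> 0" "\<delta> \<le> real_of_int R" unfolding R_def by (simp_all add: ceiling_le_iff) linarith+
  define B where "B = (real_of_int (2 * R + 1))\<^sup>2"
  have B: "B > 0" unfolding B_def using R(1) by (simp add: add_nonneg_pos)
  show ?thesis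
  \<comment> \<open>16 is the product of the constants 4 of the geometric sums in the two
    coordinates, \<open>B\<close> counts the near partners, and 2 comes from the two terms of
    \<open>e s + e t\<close>.\<close>
  proof (intro exI[of _ "2 * B * (16 * C)"] allI impI conjI)
    show "0 < 2 * B * (16 * C)" using B C(1) by simp
  next
    fix k :: real assume k: "0 < k" "k \<le> 1"
    let ?cs = "count_space (UNIV :: (int \<times> int) set)"
    define X where "X s \<omega> = num_zeros k (W \<omega>) (cell (lattice_pt s))" for s \<omega>
    have Xm[measurable]: "X s \<in> borel_measurable M" for s unfolding X_def[abs_def] by measurable
    define e where "e s = (\<integral>\<^sup>+\<omega>. (X s \<omega>)\<^sup>2 \<partial>M)" for s
    define m where "m s = (\<integral>\<^sup>+\<omega>. X s \<omega> \<partial>M)" for s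
    have tot: "num_zeros k (W \<omega>) UNIV = (\<integral>\<^sup>+s. X s \<omega> \<partial>?cs)" for \<omega>
      unfolding X_def by (rule num_zeros_lattice)
    have sume: "(\<integral>\<^sup>+s. e s \<partial>?cs) \<le> ennreal (16 * C / k\<^sup>2)"
    proof -
      let ?h = "\<lambda>a::int. ennreal (exp (- k * \<bar>real_of_int a\<bar>))"
      have "(\<integral>\<^sup>+s. e s \<partial>?cs) \<le> (\<integral>\<^sup>+s. ennreal C * (?h (fst s) * ?h (snd s)) \<partial>?cs)"
      proof (rule nn_integral_mono)
        fix s
        have "e s \<le> ennreal (C * exp (- k * (\<bar>lattice_pt s$1\<bar> + \<bar>lattice_pt s$2\<bar>)))"
          unfolding e_def X_def by (rule C(2)[OF k])
        also have "C * exp (- k * (\<bar>lattice_pt s$1\<bar> + \<bar>lattice_pt s$2\<bar>)) = C * (exp (- k * \<bar>real_of_int (fst s)\<bar>) * exp (- k * \<bar>real_of_int (snd s)\<bar>))"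
          by (simp add: lattice_pt_def exp_add[symmetric] algebra_simps)
        also have "ennreal \<dots> = ennreal C * (?h (fst s) * ?h (snd s))" using C(1) by (simp add: ennreal_mult)
        finally show "e s \<le> ennreal C * (?h (fst s) * ?h (snd s))" .
      qed
      also have "\<dots> = ennreal C * (\<integral>\<^sup>+s. ?h (fst s) * ?h (snd s) \<partial>?cs)" by (rule nn_integral_cmult) simp
      also have "(\<integral>\<^sup>+s. ?h (fst s) * ?h (snd s) \<partial>?cs) = (\<integral>\<^sup>+a. \<integral>\<^sup>+b. ?h a * ?h b \<partial>count_space UNIV \<partial>count_space UNIV)"
        by (subst nn_integral_fst_count_space[symmetric]) simp
      also have "\<dots> = (\<integral>\<^sup>+a. ?h a \<partial>count_space UNIV) * (\<integral>\<^sup>+a. ?h a \<partial>count_space UNIV)"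
        by (simp add: nn_integral_cmult nn_integral_multc)
      also have "ennreal C * \<dots> \<le> ennreal C * (ennreal (4 / k) * ennreal (4 / k))"
        by (intro mult_left_mono mult_mono sum_exp_int_le k) auto
      also have "\<dots> = ennreal (16 * C / k\<^sup>2)"
        using C(1) k by (simp add: ennreal_mult[symmetric] power2_eq_square)
      finally show ?thesis .
    qed
    have EN: "(\<integral>\<^sup>+\<omega>. num_zeros k (W \<omega>) UNIV \<partial>M) = (\<integral>\<^sup>+s. m s \<partial>?cs)"
      unfolding tot m_def by (rule nn_integral_count_space_nn_integral) auto
    have "(\<integral>\<^sup>+s. m s \<partial>?cs) \<le> (\<integral>\<^sup>+s. e s \<partial>?cs)"
      unfolding m_def e_def X_def by (intro nn_integral_mono num_zeros_le_sq)
    then have mfin: "(\<integral>\<^sup>+s. m s \<partial>?cs) < \<top>" using sume by (meson ennreal_less_top le_less_trans)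
    then show "(\<integral>\<^sup>+\<omega>. num_zeros k (W \<omega>) UNIV \<partial>M) < \<top>" unfolding EN .
    have pair: "(\<integral>\<^sup>+\<omega>. X s \<omega> * X t \<omega> \<partial>M) \<le> indicator (near_pairs R) (s, t) * (e s + e t) + m s * m t" for s t
    proof (cases "(s, t) \<in> near_pairs R")
      case True
      have "(\<integral>\<^sup>+\<omega>. X s \<omega> * X t \<omega> \<partial>M) \<le> (\<integral>\<^sup>+\<omega>. (X s \<omega>)\<^sup>2 + (X t \<omega>)\<^sup>2 \<partial>M)"
        by (intro nn_integral_mono ennreal_mult_le_sq_sum)
      also have "\<dots> = e s + e t" unfolding e_def by (rule nn_integral_add) auto
      finally show ?thesis using True by (simp add: add_increasing2)
    next
      case False
      have "(\<integral>\<^sup>+\<omega>. X s \<omega> * X t \<omega> \<partial>M) = m s * m t"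
        unfolding X_def m_def by (rule num_zeros_indep[OF \<delta> far_cells[OF R(2) False]])
      then show ?thesis by simp
    qed
    have "(\<integral>\<^sup>+\<omega>. (num_zeros k (W \<omega>) UNIV)\<^sup>2 \<partial>M) = (\<integral>\<^sup>+\<omega>. \<integral>\<^sup>+s. \<integral>\<^sup>+t. X s \<omega> * X t \<omega> \<partial>?cs \<partial>?cs \<partial>M)"
      unfolding tot power2_eq_square by (simp add: nn_integral_cmult nn_integral_multc)
    also have "\<dots> = (\<integral>\<^sup>+s. \<integral>\<^sup>+\<omega>. \<integral>\<^sup>+t. X s \<omega> * X t \<omega> \<partial>?cs \<partial>M \<partial>?cs)"
    proof (rule nn_integral_count_space_nn_integral)
      fix s
      have t: "(\<lambda>\<omega>. \<integral>\<^sup>+t. X t \<omega> \<partial>?cs) \<in> borel_measurable M"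
        by (rule borel_measurable_nn_integral_countable) auto
      show "(\<lambda>\<omega>. \<integral>\<^sup>+t. X s \<omega> * X t \<omega> \<partial>?cs) \<in> borel_measurable M"
        using t by (simp add: nn_integral_cmult)
    qed simp
    also have "\<dots> = (\<integral>\<^sup>+s. \<integral>\<^sup>+t. \<integral>\<^sup>+\<omega>. X s \<omega> * X t \<omega> \<partial>M \<partial>?cs \<partial>?cs)"
      by (intro nn_integral_cong nn_integral_count_space_nn_integral) auto
    also have "\<dots> \<le> (\<integral>\<^sup>+s. \<integral>\<^sup>+t. indicator (near_pairs R) (s, t) * (e s + e t) + m s * m t \<partial>?cs \<partial>?cs)"
      by (intro nn_integral_mono pair)
    also have "\<dots> = (\<integral>\<^sup>+s. \<integral>\<^sup>+t. indicator (near_pairs R) (s, t) * e s \<partial>?cs \<partial>?cs)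
        + (\<integral>\<^sup>+s. \<integral>\<^sup>+t. indicator (near_pairs R) (s, t) * e t \<partial>?cs \<partial>?cs) + (\<integral>\<^sup>+s. \<integral>\<^sup>+t. m s * m t \<partial>?cs \<partial>?cs)"
      by (simp add: distrib_left nn_integral_add)
    also have "(\<integral>\<^sup>+s. \<integral>\<^sup>+t. m s * m t \<partial>?cs \<partial>?cs) = (\<integral>\<^sup>+s. m s \<partial>?cs)\<^sup>2"
      by (simp add: nn_integral_cmult nn_integral_multc power2_eq_square)
    \<comment> \<open>Exchanging \<open>s\<close> and \<open>t\<close> turns this term into the
      other one, nearness being symmetric.\<close>
    also have "(\<integral>\<^sup>+s. \<integral>\<^sup>+t. indicator (near_pairs R) (s, t) * e t \<partial>?cs \<partial>?cs) = (\<integral>\<^sup>+t. \<integral>\<^sup>+s. indicator (near_pairs R) (s, t) * e t \<partial>?cs \<partial>?cs)"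
      by (rule nn_integral_count_space_nn_integral) auto
    also have "\<dots> = (\<integral>\<^sup>+s. \<integral>\<^sup>+t. indicator (near_pairs R) (s, t) * e s \<partial>?cs \<partial>?cs)"
      by (simp add: indicator_def near_pairs_sym)
    also have "(\<integral>\<^sup>+s. \<integral>\<^sup>+t. indicator (near_pairs R) (s, t) * e s \<partial>?cs \<partial>?cs) = ennreal B * (\<integral>\<^sup>+s. e s \<partial>?cs)"
      by (simp add: nn_integral_multc near_pairs_count[OF R(1)] nn_integral_cmult B_def)
    also have "ennreal B * (\<integral>\<^sup>+s. e s \<partial>?cs) + ennreal B * (\<integral>\<^sup>+s. e s \<partial>?cs) + (\<integral>\<^sup>+s. m s \<partial>?cs)\<^sup>2
       \<le> ennreal B * ennreal (16 * C / k\<^sup>2) + ennreal B * ennreal (16 * C / k\<^sup>2) + (\<integral>\<^sup>+s. m s \<partial>?cs)\<^sup>2"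
      by (intro add_mono mult_left_mono sume) auto
    also have "ennreal B * ennreal (16 * C / k\<^sup>2) + ennreal B * ennreal (16 * C / k\<^sup>2) = ennreal (2 * B * (16 * C) / k\<^sup>2)"
      using B C(1) by (simp add: ennreal_mult[symmetric] ennreal_plus[symmetric] del: ennreal_plus)
    finally show "(\<integral>\<^sup>+\<omega>. (num_zeros k (W \<omega>) UNIV)\<^sup>2 \<partial>M) \<le> ennreal (2 * B * (16 * C) / k\<^sup>2) + (\<integral>\<^sup>+\<omega>. num_zeros k (W \<omega>) UNIV \<partial>M)\<^sup>2"
      unfolding EN .
  qed
qed

lemma num_zeros_UNIV_measurable[measurable]: "(\<lambda>\<omega>. num_zeros k (W \<omega>) UNIV) \<in> borel_measurable M"
  unfolding num_zeros_lattice by (rule borel_measurable_nn_integral_countable) auto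

lemma SP2_num_zeros:
  "num_zeros k (W \<omega>) UNIV = emeasure (count_space UNIV) (SP2 W k \<omega>)"
proof -
  have "{x\<in>UNIV. \<forall>m. spec_fun k (W \<omega>) m x = 0} = SP2 W k \<omega>"
    by (auto simp: SP2_def spec_fun_def grad_def vec_eq_iff)
  then show ?thesis by (simp add: num_zeros_def)
qed

end

theorem theorem10:
  fixes M :: "'a measure" and W :: "'a \<Rightarrow> real^2 \<Rightarrow> real" and \<delta> :: real
  assumes "prob_space M"
    and "centered_gaussian_field M W"
    and "stationary_field M W"
    and "\<forall>\<omega>\<in>space M. Ck 3 (W \<omega>)"
    and "invertible (covmat M (\<lambda>\<omega>. grad (W \<omega>) 0))"
    and "\<exists>m>0. \<forall>z::real^2. norm z = 1 \<longrightarrow>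
           det (covmat M (\<lambda>\<omega>. hess (W \<omega>) 0 *v z)) \<ge> m"
    and "\<delta> > 0" and "delta_dependent M W \<delta>"
  shows "\<exists>L>0. \<exists>k0>0. \<forall>k. 0 < k \<and> k < k0 \<longrightarrow>
           (AE \<omega> in M. finite (SP2 W k \<omega>)) \<and>
           integrable M (\<lambda>\<omega>. (real (card (SP2 W k \<omega>)))\<^sup>2) \<and>
           (\<integral>\<omega>. (real (card (SP2 W k \<omega>)) - (\<integral>\<omega>'. real (card (SP2 W k \<omega>')) \<partial>M))\<^sup>2 \<partial>M)
             \<le> L / k\<^sup>2"
proof -
  interpret nondegenerate_surface M W
    using assms by (intro nondegenerate_surface.intro gaussian_surface.intro gaussian_surface_axioms.intro
      nondegenerate_surface_axioms.intro) auto
  obtain D where D: "D > 0" "\<And>k. 0 < k \<Longrightarrow> k \<le> 1 \<Longrightarrow> (\<integral>\<^sup>+\<omega>. num_zeros k (W \<omega>) UNIV \<partial>M) < \<top>"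
    "\<And>k. 0 < k \<Longrightarrow> k \<le> 1 \<Longrightarrow>
    (\<integral>\<^sup>+\<omega>. (num_zeros k (W \<omega>) UNIV)\<^sup>2 \<partial>M) \<le> ennreal (D / k\<^sup>2) + (\<integral>\<^sup>+\<omega>. num_zeros k (W \<omega>) UNIV \<partial>M)\<^sup>2"
    using num_zeros_total_moment[OF assms(8)] by blast
  have main: "(AE \<omega> in M. finite (SP2 W k \<omega>)) \<and>
           integrable M (\<lambda>\<omega>. (real (card (SP2 W k \<omega>)))\<^sup>2) \<and>
           (\<integral>\<omega>. (real (card (SP2 W k \<omega>)) - (\<integral>\<omega>'. real (card (SP2 W k \<omega>')) \<partial>M))\<^sup>2 \<partial>M)
             \<le> D / k\<^sup>2" if k: "0 < k" "k < 1" for k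
  proof -
    let ?N = "\<lambda>\<omega>. num_zeros k (W \<omega>) UNIV" and ?c = "\<lambda>\<omega>. real (card (SP2 W k \<omega>))"
    \<comment> \<open>The conventions agree on infinite sets: \<open>card\<close> gives 0, and so
      does \<open>enn2real\<close> of \<open>\<infinity>\<close>.\<close>
    have c: "?c \<omega> = enn2real (?N \<omega>)" for \<omega>
      unfolding SP2_num_zeros by (cases "finite (SP2 W k \<omega>)") (auto simp: ennreal_of_nat_eq_real_of_nat)
    have [measurable]: "?c \<in> borel_measurable M" unfolding c by measurable
    have "AE \<omega> in M. ?N \<omega> \<noteq> \<infinity>"
      using D(2)[of k] k by (intro nn_integral_PInf_AE) auto
    then have fin: "AE \<omega> in M. finite (SP2 W k \<omega>)"
      by eventually_elim (auto simp: SP2_num_zeros emeasure_count_space split: if_splits)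
    then have Nc: "AE \<omega> in M. ?N \<omega> = ennreal (?c \<omega>)"
      by eventually_elim (simp add: SP2_num_zeros ennreal_of_nat_eq_real_of_nat)
    have Nc2: "AE \<omega> in M. (?N \<omega>)\<^sup>2 = ennreal ((?c \<omega>)\<^sup>2)"
      using Nc by eventually_elim (simp add: ennreal_power)
    have EN: "(\<integral>\<^sup>+\<omega>. ?N \<omega> \<partial>M) = (\<integral>\<^sup>+\<omega>. ennreal (?c \<omega>) \<partial>M)" using Nc by (rule nn_integral_cong_AE)
    have EN2: "(\<integral>\<^sup>+\<omega>. (?N \<omega>)\<^sup>2 \<partial>M) = (\<integral>\<^sup>+\<omega>. ennreal ((?c \<omega>)\<^sup>2) \<partial>M)" using Nc2 by (rule nn_integral_cong_AE)
    have i1: "integrable M ?c" using D(2)[of k] k unfolding EN by (intro integrableI_nonneg) auto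
    have e1: "(\<integral>\<^sup>+\<omega>. ennreal (?c \<omega>) \<partial>M) = ennreal (expectation ?c)" using i1 by (intro nn_integral_eq_integral) auto
    have E0: "expectation ?c \<ge> 0" by (intro Bochner_Integration.integral_nonneg) auto
    \<comment> \<open>The mean is finite by now, so the comparison can move to the reals, where
      subtracting its square gives the variance.\<close>
    have le: "(\<integral>\<^sup>+\<omega>. ennreal ((?c \<omega>)\<^sup>2) \<partial>M) \<le> ennreal (D / k\<^sup>2 + (expectation ?c)\<^sup>2)"
      using D(3)[of k] k D(1) E0 unfolding EN EN2 e1 by (simp add: ennreal_power ennreal_plus[symmetric] del: ennreal_plus)
    then have "(\<integral>\<^sup>+\<omega>. ennreal ((?c \<omega>)\<^sup>2) \<partial>M) < \<top>" by (rule le_less_trans) simp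
    then have i2: "integrable M (\<lambda>\<omega>. (?c \<omega>)\<^sup>2)" by (intro integrableI_nonneg) auto
    then have "ennreal (expectation (\<lambda>\<omega>. (?c \<omega>)\<^sup>2)) \<le> ennreal (D / k\<^sup>2 + (expectation ?c)\<^sup>2)"
      using le by (simp add: nn_integral_eq_integral)
    then have "expectation (\<lambda>\<omega>. (?c \<omega>)\<^sup>2) \<le> D / k\<^sup>2 + (expectation ?c)\<^sup>2"
      using D(1) by (subst (asm) ennreal_le_iff) auto
    moreover have "variance ?c = expectation (\<lambda>\<omega>. (?c \<omega>)\<^sup>2) - (expectation ?c)\<^sup>2"
      using i1 i2 by (rule variance_eq)
    ultimately show ?thesis using fin i2 by simp
  qed
  \<comment> \<open>The threshold is 1 because the cell bound and the geometric sums use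
    \<open>k \<le> 1\<close>.\<close>
  show ?thesis
    by (rule exI[of _ D], rule conjI[OF D(1)], rule exI[of _ 1]) (use main in auto)
qed

end
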